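(* Let $\mathsf k$ be a field and let $U$ be a Galois $\Gamma$-ring in the invariant skew group ring $\mathcal K=\mathcal L^G$, $\mathcal L=L*\mathcal M$ (with $\mathcal M$ a group). Then $U$ is a prime PI $\mathsf k$-algebra if and only if $\mathcal K$ is a central simple algebra. In this case, $$\operatorname{Frac}(Z(U))=Z(\mathcal K),$$ the group $\mathcal M$ is necessarily finite, and $U$ and $\mathcal K$ satisfy the same polynomial identities as the matrix algebra $M_n(\operatorname{Frac}(Z(U)))$, where $n=\operatorname{PI-deg}(U)$.
   Context: Setting: $\Lambda$ is an integrally closed (commutative) domain which is a $\mathsf k$-algebra, $G$ is a finite subgroup of the group $\operatorname{Aut}_{\mathsf k}(\Lambda)$ of $\mathsf k$-algebra automorphisms and $\mathcal M$ is a submonoid (here a subgroup) of $\operatorname{Aut}_{\mathsf k}(\Lambda)$ such that (1) $\mathcal M\mathcal M^{-1}\cap G=\{e\}$; (2) $G$ acts on $\mathcal M$ by conjugation, $g\cdot\mu=g\mu g^{-1}\in\mathcal M$; (3) $\Lambda$ is a Noetherian $\Lambda^G$-module. $\mathcal M$ is assumed finitely generated. Put $L=\operatorname{Frac}\Lambda$, $\Gamma=\Lambda^G$, $K=\operatorname{Frac}\Gamma=L^G$. The ring $\mathcal L=L*\mathcal M$ is the free left $L$-module on $\mathcal M$ with multiplication $(a\mu)(b\nu)=a\,\mu(b)\,\mu\nu$. The group $G$ acts on $\mathcal L$ via $a\mu\mapsto g(a)\,(g\cdot\mu)$, and $\mathcal K=\mathcal L^G$ is the fixed ring. A Galois $\Gamma$-ring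 in $\mathcal K$ is a subring $U\subseteq\mathcal K$ containing $\Gamma$ and finitely generated as a ring over $\Gamma$ such that $KU=UK=\mathcal K$. $Z(\cdot)$ denotes the center. "Central simple algebra" means a simple ring that is finite-dimensional over its center. A $\mathsf k$-algebra $A$ is PI if some polynomial in the free associative unital algebra $\mathsf k\langle X\rangle$ with at least one monomial of maximal degree having coefficient $1$ vanishes under all substitutions from $A$. For a prime PI-algebra $R$ with center $Z$, by Posner's theorem the localization $Q$ of $R$ at $Z\setminus\{0\}$ is a finite-dimensional central simple $\operatorname{Frac}(Z)$-algebra, and $\operatorname{PI-deg}(R)=\sqrt{\dim_{\operatorname{Frac}(Z)}Q}$. *)

theory Defs
  imports
    Complex_Main
    "HOL-Library.FuncSet"
    "HOL-Library.Poly_Mapping"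
    "HOL-Computational_Algebra.Fraction_Field"
    "HOL-Computational_Algebra.Polynomial_Factorial"
    "HOL-Algebra.Embedded_Algebras"
    "HOL-Algebra.Generated_Rings"
    "HOL-Algebra.Ideal_Product"
begin

section \<open>The commutative data\<close>

text \<open>The domain \<open>\<Lambda>\<close> is the type \<open>'a\<close>, the ground field \<open>k\<close> is the type \<open>'k\<close>, and
  \<open>L = Frac \<Lambda>\<close> is the type \<open>'a fract\<close>, with \<open>\<Lambda>\<close> embedded by \<open>to_fract\<close>.\<close>

definition commutative_algebra :: "('k::field \<Rightarrow> 'a::comm_ring_1 \<Rightarrow> 'a) \<Rightarrow> bool" where
  "commutative_algebra scale \<longleftrightarrow>
     vector_space scale \<and> (\<forall>c x y. scale c (x * y) = scale c x * y)"

definition integrally_closed_domain :: "'a::idom itself \<Rightarrow> bool" where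
  "integrally_closed_domain _ \<longleftrightarrow>
     (\<forall>q :: 'a fract.
        (\<exists>p :: 'a poly. lead_coeff p = 1 \<and> poly (map_poly to_fract p) q = 0)
          \<longrightarrow> q \<in> range to_fract)"

definition aut_group :: "('k::field \<Rightarrow> 'a::comm_ring_1 \<Rightarrow> 'a) \<Rightarrow> ('a \<Rightarrow> 'a) monoid" where
  "aut_group scale =
     \<lparr> carrier = {f. bij f \<and> f 1 = 1 \<and> (\<forall>x y. f (x + y) = f x + f y) \<and>
                     (\<forall>x y. f (x * y) = f x * f y) \<and> (\<forall>c x. f (scale c x) = scale c (f x))},
       mult = (\<circ>), one = id \<rparr>"

definition invariants :: "('a \<Rightarrow> 'a) set \<Rightarrow> 'a set" where
  "invariants G = {x. \<forall>g\<in>G. g x = x}"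

text \<open>The ambient ring as a module over a subring \<open>\<Gamma>\<close> of it.\<close>

definition is_submodule :: "'a::comm_ring_1 set \<Rightarrow> 'a set \<Rightarrow> bool" where
  "is_submodule \<Gamma> N \<longleftrightarrow>
     0 \<in> N \<and> (\<forall>x\<in>N. \<forall>y\<in>N. x + y \<in> N) \<and> (\<forall>c\<in>\<Gamma>. \<forall>x\<in>N. c * x \<in> N)"

definition noetherian_over :: "'a::comm_ring_1 set \<Rightarrow> bool" where
  "noetherian_over \<Gamma> \<longleftrightarrow>
     (\<forall>N. is_submodule \<Gamma> N \<longrightarrow>
        (\<exists>S. finite S \<and> S \<subseteq> N \<and> N = {\<Sum>s\<in>S. c s * s | c. c ` S \<subseteq> \<Gamma>}))"

section \<open>The skew group ring and its invariants\<close>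

definition fract_ext :: "('a::idom \<Rightarrow> 'a) \<Rightarrow> 'a fract \<Rightarrow> 'a fract" where
  "fract_ext f q = (THE r. \<exists>a b. b \<noteq> 0 \<and> q = Fract a b \<and> r = Fract (f a) (f b))"

definition support :: "('g \<Rightarrow> 'b::zero) \<Rightarrow> 'g set" where
  "support x = {m. x m \<noteq> 0}"

text \<open>An element \<open>\<Sum> a\<^sub>\<mu> \<mu>\<close> of \<open>L * M\<close> is the finitely supported function \<open>\<mu> \<mapsto> a\<^sub>\<mu>\<close>.\<close>

definition skew_ring :: "('a::idom \<Rightarrow> 'a) set \<Rightarrow> (('a \<Rightarrow> 'a) \<Rightarrow> 'a fract) ring" where
  "skew_ring M =
     \<lparr> carrier = {x. finite (support x) \<and> support x \<subseteq> M},
       mult = (\<lambda>x y \<rho>. \<Sum>(\<mu>, \<nu>) \<in> {(\<mu>, \<nu>). \<mu> \<in> support x \<and> \<nu> \<in> support y \<and> \<mu> \<circ> \<nu> = \<rho>}.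
                  x \<mu> * fract_ext \<mu> (y \<nu>)),
       one = (\<lambda>\<mu>. if \<mu> = id then 1 else 0),
       zero = (\<lambda>_. 0),
       add = (\<lambda>x y \<mu>. x \<mu> + y \<mu>) \<rparr>"

text \<open>The action \<open>a\<mu> \<mapsto> g(a) (g \<mu> g\<inverse>)\<close>: the coefficient of the image of \<open>x\<close> at \<open>\<rho>\<close> comes
  from the coefficient of \<open>x\<close> at \<open>g\<inverse> \<rho> g\<close>.\<close>

definition skew_act ::
    "('a::idom \<Rightarrow> 'a) \<Rightarrow> (('a \<Rightarrow> 'a) \<Rightarrow> 'a fract) \<Rightarrow> ('a \<Rightarrow> 'a) \<Rightarrow> 'a fract" where
  "skew_act g x = (\<lambda>\<rho>. fract_ext g (x (inv_into UNIV g \<circ> \<rho> \<circ> g)))"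

definition invariant_skew_ring ::
    "('a::idom \<Rightarrow> 'a) set \<Rightarrow> ('a \<Rightarrow> 'a) set \<Rightarrow> (('a \<Rightarrow> 'a) \<Rightarrow> 'a fract) ring" where
  "invariant_skew_ring G M =
     (skew_ring M)\<lparr>carrier := {x \<in> carrier (skew_ring M). \<forall>g\<in>G. skew_act g x = x}\<rparr>"

definition skew_const :: "'a::idom fract \<Rightarrow> ('a \<Rightarrow> 'a) \<Rightarrow> 'a fract" where
  "skew_const a = (\<lambda>\<mu>. if \<mu> = id then a else 0)"

text \<open>The structure map \<open>k \<rightarrow> \<Lambda> \<rightarrow> L * M\<close>; its image is central and fixed by \<open>G\<close>.\<close>

definition skew_scalar :: "('k::field \<Rightarrow> 'a::idom \<Rightarrow> 'a) \<Rightarrow> 'k \<Rightarrow> ('a \<Rightarrow> 'a) \<Rightarrow> 'a fract" where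
  "skew_scalar scale c = skew_const (to_fract (scale c 1))"

text \<open>\<open>\<Gamma> = \<Lambda>\<^sup>G\<close> and \<open>K = Frac \<Gamma>\<close>, as subsets of the invariant skew ring.\<close>

definition embedded_Gamma :: "('a::idom \<Rightarrow> 'a) set \<Rightarrow> (('a \<Rightarrow> 'a) \<Rightarrow> 'a fract) set" where
  "embedded_Gamma G = {skew_const (to_fract a) | a. a \<in> invariants G}"

definition embedded_K :: "('a::idom \<Rightarrow> 'a) set \<Rightarrow> (('a \<Rightarrow> 'a) \<Rightarrow> 'a fract) set" where
  "embedded_K G = {skew_const (Fract a b) | a b. a \<in> invariants G \<and> b \<in> invariants G \<and> b \<noteq> 0}"

text \<open>\<open>ideal_prod R A B\<close> is the set of finite nonempty sums of products \<open>a b\<close> with \<open>a \<in> A\<close>,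
  \<open>b \<in> B\<close>; its definition does not require \<open>A\<close> and \<open>B\<close> to be ideals.\<close>

definition galois_ring ::
    "('a::idom \<Rightarrow> 'a) set \<Rightarrow> ('a \<Rightarrow> 'a) set \<Rightarrow> (('a \<Rightarrow> 'a) \<Rightarrow> 'a fract) set \<Rightarrow> bool" where
  "galois_ring G M U \<longleftrightarrow>
     subring U (invariant_skew_ring G M) \<and>
     embedded_Gamma G \<subseteq> U \<and>
     (\<exists>S. finite S \<and> S \<subseteq> U \<and>
        generate_ring (invariant_skew_ring G M) (embedded_Gamma G \<union> S) = U) \<and>
     ideal_prod (invariant_skew_ring G M) (embedded_K G) U = carrier (invariant_skew_ring G M) \<and>
     ideal_prod (invariant_skew_ring G M) U (embedded_K G) = carrier (invariant_skew_ring G M)"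

section \<open>Noncommutative rings\<close>

definition center :: "('r, 'm) ring_scheme \<Rightarrow> 'r set" where
  "center R = {z \<in> carrier R. \<forall>x\<in>carrier R. z \<otimes>\<^bsub>R\<^esub> x = x \<otimes>\<^bsub>R\<^esub> z}"

definition prime_ring :: "('r, 'm) ring_scheme \<Rightarrow> bool" where
  "prime_ring R \<longleftrightarrow>
     ring R \<and> \<one>\<^bsub>R\<^esub> \<noteq> \<zero>\<^bsub>R\<^esub> \<and>
     (\<forall>a\<in>carrier R. \<forall>b\<in>carrier R.
        (\<forall>r\<in>carrier R. a \<otimes>\<^bsub>R\<^esub> r \<otimes>\<^bsub>R\<^esub> b = \<zero>\<^bsub>R\<^esub>) \<longrightarrow> a = \<zero>\<^bsub>R\<^esub> \<or> b = \<zero>\<^bsub>R\<^esub>)"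

definition simple_ring :: "('r, 'm) ring_scheme \<Rightarrow> bool" where
  "simple_ring R \<longleftrightarrow>
     ring R \<and> \<one>\<^bsub>R\<^esub> \<noteq> \<zero>\<^bsub>R\<^esub> \<and> (\<forall>I. ideal I R \<longrightarrow> I = {\<zero>\<^bsub>R\<^esub>} \<or> I = carrier R)"

definition central_simple_algebra :: "('r, 'm) ring_scheme \<Rightarrow> bool" where
  "central_simple_algebra R \<longleftrightarrow>
     simple_ring R \<and> ring.finite_dimension R (center R) (carrier R)"

subsection \<open>Polynomial identities\<close>

text \<open>The free algebra \<open>k\<langle>X\<rangle>\<close> on countably many variables: its monomials are the words in the
  indices of the variables. An algebra over \<open>k\<close> is a ring \<open>R\<close> with a structure map \<open>\<eta>\<close> from
  \<open>k\<close> to the center of \<open>R\<close>.\<close>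

type_synonym 'k free_algebra = "nat list \<Rightarrow>\<^sub>0 'k"

definition word_eval :: "('r, 'm) ring_scheme \<Rightarrow> (nat \<Rightarrow> 'r) \<Rightarrow> nat list \<Rightarrow> 'r" where
  "word_eval R x w = foldr (\<lambda>i r. x i \<otimes>\<^bsub>R\<^esub> r) w \<one>\<^bsub>R\<^esub>"

definition free_eval ::
    "('r, 'm) ring_scheme \<Rightarrow> ('k::field \<Rightarrow> 'r) \<Rightarrow> (nat \<Rightarrow> 'r) \<Rightarrow> 'k free_algebra \<Rightarrow> 'r" where
  "free_eval R \<eta> x p =
     (\<Oplus>\<^bsub>R\<^esub>w\<in>Poly_Mapping.keys p. \<eta> (Poly_Mapping.lookup p w) \<otimes>\<^bsub>R\<^esub> word_eval R x w)"

definition polynomial_identities ::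
    "('r, 'm) ring_scheme \<Rightarrow> ('k::field \<Rightarrow> 'r) \<Rightarrow> 'k free_algebra set" where
  "polynomial_identities R \<eta> =
     {p. \<forall>x. range x \<subseteq> carrier R \<longrightarrow> free_eval R \<eta> x p = \<zero>\<^bsub>R\<^esub>}"

definition has_monic_leading_word :: "'k::field free_algebra \<Rightarrow> bool" where
  "has_monic_leading_word p \<longleftrightarrow>
     (\<exists>w\<in>Poly_Mapping.keys p. Poly_Mapping.lookup p w = 1 \<and>
        (\<forall>v\<in>Poly_Mapping.keys p. length v \<le> length w))"

definition PI_algebra :: "('r, 'm) ring_scheme \<Rightarrow> ('k::field \<Rightarrow> 'r) \<Rightarrow> bool" where
  "PI_algebra R \<eta> \<longleftrightarrow> (\<exists>p\<in>polynomial_identities R \<eta>. has_monic_leading_word p)"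

subsection \<open>Central localization and PI degree\<close>

text \<open>The localization of \<open>R\<close> at the nonzero elements of its center, for rings in which these
  are regular (such as prime rings); the class of \<open>(r, s)\<close> is the fraction \<open>r s\<inverse>\<close>.\<close>

definition frac_rel :: "('r, 'm) ring_scheme \<Rightarrow> (('r \<times> 'r) \<times> ('r \<times> 'r)) set" where
  "frac_rel R =
     {((r, s), (r', s')). r \<in> carrier R \<and> r' \<in> carrier R \<and>
        s \<in> center R - {\<zero>\<^bsub>R\<^esub>} \<and> s' \<in> center R - {\<zero>\<^bsub>R\<^esub>} \<and> r \<otimes>\<^bsub>R\<^esub> s' = r' \<otimes>\<^bsub>R\<^esub> s}"

definition central_localization :: "('r, 'm) ring_scheme \<Rightarrow> ('r \<times> 'r) set ring" where
  "central_localization R =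
     \<lparr> carrier = (carrier R \<times> (center R - {\<zero>\<^bsub>R\<^esub>})) // frac_rel R,
       mult = (\<lambda>X Y. \<Union>(r, s)\<in>X. \<Union>(r', s')\<in>Y.
                  frac_rel R `` {(r \<otimes>\<^bsub>R\<^esub> r', s \<otimes>\<^bsub>R\<^esub> s')}),
       one = frac_rel R `` {(\<one>\<^bsub>R\<^esub>, \<one>\<^bsub>R\<^esub>)},
       zero = frac_rel R `` {(\<zero>\<^bsub>R\<^esub>, \<one>\<^bsub>R\<^esub>)},
       add = (\<lambda>X Y. \<Union>(r, s)\<in>X. \<Union>(r', s')\<in>Y.
                  frac_rel R `` {(r \<otimes>\<^bsub>R\<^esub> s' \<oplus>\<^bsub>R\<^esub> r' \<otimes>\<^bsub>R\<^esub> s, s \<otimes>\<^bsub>R\<^esub> s')}) \<rparr>"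

definition PI_deg :: "('r, 'm) ring_scheme \<Rightarrow> real" where
  "PI_deg R =
     sqrt (real (ring.dim (central_localization R)
        {frac_rel R `` {(z, s)} | z s. z \<in> center R \<and> s \<in> center R - {\<zero>\<^bsub>R\<^esub>}}
        (carrier (central_localization R))))"

text \<open>The field of fractions, formed inside \<open>R\<close>, of a commutative subring \<open>Z\<close> whose nonzero
  elements are units of \<open>R\<close>.\<close>

definition fractions_in :: "('r, 'm) ring_scheme \<Rightarrow> 'r set \<Rightarrow> 'r set" where
  "fractions_in R Z = {a \<otimes>\<^bsub>R\<^esub> inv\<^bsub>R\<^esub> b | a b. a \<in> Z \<and> b \<in> Z - {\<zero>\<^bsub>R\<^esub>}}"

subsection \<open>Matrix rings\<close>

definition matrix_ring :: "nat \<Rightarrow> ('r, 'm) ring_scheme \<Rightarrow> (nat \<times> nat \<Rightarrow> 'r) ring" where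
  "matrix_ring n F =
     \<lparr> carrier = ({..<n} \<times> {..<n}) \<rightarrow>\<^sub>E carrier F,
       mult = (\<lambda>A B. \<lambda>(i, j)\<in>{..<n} \<times> {..<n}. \<Oplus>\<^bsub>F\<^esub>k\<in>{..<n}. A (i, k) \<otimes>\<^bsub>F\<^esub> B (k, j)),
       one = (\<lambda>(i, j)\<in>{..<n} \<times> {..<n}. if i = j then \<one>\<^bsub>F\<^esub> else \<zero>\<^bsub>F\<^esub>),
       zero = (\<lambda>(i, j)\<in>{..<n} \<times> {..<n}. \<zero>\<^bsub>F\<^esub>),
       add = (\<lambda>A B. \<lambda>(i, j)\<in>{..<n} \<times> {..<n}. A (i, j) \<oplus>\<^bsub>F\<^esub> B (i, j)) \<rparr>"

definition scalar_matrix :: "nat \<Rightarrow> ('r, 'm) ring_scheme \<Rightarrow> 'r \<Rightarrow> nat \<times> nat \<Rightarrow> 'r" where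
  "scalar_matrix n F c = (\<lambda>(i, j)\<in>{..<n} \<times> {..<n}. if i = j then c else \<zero>\<^bsub>F\<^esub>)"

end

(*
  Let \<L> = L * M act on L by (a \<mu>)(w) = a \<mu>(w). Artin's theorem for G together with
  M \<inter> G = {e} shows that distinct elements of M differ on \<Gamma>, so by Dedekind's lemma an
  element of \<L> vanishing on a line \<Gamma> w with w \<noteq> 0 is zero. Hence every Galois ring U is
  prime: a \<Gamma> b = 0 makes a vanish on \<Gamma> b(v). Both sides of the equivalence amount to M being
  finite. If M is infinite, linear algebra over L followed by averaging over G produces nonzero
  elements of U killing any given finite subset of K, and such annihilators allow one to strip a
  multilinear identity of U of its variables one after the other. If \<K> is finite-dimensional over
  its center, which lies in K, the supports of its elements stay in a fixed finite set; but every
  element of M occurs in such a support. Conversely, for finite M a system v_i in K with dual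
  functionals T_i in \<K>, T_i(v_j) = \<delta>_ij, has T_i(K) inside the fixed field F of M and G, so
  the v_i T_j are matrix units and \<K> is the full matrix ring over F of size |M|. The ring U is
  tied to \<K> by central denominators, namely norms from \<Gamma> to \<Gamma>^M.
*)

theory Submission
  imports Defs "HOL-Combinatorics.Multiset_Permutations" "HOL-Combinatorics.Permutations"
begin

section \<open>Linear algebra over a field and multilinear identities\<close>

text \<open>For finite M the matrix units come from \<K> = End_F(K): the elements of \<K> map K into
  itself, they do so F-linearly, and the action on K is faithful because M separates \<Gamma>. As G
  normalises M and meets it trivially, GM is a group of order |G||M| with fixed field F, so [K:F] =
  |M|; this is the matrix size n. In the code K is \<open>fixed_G\<close> and F is
  \<open>fixed_GM\<close>.

  That k may be finite shapes the treatment of identities. Homogeneous components of an identity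
  need not be identities then, so a multilinear one is extracted without scalars, by a signed sum
  over the sets of positions in the leading word; the term of the identity permutation keeps the
  coefficient 1. For the same reason U and \<K> cannot be compared through multilinear identities
  alone. A denominator must be pulled out of every letter of every word at once, hence it has to be
  central, and whether \<Gamma>^M is finite or infinite makes a difference. For finite M the
  polynomial showing that U is PI is the standard one of degree n^2 + 1, since \<K> has dimension
  n^2 over F.\<close>

lemma dedekind_independence:
  fixes \<phi> :: "'i \<Rightarrow> 'b::monoid_mult \<Rightarrow> 'c::field"
  assumes fin: "finite I"
    and one: "1 \<in> X" and closed: "\<And>x y. x \<in> X \<Longrightarrow> y \<in> X \<Longrightarrow> x * y \<in> X"
    and phi_one: "\<And>i. i \<in> I \<Longrightarrow> \<phi> i 1 = 1"
    and phi_mult: "\<And>i x y. i \<in> I \<Longrightarrow> x \<in> X \<Longrightarrow> y \<in> X \<Longrightarrow> \<phi> i (x * y) = \<phi> i x * \<phi> i y"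
    and distinct: "\<And>i j. i \<in> I \<Longrightarrow> j \<in> I \<Longrightarrow> i \<noteq> j \<Longrightarrow> \<exists>x\<in>X. \<phi> i x \<noteq> \<phi> j x"
    and zero: "\<And>x. x \<in> X \<Longrightarrow> (\<Sum>i\<in>I. c i * \<phi> i x) = 0"
  shows "\<forall>i\<in>I. c i = 0"
  using fin phi_one phi_mult distinct zero
proof (induction I arbitrary: c rule: finite_induct)
  case empty
  then show ?case by simp
next
  case (insert i I)
  have "c j = 0" if j: "j \<in> I" for j
  proof -
    obtain y where y: "y \<in> X" "\<phi> j y \<noteq> \<phi> i y"
      using insert.prems(3)[of j i] j insert.hyps by auto
    \<comment> \<open>Subtracting \<open>\<phi> i y\<close> times the relation at x from the
      relation at y * x removes the term of i. Only products inside X are formed, so the same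
      argument serves for X = L, K and \<Gamma>.\<close>
    have "\<forall>k\<in>I. c k * (\<phi> k y - \<phi> i y) = 0"
    proof (rule insert.IH)
      fix x assume x: "x \<in> X"
      have 1: "c i * \<phi> i x + (\<Sum>k\<in>I. c k * \<phi> k x) = 0"
        using insert.prems(4)[OF x] insert.hyps by simp
      have "c i * \<phi> i (y * x) + (\<Sum>k\<in>I. c k * \<phi> k (y * x)) = 0"
        using insert.prems(4)[of "y * x"] insert.hyps closed x y by simp
      then have 2: "c i * (\<phi> i y * \<phi> i x) + (\<Sum>k\<in>I. c k * (\<phi> k y * \<phi> k x)) = 0"
        using insert.prems(2) x y by simp
      have "(\<Sum>k\<in>I. c k * (\<phi> k y - \<phi> i y) * \<phi> k x)
          = (\<Sum>k\<in>I. c k * (\<phi> k y * \<phi> k x)) - \<phi> i y * (\<Sum>k\<in>I. c k * \<phi> k x)"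
        by (simp add: sum_distrib_left sum_subtractf algebra_simps)
      also have "\<dots> = 0"
      proof -
        have a: "(\<Sum>k\<in>I. c k * (\<phi> k y * \<phi> k x)) = - (c i * (\<phi> i y * \<phi> i x))"
          using 2 by (simp add: eq_neg_iff_add_eq_0 add.commute)
        have b: "(\<Sum>k\<in>I. c k * \<phi> k x) = - (c i * \<phi> i x)"
          using 1 by (simp add: eq_neg_iff_add_eq_0 add.commute)
        show ?thesis unfolding a b by simp
      qed
      finally show "(\<Sum>k\<in>I. c k * (\<phi> k y - \<phi> i y) * \<phi> k x) = 0" .
    qed (use insert.prems in auto)
    then show ?thesis using y j by auto
  qed
  moreover from this have "c i = 0"
    using insert.prems(4)[OF one] insert.prems(1) insert.hyps by simp
  ultimately show ?case by blast
qed

text \<open>Independence yields points v at which the square matrix of values is invertible, and b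
  is its inverse; the last clause recovers every functional on X by interpolation at these points. X
  carries no linear structure: the points are found one at a time by elimination on the
  functionals.\<close>

lemma dual_system_exists:
  fixes \<phi> :: "'i \<Rightarrow> 'b \<Rightarrow> 'c::field"
  assumes fin: "finite I"
    and ind: "\<And>c. \<forall>x\<in>X. (\<Sum>i\<in>I. c i * \<phi> i x) = 0 \<Longrightarrow> \<forall>i\<in>I. c i = 0"
  shows "\<exists>v b. v ` I \<subseteq> X \<and>
    (\<forall>i\<in>I. \<forall>j\<in>I. (\<Sum>k\<in>I. b i k * \<phi> k (v j)) = (if i = j then 1 else 0)) \<and>
    (\<forall>k\<in>I. \<forall>x\<in>X. \<phi> k x = (\<Sum>i\<in>I. \<phi> k (v i) * (\<Sum>l\<in>I. b i l * \<phi> l x)))"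
  using fin ind
proof (induction I rule: finite_induct)
  case empty
  then show ?case by auto
next
  case (insert i0 I)
  have ind_I: "\<forall>i\<in>I. c i = 0" if "\<forall>x\<in>X. (\<Sum>i\<in>I. c i * \<phi> i x) = 0" for c
  proof -
    have "(\<Sum>i\<in>I. (c(i0 := 0)) i * \<phi> i x) = (\<Sum>i\<in>I. c i * \<phi> i x)" for x
      by (rule sum.cong) (use insert.hyps in auto)
    then have "\<forall>i\<in>insert i0 I. (c(i0 := 0)) i = 0"
      by (intro insert.prems) (use that insert.hyps in simp)
    then show ?thesis using insert.hyps by (metis fun_upd_other insertCI)
  qed
  have "\<exists>v b. v ` I \<subseteq> X \<and>
      (\<forall>i\<in>I. \<forall>j\<in>I. (\<Sum>k\<in>I. b i k * \<phi> k (v j)) = (if i = j then 1 else 0)) \<and>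
      (\<forall>k\<in>I. \<forall>x\<in>X. \<phi> k x = (\<Sum>i\<in>I. \<phi> k (v i) * (\<Sum>l\<in>I. b i l * \<phi> l x)))"
    by (rule insert.IH) (rule ind_I)
  then obtain v b where vb: "v ` I \<subseteq> X"
    "\<forall>i\<in>I. \<forall>j\<in>I. (\<Sum>k\<in>I. b i k * \<phi> k (v j)) = (if i = j then 1 else 0)"
    "\<forall>k\<in>I. \<forall>x\<in>X. \<phi> k x = (\<Sum>i\<in>I. \<phi> k (v i) * (\<Sum>l\<in>I. b i l * \<phi> l x))"
    by (elim exE conjE)
  note v = vb(1) and dual = vb(2)[rule_format] and span = vb(3)[rule_format]
  define T where "T i x = (\<Sum>k\<in>I. b i k * \<phi> k x)" for i x
  \<comment> \<open>What remains of the new functional after interpolation at the old points. Its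
    coordinates d have the entry 1 at i0, so independence gives a point x0 where it does not
    vanish.\<close>
  define \<psi> where "\<psi> x = \<phi> i0 x - (\<Sum>i\<in>I. \<phi> i0 (v i) * T i x)" for x
  define d where "d k = (if k = i0 then 1 else - (\<Sum>i\<in>I. \<phi> i0 (v i) * b i k))" for k
  have psi: "\<psi> x = (\<Sum>k\<in>insert i0 I. d k * \<phi> k x)" for x
  proof -
    have "(\<Sum>i\<in>I. \<phi> i0 (v i) * T i x) = (\<Sum>i\<in>I. \<Sum>k\<in>I. \<phi> i0 (v i) * b i k * \<phi> k x)"
      by (simp add: T_def sum_distrib_left mult.assoc)
    also have "\<dots> = (\<Sum>k\<in>I. (\<Sum>i\<in>I. \<phi> i0 (v i) * b i k) * \<phi> k x)"
      by (subst sum.swap) (simp add: sum_distrib_right)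
    also have "\<dots> = - (\<Sum>k\<in>I. d k * \<phi> k x)"
      unfolding sum_negf[symmetric]
      by (rule sum.cong) (use insert.hyps in \<open>auto simp: d_def\<close>)
    finally show ?thesis using insert.hyps by (simp add: \<psi>_def d_def)
  qed
  have "\<exists>x\<in>X. \<psi> x \<noteq> 0"
  proof (rule ccontr)
    assume "\<not> (\<exists>x\<in>X. \<psi> x \<noteq> 0)"
    then have "\<forall>k\<in>insert i0 I. d k = 0" by (intro insert.prems) (simp add: psi)
    then show False by (simp add: d_def)
  qed
  then obtain x0 where x0: "x0 \<in> X" "\<psi> x0 \<noteq> 0" by blast
  have T_v: "T i (v j) = (if i = j then 1 else 0)" if "i \<in> I" "j \<in> I" for i j
    using dual that by (simp add: T_def)
  have psi_v: "\<psi> (v j) = 0" if "j \<in> I" for j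
    using that insert.hyps by (simp add: \<psi>_def T_v if_distrib sum.delta cong: if_cong sum.cong)
  define v' where "v' = v(i0 := x0)"
  \<comment> \<open>The new dual functional is \<psi> normalised at x0, and each old one is
    corrected by a multiple of \<psi> so as to vanish there. The guard at i0 replaces a junk value:
    the induction hypothesis controls b on I only.\<close>
  define b' where "b' i k = (if i = i0 then d k / \<psi> x0 else
     (if k = i0 then 0 else b i k) - T i x0 * (d k / \<psi> x0))" for i k
  define T' where "T' i x = (\<Sum>k\<in>insert i0 I. b' i k * \<phi> k x)" for i x
  have T'0: "T' i0 x = \<psi> x / \<psi> x0" for x
    by (simp add: T'_def b'_def psi sum_divide_distrib)
  have T'1: "T' i x = T i x - T i x0 * (\<psi> x / \<psi> x0)" if "i \<in> I" for i x
  proof -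
    have "i \<noteq> i0" using that insert.hyps by auto
    have "T' i x = (\<Sum>k\<in>insert i0 I. (if k = i0 then 0 else b i k) * \<phi> k x)
        - T i x0 * ((\<Sum>k\<in>insert i0 I. d k * \<phi> k x) / \<psi> x0)"
      unfolding T'_def b'_def using \<open>i \<noteq> i0\<close>
      by (simp only: if_False left_diff_distrib sum_subtractf sum_distrib_left sum_divide_distrib)
         (simp add: mult.assoc)
    also have "(\<Sum>k\<in>insert i0 I. (if k = i0 then 0 else b i k) * \<phi> k x) = T i x"
      using insert.hyps by (auto simp: T_def intro!: sum.cong)
    finally show ?thesis by (simp add: psi)
  qed
  show ?case
  proof (intro exI conjI ballI)
    show "v' ` insert i0 I \<subseteq> X" using v x0 insert.hyps by (auto simp: v'_def)
    fix i j assume i: "i \<in> insert i0 I" and j: "j \<in> insert i0 I"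
    have "T' i (v' j) = (if i = j then 1 else 0)"
      using i j x0 insert.hyps by (auto simp: T'0 T'1 v'_def T_v psi_v)
    then show "(\<Sum>k\<in>insert i0 I. b' i k * \<phi> k (v' j)) = (if i = j then 1 else 0)"
      by (simp only: T'_def)
  next
    fix k x assume k: "k \<in> insert i0 I" and x: "x \<in> X"
    have T_sum: "\<phi> k x = (if k = i0 then \<psi> x else 0) + (\<Sum>i\<in>I. \<phi> k (v i) * T i x)" if "x \<in> X" for x
      using k span[of k x] that insert.hyps by (auto simp: \<psi>_def T_def)
    have "(\<Sum>i\<in>insert i0 I. \<phi> k (v' i) * T' i x)
       = \<phi> k x0 * (\<psi> x / \<psi> x0) + (\<Sum>i\<in>I. \<phi> k (v i) * (T i x - T i x0 * (\<psi> x / \<psi> x0)))"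
      using insert.hyps by (auto simp: v'_def T'0 T'1 intro!: sum.cong)
    also have "\<dots> = (\<phi> k x0 - (\<Sum>i\<in>I. \<phi> k (v i) * T i x0)) * (\<psi> x / \<psi> x0) + (\<Sum>i\<in>I. \<phi> k (v i) * T i x)"
      by (simp add: algebra_simps sum_subtractf sum_distrib_left)
    also have "\<phi> k x0 - (\<Sum>i\<in>I. \<phi> k (v i) * T i x0) = (if k = i0 then \<psi> x0 else 0)"
      using T_sum[OF x0(1)] by simp
    also have "\<dots> * (\<psi> x / \<psi> x0) + (\<Sum>i\<in>I. \<phi> k (v i) * T i x) = \<phi> k x"
      using T_sum[OF x] x0 by simp
    finally show "\<phi> k x = (\<Sum>i\<in>insert i0 I. \<phi> k (v' i) * (\<Sum>l\<in>insert i0 I. b' i l * \<phi> l x))"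
      by (simp only: T'_def)
  qed
qed

text \<open>Gaussian elimination with one pivot per equation. The solution is kept inside a subfield
  F because the dependence behind the standard identity needs coefficients that commute with the
  operators; for annihilating elements F is all of L.\<close>

lemma homogeneous_system_solution:
  fixes a :: "'i \<Rightarrow> 'j \<Rightarrow> 'c::field"
  assumes "finite J" and "finite I" and "card J < card I"
    and "0 \<in> F" and "1 \<in> F" and "\<And>x y. x \<in> F \<Longrightarrow> y \<in> F \<Longrightarrow> x - y \<in> F"
    and "\<And>x y. x \<in> F \<Longrightarrow> y \<in> F \<Longrightarrow> x * y \<in> F" and "\<And>x y. x \<in> F \<Longrightarrow> y \<in> F \<Longrightarrow> x / y \<in> F"
    and "\<And>i j. i \<in> I \<Longrightarrow> j \<in> J \<Longrightarrow> a i j \<in> F"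
  shows "\<exists>c. range c \<subseteq> F \<and> (\<exists>i\<in>I. c i \<noteq> 0) \<and> (\<forall>j\<in>J. (\<Sum>i\<in>I. c i * a i j) = 0)"
  using assms(1-3,9)
proof (induction J arbitrary: I a rule: finite_induct)
  case empty
  then show ?case using assms(5) by (intro exI[of _ "\<lambda>_. 1"]) (auto simp: card_gt_0_iff)
next
  case (insert j J)
  note F = assms(4-8)
  show ?case
  proof (cases "\<forall>i\<in>I. a i j = 0")
    case True
    have "\<exists>c. range c \<subseteq> F \<and> (\<exists>i\<in>I. c i \<noteq> 0) \<and> (\<forall>j\<in>J. (\<Sum>i\<in>I. c i * a i j) = 0)"
      by (rule insert.IH) (use insert.prems insert.hyps in auto)
    then obtain c where c: "range c \<subseteq> F" "\<exists>i\<in>I. c i \<noteq> 0" "\<forall>j\<in>J. (\<Sum>i\<in>I. c i * a i j) = 0"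
      by (elim exE conjE)
    then show ?thesis using True by (intro exI[of _ c]) simp
  next
    case False
    then obtain i0 where i0: "i0 \<in> I" "a i0 j \<noteq> 0" by blast
    let ?I = "I - {i0}"
    have "\<exists>c. range c \<subseteq> F \<and> (\<exists>i\<in>?I. c i \<noteq> 0) \<and>
        (\<forall>l\<in>J. (\<Sum>i\<in>?I. c i * (a i l - a i j / a i0 j * a i0 l)) = 0)"
      by (rule insert.IH) (use insert.prems insert.hyps i0 F in auto)
    then obtain c where c: "range c \<subseteq> F" "\<exists>i\<in>?I. c i \<noteq> 0"
      and eq: "\<And>l. l \<in> J \<Longrightarrow> (\<Sum>i\<in>?I. c i * (a i l - a i j / a i0 j * a i0 l)) = 0"
      by blast
    define s where "s = (\<Sum>i\<in>?I. c i * (a i j / a i0 j))"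
    have add_F: "x + y \<in> F" if "x \<in> F" "y \<in> F" for x y
      using F(3)[OF that(1) F(3)[OF F(1) that(2)]] by simp
    have sum_F: "sum f A \<in> F" if "finite A" "\<And>x. x \<in> A \<Longrightarrow> f x \<in> F" for f :: "'i \<Rightarrow> 'c" and A
      using that by (induction A rule: finite_induct) (auto intro: add_F F(1))
    have "s \<in> F" unfolding s_def
    proof (rule sum_F)
      fix i assume "i \<in> ?I"
      then have "a i j / a i0 j \<in> F" using insert.prems i0 by (intro F(5)) auto
      moreover have "c i \<in> F" using c by auto
      ultimately show "c i * (a i j / a i0 j) \<in> F" by (intro F(4))
    qed (use insert.prems in simp)
    \<comment> \<open>The value at the pivot is the one forced by the equation j.\<close>
    define c' where "c' = c(i0 := - s)"
    have "range c' \<subseteq> F"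
      using c \<open>s \<in> F\<close> F(3)[OF F(1) \<open>s \<in> F\<close>] by (auto simp: c'_def)
    moreover have "\<exists>i\<in>I. c' i \<noteq> 0" using c by (auto simp: c'_def)
    moreover have "(\<Sum>i\<in>I. c' i * a i l) = 0" if l: "l \<in> insert j J" for l
    proof -
      have "(\<Sum>i\<in>I. c' i * a i l) = - s * a i0 l + (\<Sum>i\<in>?I. c i * a i l)"
        using i0 insert.prems by (simp add: sum.remove[of I i0] c'_def)
      also have "\<dots> = (\<Sum>i\<in>?I. c i * (a i l - a i j / a i0 j * a i0 l))"
        by (simp add: s_def algebra_simps sum_subtractf sum_distrib_left)
      also have "\<dots> = 0" using eq l i0 by auto
      finally show ?thesis .
    qed
    ultimately show ?thesis by blast
  qed
qed

section \<open>Multilinear identities by inclusion-exclusion\<close>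

lemma sum_neg_one_power_between:
  assumes "finite D" and "A \<subseteq> D"
  shows "(\<Sum>T\<in>{T. A \<subseteq> T \<and> T \<subseteq> D}. (-1 :: 'c::comm_ring_1) ^ card T) = (if A = D then (-1) ^ card D else 0)"
proof (cases "A = D")
  case True
  then have "{T. A \<subseteq> T \<and> T \<subseteq> D} = {D}" by auto
  with True show ?thesis by simp
next
  case False
  \<comment> \<open>Adding or removing this q pairs off the sets T, with opposite signs.\<close>
  then obtain q where q: "q \<in> D" "q \<notin> A" using assms by blast
  let ?B = "{T. A \<subseteq> T \<and> T \<subseteq> D - {q}}"
  have fin: "finite ?B" using assms by (auto intro: finite_subset[of _ "Pow D"])
  have split: "{T. A \<subseteq> T \<and> T \<subseteq> D} = ?B \<union> insert q ` ?B"
  proof (intro equalityI subsetI)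
    fix T assume T: "T \<in> {T. A \<subseteq> T \<and> T \<subseteq> D}"
    show "T \<in> ?B \<union> insert q ` ?B"
    proof (cases "q \<in> T")
      case True
      then have "T = insert q (T - {q})" "T - {q} \<in> ?B" using T q by auto
      then show ?thesis by blast
    qed (use T in auto)
  qed (use q in auto)
  have inj: "inj_on (insert q) ?B" by (auto simp: inj_on_def)
  have "(\<Sum>T\<in>insert q ` ?B. (-1 :: 'c) ^ card T) = (\<Sum>T\<in>?B. (-1) ^ card (insert q T))"
    by (simp add: sum.reindex[OF inj])
  also have "\<dots> = (\<Sum>T\<in>?B. - ((-1) ^ card T))"
  proof (rule sum.cong)
    fix T assume T: "T \<in> ?B"
    then have "finite T" "q \<notin> T" using assms by (auto intro: finite_subset)
    then show "(-1 :: 'c) ^ card (insert q T) = - ((-1) ^ card T)" by simp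
  qed simp
  finally have "(\<Sum>T\<in>insert q ` ?B. (-1 :: 'c) ^ card T) = - (\<Sum>T\<in>?B. (-1) ^ card T)"
    by (simp add: sum_negf)
  then show ?thesis unfolding split using False
    by (subst sum.union_disjoint) (use fin in auto)
qed

text \<open>Multiplying out a composition of sums means choosing a position for each letter, so the
  result runs over the liftings of u along f to words of positions. Additivity is all that moves the
  sums outwards.\<close>

lemma foldr_sum_expand:
  fixes Y :: "nat \<Rightarrow> 'b::ab_group_add \<Rightarrow> 'b"
  assumes add: "\<And>i x y. i \<in> T \<Longrightarrow> Y i (x + y) = Y i x + Y i y" and fin: "finite T"
  shows "foldr (\<lambda>i v. \<Sum>q\<in>{q\<in>T. f q = i}. Y q v) u v
     = (\<Sum>ps\<in>{ps. set ps \<subseteq> T \<and> map f ps = u}. foldr Y ps v)"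
proof (induction u)
  case Nil
  have "{ps. set ps \<subseteq> T \<and> map f ps = []} = {[]}" by auto
  then show ?case by simp
next
  case (Cons i u)
  let ?A = "{ps. set ps \<subseteq> T \<and> map f ps = u}"
  let ?Q = "{q\<in>T. f q = i}"
  have zero: "Y q 0 = 0" if "q \<in> T" for q using add[OF that, of 0 0] by simp
  have Y_sum: "Y q (sum g A) = (\<Sum>a\<in>A. Y q (g a))" if "q \<in> T" for q g and A :: "nat list set"
    by (induction A rule: infinite_finite_induct) (use that in \<open>auto simp: zero add\<close>)
  have eq: "{ps. set ps \<subseteq> T \<and> map f ps = i # u} = (\<lambda>(q, ps). q # ps) ` (?Q \<times> ?A)"
    by (force simp: map_eq_Cons_conv)
  have "foldr (\<lambda>i v. \<Sum>q\<in>{q\<in>T. f q = i}. Y q v) (i # u) v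
      = (\<Sum>q\<in>?Q. Y q (\<Sum>ps\<in>?A. foldr Y ps v))" by (simp add: Cons.IH)
  also have "\<dots> = (\<Sum>q\<in>?Q. \<Sum>ps\<in>?A. Y q (foldr Y ps v))"
    by (rule sum.cong) (auto simp: Y_sum)
  also have "\<dots> = (\<Sum>(q, ps)\<in>?Q \<times> ?A. Y q (foldr Y ps v))"
    by (rule sum.cartesian_product)
  also have "\<dots> = (\<Sum>ps\<in>{ps. set ps \<subseteq> T \<and> map f ps = i # u}. foldr Y ps v)"
    unfolding eq by (subst sum.reindex) (auto simp: inj_on_def case_prod_unfold)
  finally show ?case .
qed

text \<open>The operator side of \<open>free_eval\<close>, stated for plain functions on a field so
  that the combinatorics of identities stays free of ring structures; \<open>\<kappa>\<close> embeds
  the scalars.\<close>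

definition operator_eval :: "('k::field \<Rightarrow> 'b::field) \<Rightarrow> (nat \<Rightarrow> 'b \<Rightarrow> 'b) \<Rightarrow> 'k free_algebra \<Rightarrow> 'b \<Rightarrow> 'b" where
  "operator_eval \<kappa> X p v = (\<Sum>w\<in>Poly_Mapping.keys p. \<kappa> (Poly_Mapping.lookup p w) * foldr X w v)"

text \<open>Substitute for the \<open>i\<close>-th variable the sum of the \<open>Y q\<close> over all positions \<open>q\<close> of the leading
  word carrying \<open>i\<close>; inclusion-exclusion over the set of positions used isolates the part which is
  linear in every \<open>Y q\<close>.\<close>

lemma multilinear_identity:
  fixes S :: "('b::field \<Rightarrow> 'b) set" and p :: "'k::field free_algebra"
  assumes S_add: "\<And>Z x y. Z \<in> S \<Longrightarrow> Z (x + y) = Z x + Z y"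
    and S_zero: "(\<lambda>_. 0) \<in> S" and S_plus: "\<And>Y Z. Y \<in> S \<Longrightarrow> Z \<in> S \<Longrightarrow> (\<lambda>v. Y v + Z v) \<in> S"
    and ident: "\<And>X v. range X \<subseteq> S \<Longrightarrow> operator_eval \<kappa> X p v = 0"
    and len: "\<And>u. u \<in> Poly_Mapping.keys p \<Longrightarrow> length u \<le> length w"
    and kappa: "\<kappa> 0 = 0"
    and Y: "\<And>i. i < length w \<Longrightarrow> Y i \<in> S"
  shows "(\<Sum>ps\<in>permutations_of_set {..<length w}.
            \<kappa> (Poly_Mapping.lookup p (map ((!) w) ps)) * foldr Y ps v) = 0"
proof -
  let ?d = "length w"
  let ?D = "{..<?d}"
  let ?K = "Poly_Mapping.keys p"
  define c where "c u = \<kappa> (Poly_Mapping.lookup p u)" for u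
  define X where "X T i v = (\<Sum>q\<in>{q\<in>T. w ! q = i}. Y q v)" for T i v
  define A where "A T u = {ps. set ps \<subseteq> T \<and> map ((!) w) ps = u}" for T u
  have sum_S: "(\<lambda>v. \<Sum>q\<in>Q. Y q v) \<in> S" if "finite Q" "Q \<subseteq> ?D" for Q
    using that by (induction Q rule: finite_induct) (auto simp: S_zero intro!: S_plus Y)
  have A_fin: "finite (A T u)" if "T \<subseteq> ?D" for T u
  proof (rule finite_subset)
    show "A T u \<subseteq> {ps. set ps \<subseteq> ?D \<and> length ps = length u}" using that by (auto simp: A_def)
    show "finite {ps. set ps \<subseteq> ?D \<and> length ps = length u}" by (rule finite_lists_length_eq) simp
  qed
  have X_S: "range (X T) \<subseteq> S" if "T \<subseteq> ?D" for T
    using that sum_S[of "{q\<in>T. w ! q = i}" for i]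
    by (auto simp: X_def[abs_def] intro!: sum_S finite_subset[of _ ?D])
  have expand: "(\<Sum>u\<in>?K. c u * (\<Sum>ps\<in>A T u. foldr Y ps v)) = 0" if T: "T \<subseteq> ?D" for T
  proof -
    have "foldr (X T) u v = (\<Sum>ps\<in>A T u. foldr Y ps v)" for u
      unfolding X_def[abs_def] A_def
      by (rule foldr_sum_expand) (use T Y S_add finite_subset[OF T] in auto)
    then show ?thesis using ident[OF X_S[OF T], of v] by (simp add: operator_eval_def c_def)
  qed
  have "0 = (\<Sum>T\<in>Pow ?D. (-1) ^ card T * (\<Sum>u\<in>?K. c u * (\<Sum>ps\<in>A T u. foldr Y ps v)))"
    by (simp add: expand)
  also have "\<dots> = (\<Sum>u\<in>?K. c u * (\<Sum>T\<in>Pow ?D. (-1) ^ card T * (\<Sum>ps\<in>A T u. foldr Y ps v)))"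
    unfolding sum_distrib_left by (subst sum.swap) (simp add: ac_simps)
  also have "\<dots> = (\<Sum>u\<in>?K. c u * ((-1) ^ ?d * (\<Sum>ps\<in>{ps\<in>A ?D u. set ps = ?D}. foldr Y ps v)))"
  proof (intro sum.cong refl arg_cong2[of _ _ _ _ "(*)"])
    fix u
    have "(\<Sum>T\<in>Pow ?D. (-1) ^ card T * (\<Sum>ps\<in>A T u. foldr Y ps v))
        = (\<Sum>T\<in>Pow ?D. \<Sum>ps\<in>A ?D u. if set ps \<subseteq> T then (-1) ^ card T * foldr Y ps v else 0)"
    proof (rule sum.cong)
      fix T assume "T \<in> Pow ?D"
      then have "A T u = {ps \<in> A ?D u. set ps \<subseteq> T}" by (auto simp: A_def)
      then show "(-1) ^ card T * (\<Sum>ps\<in>A T u. foldr Y ps v)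
          = (\<Sum>ps\<in>A ?D u. if set ps \<subseteq> T then (-1) ^ card T * foldr Y ps v else 0)"
        by (simp add: sum_distrib_left sum.inter_filter A_fin if_distrib cong: if_cong)
    qed simp
    also have "\<dots> = (\<Sum>ps\<in>A ?D u. \<Sum>T\<in>Pow ?D. if set ps \<subseteq> T then (-1) ^ card T * foldr Y ps v else 0)"
      by (rule sum.swap)
    \<comment> \<open>After the swap each word of positions carries the alternating sum over all T
      containing its letters, which vanishes unless every position is used.\<close>
    also have "\<dots> = (\<Sum>ps\<in>A ?D u. if set ps = ?D then (-1) ^ ?d * foldr Y ps v else 0)"
    proof (rule sum.cong)
      fix ps assume ps: "ps \<in> A ?D u"
      have "(\<Sum>T\<in>Pow ?D. if set ps \<subseteq> T then (-1) ^ card T * foldr Y ps v else 0)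
          = (\<Sum>T\<in>{T. set ps \<subseteq> T \<and> T \<subseteq> ?D}. (-1) ^ card T * foldr Y ps v)"
        by (simp add: sum.inter_filter[symmetric] conj_commute)
      also have "\<dots> = (\<Sum>T\<in>{T. set ps \<subseteq> T \<and> T \<subseteq> ?D}. (-1) ^ card T) * foldr Y ps v"
        by (simp add: sum_distrib_right)
      also have "\<dots> = (if set ps = ?D then (-1) ^ ?d * foldr Y ps v else 0)"
        using ps by (subst sum_neg_one_power_between) (auto simp: A_def)
      finally show "(\<Sum>T\<in>Pow ?D. if set ps \<subseteq> T then (-1) ^ card T * foldr Y ps v else 0)
          = (if set ps = ?D then (-1) ^ ?d * foldr Y ps v else 0)" .
    qed simp
    also have "\<dots> = (-1) ^ ?d * (\<Sum>ps\<in>{ps\<in>A ?D u. set ps = ?D}. foldr Y ps v)"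
      by (simp add: sum_distrib_left sum.inter_filter A_fin if_distrib cong: if_cong)
    finally show "(\<Sum>T\<in>Pow ?D. (-1) ^ card T * (\<Sum>ps\<in>A T u. foldr Y ps v))
        = (-1) ^ ?d * (\<Sum>ps\<in>{ps\<in>A ?D u. set ps = ?D}. foldr Y ps v)" .
  qed
  also have "\<dots> = (-1) ^ ?d * (\<Sum>u\<in>?K. \<Sum>ps\<in>{ps\<in>A ?D u. set ps = ?D}. c u * foldr Y ps v)"
    by (simp add: sum_distrib_left ac_simps)
  finally have 0: "(\<Sum>u\<in>?K. \<Sum>ps\<in>{ps\<in>A ?D u. set ps = ?D}. c u * foldr Y ps v) = 0" by simp
  let ?P = "permutations_of_set ?D"
  let ?P' = "{ps\<in>?P. map ((!) w) ps \<in> ?K}"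
  have A_perm: "{ps\<in>A ?D u. set ps = ?D} = {ps\<in>?P'. map ((!) w) ps = u}" if u: "u \<in> ?K" for u
  proof (intro equalityI subsetI)
    fix ps assume ps: "ps \<in> {ps\<in>A ?D u. set ps = ?D}"
    \<comment> \<open>Maximality of the leading word enters here: a word of at most d letters that
      uses all d positions uses each exactly once, so it is a permutation.\<close>
    have "length ps \<le> ?d" using len[OF u] ps by (auto simp: A_def)
    moreover have "card (set ps) = ?d" using ps by simp
    ultimately have "distinct ps" using card_length[of ps] by (auto intro: card_distinct)
    then show "ps \<in> {ps\<in>?P'. map ((!) w) ps = u}"
      using ps u by (auto simp: A_def permutations_of_set_def)
  qed (auto simp: A_def permutations_of_set_def)
  have "(\<Sum>ps\<in>?P. c (map ((!) w) ps) * foldr Y ps v) = (\<Sum>ps\<in>?P'. c (map ((!) w) ps) * foldr Y ps v)"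
    by (rule sum.mono_neutral_right) (auto simp: c_def kappa in_keys_iff)
  also have "\<dots> = (\<Sum>u\<in>?K. \<Sum>ps\<in>{ps\<in>?P'. map ((!) w) ps = u}. c (map ((!) w) ps) * foldr Y ps v)"
    by (rule sum.group[symmetric]) auto
  also have "\<dots> = (\<Sum>u\<in>?K. \<Sum>ps\<in>{ps\<in>A ?D u. set ps = ?D}. c u * foldr Y ps v)"
    by (intro sum.cong refl) (auto simp: A_perm)
  finally show ?thesis using 0 by (simp add: c_def)
qed

section \<open>Alternating sums and the standard polynomial\<close>

lemma alternating_sum_eq_0:
  fixes Y :: "nat \<Rightarrow> 'b::field \<Rightarrow> 'b"
  assumes ab: "a < N" "b < N" "a \<noteq> b" and eq: "Y a = Y b"
  shows "(\<Sum>\<sigma> | \<sigma> permutes {..<N}. of_int (sign \<sigma>) * foldr Y (map \<sigma> [0..<N]) v) = 0"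
proof -
  let ?\<tau> = "Transposition.transpose a b"
  let ?P = "{\<sigma>. \<sigma> permutes {..<N}}"
  define f where "f \<sigma> = foldr Y (map \<sigma> [0..<N]) v" for \<sigma> :: "nat \<Rightarrow> nat"
  have tau: "?\<tau> permutes {..<N}" using ab by (intro permutes_swap_id) auto
  have Yt: "Y (?\<tau> i) = Y i" for i using eq by (simp add: Transposition.transpose_def)
  have f_tau: "f (?\<tau> \<circ> \<sigma>) = f \<sigma>" for \<sigma>
    by (simp add: f_def foldr_map comp_def Yt)
  have fin: "finite ?P" by (rule finite_permutations) simp
  have sgn: "sign (?\<tau> \<circ> \<sigma>) = - sign \<sigma>" if "\<sigma> \<in> ?P" for \<sigma>
  proof -
    have "permutation \<sigma>" using that by (auto intro: permutes_imp_permutation[of "{..<N}"])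
    then show ?thesis using ab by (simp add: sign_compose permutation_swap_id sign_swap_id)
  qed
  \<comment> \<open>Even permutations are matched with odd ones, instead of deducing s = - s, so
    that characteristic 2 is covered.\<close>
  let ?E = "{\<sigma>\<in>?P. sign \<sigma> = 1}" and ?O = "{\<sigma>\<in>?P. sign \<sigma> = - 1}"
  have bij: "bij_betw ((\<circ>) ?\<tau>) ?E ?O"
  proof (rule bij_betw_byWitness[where f' = "(\<circ>) ?\<tau>"])
    show "(\<circ>) ?\<tau> ` ?E \<subseteq> ?O" using sgn tau by (auto intro!: permutes_compose)
    show "(\<circ>) ?\<tau> ` ?O \<subseteq> ?E" using sgn tau by (auto intro!: permutes_compose)
  qed (auto simp: fun_eq_iff)
  have split: "?P = ?E \<union> ?O" by (auto simp: sign_def)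
  have "(\<Sum>\<sigma>\<in>?P. of_int (sign \<sigma>) * f \<sigma>) = (\<Sum>\<sigma>\<in>?E. of_int (sign \<sigma>) * f \<sigma>) + (\<Sum>\<sigma>\<in>?O. of_int (sign \<sigma>) * f \<sigma>)"
  proof -
    have "(\<Sum>\<sigma>\<in>?E \<union> ?O. of_int (sign \<sigma>) * f \<sigma>) = (\<Sum>\<sigma>\<in>?E. of_int (sign \<sigma>) * f \<sigma>) + (\<Sum>\<sigma>\<in>?O. of_int (sign \<sigma>) * f \<sigma>)"
      by (rule sum.union_disjoint) (use fin in auto)
    then show ?thesis by (simp only: split[symmetric])
  qed
  also have "(\<Sum>\<sigma>\<in>?O. of_int (sign \<sigma>) * f \<sigma>) = (\<Sum>\<sigma>\<in>?E. of_int (sign (?\<tau> \<circ> \<sigma>)) * f (?\<tau> \<circ> \<sigma>))"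
    by (rule sum.reindex_bij_betw[OF bij, symmetric])
  also have "\<dots> = - (\<Sum>\<sigma>\<in>?E. of_int (sign \<sigma>) * f \<sigma>)"
    unfolding sum_negf[symmetric] by (rule sum.cong) (auto simp: sgn f_tau)
  finally show ?thesis by (simp add: f_def)
qed

text \<open>The operators to the left of the slot j are additive and commute with the scalars
  \<open>c k\<close>, so a sum placed there moves outwards; distinctness ensures that the slot
  occurs only once.\<close>

lemma foldr_slot_linear:
  fixes Y :: "nat \<Rightarrow> 'b::field \<Rightarrow> 'b"
  assumes "distinct ps" and "j \<in> set ps" and "finite I"
    and lin: "\<And>i x y. i \<in> set ps \<Longrightarrow> Y i (x + y) = Y i x + Y i y"
      "\<And>i k x. i \<in> set ps \<Longrightarrow> k \<in> I \<Longrightarrow> Y i (c k * x) = c k * Y i x"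
  shows "foldr (Y(j := \<lambda>v. \<Sum>k\<in>I. c k * Z k v)) ps v = (\<Sum>k\<in>I. c k * foldr (Y(j := Z k)) ps v)"
  using assms(1,2) lin
proof (induction ps)
  case Nil
  then show ?case by simp
next
  case (Cons q ps)
  show ?case
  proof (cases "q = j")
    case True
    have eq: "foldr (Y(j := W)) ps v = foldr Y ps v" for W
      by (rule foldr_cong) (use Cons.prems True in auto)
    show ?thesis using True by (simp only: foldr.simps comp_apply eq fun_upd_same)
  next
    case False
    then have zero: "Y q 0 = 0"
      using Cons.prems(3)[of q 0 0] by (metis add_0 add_cancel_right_right list.set_intros(1))
    have "Y q (x + y) = Y q x + Y q y" for x y by (rule Cons.prems(3)) simp
    then have "Y q (sum g I) = (\<Sum>k\<in>I. Y q (g k))" for g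
      by (induction I rule: infinite_finite_induct) (simp_all add: zero)
    moreover have "foldr (Y(j := \<lambda>v. \<Sum>k\<in>I. c k * Z k v)) ps v = (\<Sum>k\<in>I. c k * foldr (Y(j := Z k)) ps v)"
      by (rule Cons.IH) (use Cons.prems False in auto)
    ultimately show ?thesis using False Cons.prems(4)[of q]
      by (simp add: fun_upd_other del: fun_upd_apply)
  qed
qed

text \<open>Put the vanishing combination into the slot j. Expanding it leaves only the multiple by
  \<open>c j\<close> of the original sum, because every other term repeats an operator.\<close>

lemma standard_sum_eq_0:
  fixes Y :: "nat \<Rightarrow> 'b::field \<Rightarrow> 'b"
  assumes dep: "\<And>v. (\<Sum>k<N. c k * Y k v) = 0" and j: "j < N" "c j \<noteq> 0"
    and lin: "\<And>i x y. i < N \<Longrightarrow> Y i (x + y) = Y i x + Y i y"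
      "\<And>i k x. i < N \<Longrightarrow> k < N \<Longrightarrow> Y i (c k * x) = c k * Y i x"
  shows "(\<Sum>\<sigma> | \<sigma> permutes {..<N}. of_int (sign \<sigma>) * foldr Y (map \<sigma> [0..<N]) v) = 0"
proof -
  let ?P = "{\<sigma>. \<sigma> permutes {..<N}}"
  define s where "s W = (\<Sum>\<sigma>\<in>?P. of_int (sign \<sigma>) * foldr W (map \<sigma> [0..<N]) v)" for W :: "nat \<Rightarrow> 'b \<Rightarrow> 'b"
  have perm: "distinct (map \<sigma> [0..<N])" "set (map \<sigma> [0..<N]) = {..<N}" if "\<sigma> \<in> ?P" for \<sigma>
    using that permutes_image[of \<sigma> "{..<N}"]
    by (auto simp: distinct_map atLeast0LessThan intro: permutes_inj_on)
  have slot: "foldr (Y(j := \<lambda>v. \<Sum>k<N. c k * Z k v)) (map \<sigma> [0..<N]) v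
      = (\<Sum>k<N. c k * foldr (Y(j := Z k)) (map \<sigma> [0..<N]) v)" if "\<sigma> \<in> ?P" for \<sigma> Z
    by (rule foldr_slot_linear) (use perm[OF that] lin j in \<open>auto simp del: set_map\<close>)
  have "s (Y(j := \<lambda>v. \<Sum>k<N. c k * Y k v)) = (\<Sum>k<N. c k * s (Y(j := Y k)))"
    unfolding s_def sum_distrib_left
    by (subst sum.swap) (auto intro!: sum.cong simp: slot sum_distrib_left ac_simps simp del: foldr_map)
  also have "\<dots> = (\<Sum>k\<in>{j}. c k * s (Y(j := Y k)))"
  proof (rule sum.mono_neutral_right)
    show "\<forall>k\<in>{..<N} - {j}. c k * s (Y(j := Y k)) = 0"
    proof
      fix k assume k: "k \<in> {..<N} - {j}"
      have "s (Y(j := Y k)) = 0" unfolding s_def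
        by (rule alternating_sum_eq_0[of j _ k]) (use k j in auto)
      then show "c k * s (Y(j := Y k)) = 0" by simp
    qed
  qed (use j in auto)
  also have "\<dots> = c j * s Y" by simp
  finally have 1: "s (Y(j := \<lambda>v. \<Sum>k<N. c k * Y k v)) = c j * s Y" .
  \<comment> \<open>Writing the zero operator as an empty combination lets
    \<open>foldr_slot_linear\<close> also show that every word containing it vanishes.\<close>
  have "(\<lambda>v. \<Sum>k<N. c k * Y k v) = (\<lambda>v. \<Sum>k\<in>({}::nat set). c k * Y k v)" by (simp add: dep)
  moreover have "foldr (Y(j := \<lambda>v. \<Sum>k\<in>({}::nat set). c k * Y k v)) (map \<sigma> [0..<N]) v = 0" if "\<sigma> \<in> ?P" for \<sigma>
    by (subst foldr_slot_linear) (use perm[OF that] lin j in \<open>auto simp del: set_map\<close>)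
  ultimately have "s (Y(j := \<lambda>v. \<Sum>k<N. c k * Y k v)) = 0" by (simp add: s_def del: foldr_map)
  with 1 j show ?thesis by (simp add: s_def)
qed

section \<open>Ring automorphisms and fixed fields\<close>

text \<open>Linearity over k is kept apart: it survives only as the statement that the scalars
  \<open>\<kappa> c\<close> are fixed.\<close>

definition ring_aut :: "('a::comm_ring_1 \<Rightarrow> 'a) \<Rightarrow> bool" where
  "ring_aut f \<longleftrightarrow> bij f \<and> f 1 = 1 \<and> (\<forall>x y. f (x + y) = f x + f y) \<and> (\<forall>x y. f (x * y) = f x * f y)"

lemma ring_autD:
  assumes "ring_aut f"
  shows "bij f" "f 1 = 1" "f 0 = 0" "f (x + y) = f x + f y" "f (x * y) = f x * f y" "f x = 0 \<longleftrightarrow> x = 0"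
proof -
  show "bij f" "f 1 = 1" "f (x + y) = f x + f y" "f (x * y) = f x * f y"
    using assms by (auto simp: ring_aut_def)
  have "f (0 + 0) = f 0 + f 0" using assms unfolding ring_aut_def by blast
  then show 0: "f 0 = 0" by simp
  show "f x = 0 \<longleftrightarrow> x = 0"
    using 0 \<open>bij f\<close> by (metis bij_is_inj injD)
qed

lemma ring_aut_id: "ring_aut id" by (simp add: ring_aut_def)

lemma ring_aut_inv: "ring_aut f \<Longrightarrow> ring_aut (inv_into UNIV f)"
  unfolding ring_aut_def
proof (intro conjI allI; elim conjE)
  assume f: "bij f" "f 1 = 1" and add: "\<forall>x y. f (x + y) = f x + f y"
    and mult: "\<forall>x y. f (x * y) = f x * f y"
  have inv_eq: "inv_into UNIV f y = x" if "f x = y" for x y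
    using that f(1) by (simp add: bij_is_inj inv_f_eq)
  have f_inv: "f (inv_into UNIV f y) = y" for y
    using f(1) by (simp add: bij_is_surj surj_f_inv_f)
  show "bij (inv_into UNIV f)" using f(1) by (rule bij_imp_bij_inv)
  show "inv_into UNIV f 1 = 1" by (rule inv_eq) (rule f(2))
  fix x y
  show "inv_into UNIV f (x + y) = inv_into UNIV f x + inv_into UNIV f y"
    by (rule inv_eq) (simp add: add f_inv)
  show "inv_into UNIV f (x * y) = inv_into UNIV f x * inv_into UNIV f y"
    by (rule inv_eq) (simp add: mult f_inv)
qed

lemma ring_aut_prod:
  assumes "ring_aut f" shows "f (\<Prod>i\<in>I. a i) = (\<Prod>i\<in>I. f (a i))"
  by (induction I rule: infinite_finite_induct) (simp_all add: ring_autD[OF assms])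

text \<open>Independence of the representing fraction, which makes the definite description in
  \<open>fract_ext\<close> meaningful. All later facts on the extension to L are computed from
  it.\<close>

lemma fract_ext_Fract:
  assumes f: "ring_aut f" and b: "b \<noteq> 0"
  shows "fract_ext f (Fract a b) = Fract (f a) (f b)"
  unfolding fract_ext_def
proof (rule the_equality)
  fix r assume "\<exists>c d. d \<noteq> 0 \<and> Fract a b = Fract c d \<and> r = Fract (f c) (f d)"
  then obtain c d where d: "d \<noteq> 0" "Fract a b = Fract c d" "r = Fract (f c) (f d)" by blast
  then have "a * d = c * b" using b by (simp add: eq_fract)
  then have "f a * f d = f c * f b" using ring_autD(5)[OF f] by metis
  then show "r = Fract (f a) (f b)" using d b by (simp add: eq_fract ring_autD(6)[OF f])
qed (use b in blast)

lemma fract_ext_to_fract: "ring_aut f \<Longrightarrow> fract_ext f (to_fract a) = to_fract (f a)"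
  by (simp add: to_fract_def fract_ext_Fract ring_autD(2))

lemma fract_ext_add: "ring_aut f \<Longrightarrow> fract_ext f (p + q) = fract_ext f p + fract_ext f q"
  by (cases p, cases q) (simp add: fract_ext_Fract ring_autD)

lemma fract_ext_mult: "ring_aut f \<Longrightarrow> fract_ext f (p * q) = fract_ext f p * fract_ext f q"
  by (cases p, cases q) (simp add: fract_ext_Fract ring_autD)

lemma fract_ext_0: "ring_aut f \<Longrightarrow> fract_ext f 0 = 0"
  using fract_ext_to_fract[of f 0] by (simp add: ring_autD)

lemma fract_ext_1: "ring_aut f \<Longrightarrow> fract_ext f 1 = 1"
  using fract_ext_to_fract[of f 1] by (simp add: ring_autD)

lemma fract_ext_uminus: "ring_aut f \<Longrightarrow> fract_ext f (- p) = - fract_ext f p"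
  using fract_ext_add[of f p "- p"] by (simp add: fract_ext_0 eq_neg_iff_add_eq_0 add.commute)

lemma fract_ext_diff: "ring_aut f \<Longrightarrow> fract_ext f (p - q) = fract_ext f p - fract_ext f q"
  using fract_ext_add[of f p "- q"] by (simp add: fract_ext_uminus)

lemma fract_ext_sum: "ring_aut f \<Longrightarrow> fract_ext f (\<Sum>i\<in>I. a i) = (\<Sum>i\<in>I. fract_ext f (a i))"
  by (induction I rule: infinite_finite_induct) (simp_all add: fract_ext_0 fract_ext_add)

lemma ring_aut_comp: "ring_aut f \<Longrightarrow> ring_aut g \<Longrightarrow> ring_aut (f \<circ> g)"
  by (simp add: ring_aut_def bij_comp)

lemma fract_ext_comp: "ring_aut f \<Longrightarrow> ring_aut g \<Longrightarrow> fract_ext (f \<circ> g) q = fract_ext f (fract_ext g q)"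
  by (cases q) (simp add: fract_ext_Fract ring_autD(6) ring_aut_comp)

lemma fract_ext_id: "fract_ext id q = q"
  by (cases q) (simp add: fract_ext_Fract ring_aut_id)

lemma fract_ext_inv:
  assumes "ring_aut f"
  shows "fract_ext f (fract_ext (inv_into UNIV f) q) = q" "fract_ext (inv_into UNIV f) (fract_ext f q) = q"
proof -
  have "f \<circ> inv_into UNIV f = id" "inv_into UNIV f \<circ> f = id"
    using ring_autD(1)[OF assms] by (auto simp: fun_eq_iff bij_is_surj surj_f_inv_f bij_is_inj)
  then show "fract_ext f (fract_ext (inv_into UNIV f) q) = q" "fract_ext (inv_into UNIV f) (fract_ext f q) = q"
    using fract_ext_comp[OF assms ring_aut_inv[OF assms]] fract_ext_comp[OF ring_aut_inv[OF assms] assms]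
    by (metis fract_ext_id)+
qed

lemma fract_ext_eq_0_iff: "ring_aut f \<Longrightarrow> fract_ext f q = 0 \<longleftrightarrow> q = 0"
  by (metis fract_ext_0 fract_ext_inv(2) ring_aut_inv)

lemma fract_ext_inverse: 
  assumes f: "ring_aut f" shows "fract_ext f (inverse q) = inverse (fract_ext f q)"
proof (cases "q = 0")
  case False
  then have "fract_ext f (inverse q) * fract_ext f q = 1"
    using fract_ext_mult[OF f, of "inverse q" q] by (simp add: fract_ext_1[OF f])
  then show ?thesis by (metis inverse_unique mult.commute)
qed (simp add: fract_ext_0[OF f])

lemma fract_ext_divide: "ring_aut f \<Longrightarrow> fract_ext f (p / q) = fract_ext f p / fract_ext f q"
  by (simp add: divide_inverse fract_ext_mult fract_ext_inverse)

lemma fract_ext_separates: 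
  "ring_aut f \<Longrightarrow> ring_aut g \<Longrightarrow> f \<noteq> g \<Longrightarrow> \<exists>q\<in>UNIV. fract_ext f q \<noteq> fract_ext g q"
  by (metis UNIV_I ext fract_ext_to_fract to_fract_eq_iff)

lemma fract_ext_independence:
  assumes "finite H" and "\<And>h. h \<in> H \<Longrightarrow> ring_aut h"
    and "1 \<in> X" and "\<And>x y. x \<in> X \<Longrightarrow> y \<in> X \<Longrightarrow> x * y \<in> X"
    and "\<And>g h. g \<in> H \<Longrightarrow> h \<in> H \<Longrightarrow> g \<noteq> h \<Longrightarrow> \<exists>x\<in>X. fract_ext g x \<noteq> fract_ext h x"
    and "\<And>x. x \<in> X \<Longrightarrow> (\<Sum>h\<in>H. c h * fract_ext h x) = 0"
  shows "\<forall>h\<in>H. c h = 0"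
  by (rule dedekind_independence[where \<phi> = fract_ext and X = X])
     (use assms in \<open>auto simp: fract_ext_1 fract_ext_mult\<close>)

text \<open>Injectivity of a translation on a finite set already gives surjectivity, so closure
  under composition makes H a group.\<close>

lemma finite_group_translation:
  fixes H :: "('a::idom \<Rightarrow> 'a) set"
  assumes "finite H" and aut: "\<And>h. h \<in> H \<Longrightarrow> ring_aut h"
    and comp: "\<And>g h. g \<in> H \<Longrightarrow> h \<in> H \<Longrightarrow> g \<circ> h \<in> H" and h: "h \<in> H"
  shows "inj_on ((\<circ>) h) H" and "(\<circ>) h ` H = H"
proof -
  show inj: "inj_on ((\<circ>) h) H"
    using fun.inj_map[OF bij_is_inj[OF ring_autD(1)[OF aut[OF h]]]] by (rule inj_on_subset) simp
  show "(\<circ>) h ` H = H"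
    by (rule endo_inj_surj[OF assms(1) _ inj]) (use comp h in auto)
qed

text \<open>The dual functionals take values fixed by H: composing one with h gives again a
  combination of elements of H, such a combination is determined on X by its values at the points v,
  and h fixes the values 0 and 1. Artin's theorem takes X = L, the matrix units take H = M and X =
  K.\<close>

lemma finite_group_dual_system:
  fixes H :: "('a::idom \<Rightarrow> 'a) set"
  assumes fin: "finite H" and aut: "\<And>h. h \<in> H \<Longrightarrow> ring_aut h" and id: "id \<in> H"
    and comp: "\<And>g h. g \<in> H \<Longrightarrow> h \<in> H \<Longrightarrow> g \<circ> h \<in> H"
    and one: "1 \<in> X" and closed: "\<And>x y. x \<in> X \<Longrightarrow> y \<in> X \<Longrightarrow> x * y \<in> X"
    and distinct: "\<And>g h. g \<in> H \<Longrightarrow> h \<in> H \<Longrightarrow> g \<noteq> h \<Longrightarrow> \<exists>x\<in>X. fract_ext g x \<noteq> fract_ext h x"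
  shows "\<exists>v b. v ` H \<subseteq> X \<and>
    (\<forall>i\<in>H. \<forall>j\<in>H. (\<Sum>k\<in>H. b i k * fract_ext k (v j)) = (if i = j then 1 else 0)) \<and>
    (\<forall>c. \<forall>x\<in>X. (\<Sum>k\<in>H. c k * fract_ext k x)
        = (\<Sum>i\<in>H. (\<Sum>k\<in>H. c k * fract_ext k (v i)) * (\<Sum>k\<in>H. b i k * fract_ext k x))) \<and>
    (\<forall>h\<in>H. \<forall>i\<in>H. \<forall>x\<in>X.
        fract_ext h (\<Sum>k\<in>H. b i k * fract_ext k x) = (\<Sum>k\<in>H. b i k * fract_ext k x))"
proof -
  have "\<exists>v b. v ` H \<subseteq> X \<and>
    (\<forall>i\<in>H. \<forall>j\<in>H. (\<Sum>k\<in>H. b i k * fract_ext k (v j)) = (if i = j then 1 else 0)) \<and>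
    (\<forall>k\<in>H. \<forall>x\<in>X. fract_ext k x = (\<Sum>i\<in>H. fract_ext k (v i) * (\<Sum>l\<in>H. b i l * fract_ext l x)))"
    by (intro dual_system_exists fin fract_ext_independence[OF fin aut one closed distinct]) auto
  then obtain v b where v: "v ` H \<subseteq> X"
    and dual: "\<And>i j. i \<in> H \<Longrightarrow> j \<in> H \<Longrightarrow> (\<Sum>k\<in>H. b i k * fract_ext k (v j)) = (if i = j then 1 else 0)"
    and span: "\<And>k x. k \<in> H \<Longrightarrow> x \<in> X \<Longrightarrow>
        fract_ext k x = (\<Sum>i\<in>H. fract_ext k (v i) * (\<Sum>l\<in>H. b i l * fract_ext l x))"
    by blast
  define T where "T i x = (\<Sum>k\<in>H. b i k * fract_ext k x)" for i x
  have span': "(\<Sum>k\<in>H. c k * fract_ext k x) = (\<Sum>i\<in>H. (\<Sum>k\<in>H. c k * fract_ext k (v i)) * T i x)"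
    if x: "x \<in> X" for c x
  proof -
    have "(\<Sum>k\<in>H. c k * fract_ext k x) = (\<Sum>k\<in>H. c k * (\<Sum>i\<in>H. fract_ext k (v i) * T i x))"
    proof (rule sum.cong[OF refl])
      fix k assume "k \<in> H"
      from span[OF this x] show "c k * fract_ext k x = c k * (\<Sum>i\<in>H. fract_ext k (v i) * T i x)"
        unfolding T_def by (rule arg_cong)
    qed
    also have "\<dots> = (\<Sum>i\<in>H. \<Sum>k\<in>H. c k * fract_ext k (v i) * T i x)"
      unfolding sum_distrib_left by (subst sum.swap) (simp add: mult.assoc)
    finally show ?thesis by (simp add: sum_distrib_right)
  qed
  have inv: "fract_ext h (T i x) = T i x" if h: "h \<in> H" and i: "i \<in> H" and x: "x \<in> X" for h i x
  proof -
    note inj = finite_group_translation(1)[OF fin aut comp h]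
      and surj = finite_group_translation(2)[OF fin aut comp h]
    \<comment> \<open>The coefficients of h composed with \<open>T i\<close>, once H is reindexed by
      left translation with h.\<close>
    define c where "c k = fract_ext h (b i (inv_into H ((\<circ>) h) k))" for k
    have c: "fract_ext h (T i y) = (\<Sum>k\<in>H. c k * fract_ext k y)" for y
    proof -
      have "(\<Sum>k\<in>H. c k * fract_ext k y) = (\<Sum>k\<in>(\<circ>) h ` H. c k * fract_ext k y)"
        using surj by simp
      also have "\<dots> = (\<Sum>k\<in>H. c (h \<circ> k) * fract_ext (h \<circ> k) y)"
        by (simp add: sum.reindex[OF inj])
      also have "\<dots> = (\<Sum>k\<in>H. fract_ext h (b i k * fract_ext k y))"
        by (rule sum.cong)
          (auto simp: c_def inv_into_f_f[OF inj] fract_ext_comp aut h fract_ext_mult)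
      also have "\<dots> = fract_ext h (T i y)" by (simp add: T_def fract_ext_sum aut h)
      finally show ?thesis ..
    qed
    have "fract_ext h (T i x) = (\<Sum>j\<in>H. (\<Sum>k\<in>H. c k * fract_ext k (v j)) * T j x)"
      unfolding c by (rule span'[OF x])
    also have "\<dots> = (\<Sum>j\<in>H. fract_ext h (T i (v j)) * T j x)" unfolding c ..
    also have "\<dots> = (\<Sum>j\<in>H. (if i = j then T j x else 0))"
      by (rule sum.cong) (auto simp: T_def dual i fract_ext_1 fract_ext_0 aut h)
    also have "\<dots> = T i x" using fin i by simp
    finally show ?thesis .
  qed
  show ?thesis
    by (intro exI[of _ v] exI[of _ b] conjI ballI allI v dual span'[unfolded T_def] inv[unfolded T_def])
qed

section \<open>Norms and fixed fields of finite groups\<close>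

lemma norm_invariant:
  fixes H :: "('a::idom \<Rightarrow> 'a) set"
  assumes fin: "finite H" and aut: "\<And>h. h \<in> H \<Longrightarrow> ring_aut h"
    and comp: "\<And>g h. g \<in> H \<Longrightarrow> h \<in> H \<Longrightarrow> g \<circ> h \<in> H" and h: "h \<in> H"
  shows "h (\<Prod>k\<in>H. k a) = (\<Prod>k\<in>H. k a)"
proof -
  note inj = finite_group_translation(1)[OF fin aut comp h]
    and surj = finite_group_translation(2)[OF fin aut comp h]
  have "h (\<Prod>k\<in>H. k a) = (\<Prod>k\<in>H. (h \<circ> k) a)" by (simp add: ring_aut_prod aut h)
  also have "\<dots> = (\<Prod>k\<in>(\<circ>) h ` H. k a)" by (simp add: prod.reindex[OF inj])
  finally show ?thesis by (simp add: surj)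
qed

lemma norm_nonzero:
  assumes "finite H" and "\<And>h. h \<in> H \<Longrightarrow> ring_aut h" and "a \<noteq> (0::'a::idom)"
  shows "(\<Prod>k\<in>H. k a) \<noteq> 0"
  using assms by (auto simp: ring_autD(6))

text \<open>Expanding a fraction by the other conjugates of its denominator makes the denominator a
  norm, which is invariant; if the fraction is fixed, the numerator is then invariant as
  well.\<close>

lemma fract_fixed_conv:
  fixes H :: "('a::idom \<Rightarrow> 'a) set"
  assumes fin: "finite H" and aut: "\<And>h. h \<in> H \<Longrightarrow> ring_aut h" and id: "id \<in> H"
    and comp: "\<And>g h. g \<in> H \<Longrightarrow> h \<in> H \<Longrightarrow> g \<circ> h \<in> H"
  shows "{q. \<forall>h\<in>H. fract_ext h q = q} = {Fract a b | a b. a \<in> invariants H \<and> b \<in> invariants H \<and> b \<noteq> 0}"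
proof (intro equalityI subsetI)
  fix q assume q: "q \<in> {q. \<forall>h\<in>H. fract_ext h q = q}"
  obtain a b where ab: "q = Fract a b" "b \<noteq> 0" by (cases q) auto
  define n where "n = (\<Prod>k\<in>H. k b)"
  define d where "d = (\<Prod>k\<in>H - {id}. k b)"
  have n: "n = b * d" unfolding n_def d_def using fin id by (subst prod.remove[of H id]) auto
  have n0: "n \<noteq> 0" unfolding n_def by (rule norm_nonzero) (use fin aut ab in auto)
  have n_inv: "n \<in> invariants H"
    unfolding n_def invariants_def using norm_invariant[of H] fin aut comp by simp
  have q': "q = Fract (a * d) n" using ab n n0 by (simp add: eq_fract ac_simps)
  have "h (a * d) = a * d" if h: "h \<in> H" for h
  proof -
    have "Fract (h (a * d)) (h n) = Fract (a * d) n"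
    proof -
      have "fract_ext h q = q" using q h by simp
      then show ?thesis unfolding q' fract_ext_Fract[OF aut[OF h] n0] .
    qed
    moreover have "h n = n" using n_inv h by (simp add: invariants_def)
    ultimately show ?thesis using n0 by (simp add: eq_fract)
  qed
  then show "q \<in> {Fract a b | a b. a \<in> invariants H \<and> b \<in> invariants H \<and> b \<noteq> 0}"
    using q' n_inv n0 unfolding invariants_def by blast
next
  fix q assume "q \<in> {Fract a b | a b. a \<in> invariants H \<and> b \<in> invariants H \<and> b \<noteq> 0}"
  then show "q \<in> {q. \<forall>h\<in>H. fract_ext h q = q}"
    unfolding invariants_def using fract_ext_Fract[OF aut] by fastforce
qed

text \<open>Artin: the fixed field determines the finite group. An automorphism fixing it agrees, in
  the coordinates of a dual system of \<open>H\<close>, with a combination of elements of \<open>H\<close>.\<close>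

lemma finite_group_galois_closed:
  fixes H :: "('a::idom \<Rightarrow> 'a) set"
  assumes fin: "finite H" and aut: "\<And>h. h \<in> H \<Longrightarrow> ring_aut h" and id: "id \<in> H"
    and comp: "\<And>g h. g \<in> H \<Longrightarrow> h \<in> H \<Longrightarrow> g \<circ> h \<in> H"
    and f: "ring_aut f" and fix_inv: "\<And>a. a \<in> invariants H \<Longrightarrow> f a = a"
  shows "f \<in> H"
proof (rule ccontr)
  assume nf: "f \<notin> H"
  have fixed: "fract_ext f q = q" if "\<forall>h\<in>H. fract_ext h q = q" for q
  proof -
    from that obtain a b where "q = Fract a b" "a \<in> invariants H" "b \<in> invariants H" "b \<noteq> 0"
      using fract_fixed_conv[of H] fin aut id comp by blast
    then show ?thesis by (simp add: fract_ext_Fract f fix_inv)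
  qed
  have sep: "\<exists>x\<in>UNIV. fract_ext g x \<noteq> fract_ext h x" if "g \<in> H" "h \<in> H" "g \<noteq> h" for g h
    by (rule fract_ext_separates[OF aut aut]) (rule that)+
  have "\<exists>v b. v ` H \<subseteq> UNIV \<and>
    (\<forall>i\<in>H. \<forall>j\<in>H. (\<Sum>k\<in>H. b i k * fract_ext k (v j)) = (if i = j then 1 else 0)) \<and>
    (\<forall>c. \<forall>x\<in>UNIV. (\<Sum>k\<in>H. c k * fract_ext k x)
        = (\<Sum>i\<in>H. (\<Sum>k\<in>H. c k * fract_ext k (v i)) * (\<Sum>k\<in>H. b i k * fract_ext k x))) \<and>
    (\<forall>h\<in>H. \<forall>i\<in>H. \<forall>x\<in>UNIV.
        fract_ext h (\<Sum>k\<in>H. b i k * fract_ext k x) = (\<Sum>k\<in>H. b i k * fract_ext k x))"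
    by (rule finite_group_dual_system[OF fin aut id comp UNIV_I UNIV_I sep])
  then obtain v b where
    span_inv: "\<forall>c. \<forall>x\<in>UNIV. (\<Sum>k\<in>H. c k * fract_ext k x)
        = (\<Sum>i\<in>H. (\<Sum>k\<in>H. c k * fract_ext k (v i)) * (\<Sum>k\<in>H. b i k * fract_ext k x))"
      "\<forall>h\<in>H. \<forall>i\<in>H. \<forall>x\<in>UNIV.
        fract_ext h (\<Sum>k\<in>H. b i k * fract_ext k x) = (\<Sum>k\<in>H. b i k * fract_ext k x)"
    by (elim exE conjE)
  note span = span_inv(1)[rule_format] and inv = span_inv(2)[rule_format]
  define T where "T i x = (\<Sum>k\<in>H. b i k * fract_ext k x)" for i x
  have x_eq: "x = (\<Sum>i\<in>H. v i * T i x)" for x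
  proof -
    \<comment> \<open>With the indicator of \<open>id\<close> as coefficients the interpolation
      formula becomes the expansion of x itself.\<close>
    have d: "(\<Sum>k\<in>H. (if k = id then 1 else 0) * fract_ext k y) = y" for y
    proof -
      have "(\<Sum>k\<in>H. (if k = id then 1 else 0) * fract_ext k y) = (\<Sum>k\<in>H. if k = id then y else 0)"
        by (rule sum.cong) (auto simp: fract_ext_id[unfolded id_def] id_def)
      then show ?thesis using fin id by simp
    qed
    show ?thesis using span[OF UNIV_I, of "\<lambda>k. if k = id then 1 else 0" x] unfolding d T_def .
  qed
  have f_eq: "fract_ext f x = (\<Sum>i\<in>H. fract_ext f (v i) * T i x)" for x
  proof -
    have "fract_ext f x = fract_ext f (\<Sum>i\<in>H. v i * T i x)"
      by (rule arg_cong[OF x_eq])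
    also have "\<dots> = (\<Sum>i\<in>H. fract_ext f (v i) * fract_ext f (T i x))"
      by (simp add: fract_ext_sum fract_ext_mult f)
    also have "\<dots> = (\<Sum>i\<in>H. fract_ext f (v i) * T i x)"
      by (intro sum.cong refl arg_cong2[of _ _ _ _ "(*)"] fixed) (auto simp: T_def inv)
    finally show ?thesis .
  qed
  \<comment> \<open>On L the map f agrees with a combination of elements of H. This is a relation
    among distinct automorphisms with coefficient 1 at f, contrary to Dedekind.\<close>
  define c where "c k = (if k = f then 1 else - (\<Sum>i\<in>H. fract_ext f (v i) * b i k))" for k
  have "\<forall>h\<in>insert f H. c h = 0"
  proof (rule fract_ext_independence[where X = UNIV])
    fix x
    have "(\<Sum>i\<in>H. fract_ext f (v i) * T i x) = (\<Sum>k\<in>H. (\<Sum>i\<in>H. fract_ext f (v i) * b i k) * fract_ext k x)"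
      unfolding T_def sum_distrib_left sum_distrib_right
      by (subst sum.swap) (simp add: mult.assoc)
    also have "\<dots> = - (\<Sum>k\<in>H. c k * fract_ext k x)"
      unfolding sum_negf[symmetric] by (rule sum.cong) (use nf in \<open>auto simp: c_def\<close>)
    finally show "(\<Sum>h\<in>insert f H. c h * fract_ext h x) = 0"
      using fin nf by (simp add: f_eq[of x] c_def)
    show "\<exists>x\<in>UNIV. fract_ext g x \<noteq> fract_ext h x"
      if "g \<in> insert f H" "h \<in> insert f H" "g \<noteq> h" for g h
      using fract_ext_separates[of g h] that aut f by blast
  qed (use fin aut f in auto)
  then show False by (simp add: c_def)
qed

section \<open>The skew group ring as a ring of operators\<close>

lemma group_aut_group:
  assumes "commutative_algebra scale"
  shows "group (aut_group scale)"
proof (rule groupI)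
  fix f assume f: "f \<in> carrier (aut_group scale)"
  then have "ring_aut f" by (simp add: aut_group_def ring_aut_def)
  then have aut: "ring_aut (inv_into UNIV f)" by (rule ring_aut_inv)
  have bij: "bij f" using f by (simp add: aut_group_def)
  have "inv_into UNIV f (scale c x) = scale c (inv_into UNIV f x)" for c x
  proof -
    have "f (scale c (inv_into UNIV f x)) = scale c x"
      using f bij by (simp add: aut_group_def bij_is_surj surj_f_inv_f)
    then show ?thesis using bij by (simp add: bij_is_inj inv_f_eq)
  qed
  then have "inv_into UNIV f \<in> carrier (aut_group scale)"
    using aut by (simp add: aut_group_def ring_aut_def)
  moreover have "inv_into UNIV f \<otimes>\<^bsub>aut_group scale\<^esub> f = \<one>\<^bsub>aut_group scale\<^esub>"
    using bij by (auto simp: aut_group_def fun_eq_iff bij_is_inj)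
  ultimately show "\<exists>g\<in>carrier (aut_group scale). g \<otimes>\<^bsub>aut_group scale\<^esub> f = \<one>\<^bsub>aut_group scale\<^esub>"
    by blast
qed (auto simp: aut_group_def bij_comp o_assoc)

lemma aut_group_inv:
  assumes "commutative_algebra scale" and f: "f \<in> carrier (aut_group scale)"
  shows "inv\<^bsub>aut_group scale\<^esub> f = inv_into UNIV f"
proof -
  interpret group "aut_group scale" by (rule group_aut_group) fact
  have "bij f" using f by (simp add: aut_group_def)
  have "f \<circ> (inv\<^bsub>aut_group scale\<^esub> f) = id"
    using r_inv[OF f] by (simp add: aut_group_def)
  then have "f ((inv\<^bsub>aut_group scale\<^esub> f) y) = y" for y by (metis comp_apply id_apply)
  then show ?thesis
    using \<open>bij f\<close> by (intro ext inv_f_eq[symmetric] bij_is_inj)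
qed

lemma in_skew_ring_iff: "x \<in> carrier (skew_ring M) \<longleftrightarrow> finite (support x) \<and> support x \<subseteq> M"
  by (simp add: skew_ring_def)

definition act :: "(('a::idom \<Rightarrow> 'a) \<Rightarrow> 'a fract) \<Rightarrow> 'a fract \<Rightarrow> 'a fract" where
  "act x w = (\<Sum>\<mu>\<in>support x. x \<mu> * fract_ext \<mu> w)"

lemma act_superset:
  "finite S \<Longrightarrow> support x \<subseteq> S \<Longrightarrow> act x w = (\<Sum>\<mu>\<in>S. x \<mu> * fract_ext \<mu> w)"
  unfolding act_def by (rule sum.mono_neutral_left) (auto simp: support_def)

lemma support_skew_const: "support (skew_const a) = (if a = 0 then {} else {id})"
  by (auto simp: support_def skew_const_def)

lemma act_const: "act (skew_const a) w = a * w"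
  by (simp add: act_def support_skew_const fract_ext_id)
     (simp add: skew_const_def fract_ext_id)

lemma skew_const_eq_iff [simp]: "skew_const a = skew_const b \<longleftrightarrow> a = b"
  by (auto simp: skew_const_def fun_eq_iff)

lemma act_add:
  assumes "finite (support x)" and "finite (support y)"
  shows "act (\<lambda>\<mu>. x \<mu> + y \<mu>) w = act x w + act y w"
proof -
  let ?S = "support x \<union> support y"
  have "support (\<lambda>\<mu>. x \<mu> + y \<mu>) \<subseteq> ?S" by (auto simp: support_def)
  then show ?thesis using assms
    by (simp add: act_superset[of ?S] sum.distrib distrib_right)
qed

lemma act_scale:
  "act (\<lambda>\<mu>. a * x \<mu>) w = a * act x w"
  by (cases "a = 0") (simp_all add: act_def support_def sum_distrib_left mult.assoc)

lemma act_diff: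
  assumes "finite (support x)" and "finite (support y)"
  shows "act (\<lambda>\<mu>. x \<mu> - y \<mu>) w = act x w - act y w"
proof -
  have y: "finite (support (\<lambda>\<mu>. (-1) * y \<mu>))" using assms by (simp add: support_def)
  show ?thesis
    using act_add[OF assms(1) y, of w] act_scale[of "-1" y w] by simp
qed

lemma skew_mult_eq:
  "(x \<otimes>\<^bsub>skew_ring M\<^esub> y) \<rho> = (\<Sum>p\<in>{p \<in> support x \<times> support y. fst p \<circ> snd p = \<rho>}. x (fst p) * fract_ext (fst p) (y (snd p)))"
  unfolding skew_ring_def by (auto simp: case_prod_unfold intro!: sum.cong)

locale skew_setting =
  fixes M :: "('a::idom \<Rightarrow> 'a) set"
  assumes M_aut: "\<And>\<mu>. \<mu> \<in> M \<Longrightarrow> ring_aut \<mu>"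
    and M_id: "id \<in> M"
    and M_comp: "\<And>\<mu> \<nu>. \<mu> \<in> M \<Longrightarrow> \<nu> \<in> M \<Longrightarrow> \<mu> \<circ> \<nu> \<in> M"
begin

abbreviation "\<L> \<equiv> skew_ring M"

abbreviation L_mult (infixl "\<star>" 70) where
  "x \<star> y \<equiv> x \<otimes>\<^bsub>\<L>\<^esub> y"

lemma act_add_arg:
  "x \<in> carrier \<L> \<Longrightarrow> act x (v + w) = act x v + act x w"
  unfolding act_def sum.distrib[symmetric]
  by (rule sum.cong) (auto simp: in_skew_ring_iff fract_ext_add M_aut subset_iff distrib_left)

lemma act_0_arg: "x \<in> carrier \<L> \<Longrightarrow> act x 0 = 0"
  unfolding act_def
  by (rule sum.neutral) (auto simp: in_skew_ring_iff fract_ext_0 M_aut subset_iff)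

lemma act_sum_arg:
  "x \<in> carrier \<L> \<Longrightarrow> act x (\<Sum>i\<in>I. f i) = (\<Sum>i\<in>I. act x (f i))"
  by (induction I rule: infinite_finite_induct) (simp_all add: act_0_arg act_add_arg)

lemma support_skew_mult:
  "support (x \<star> y) \<subseteq> (\<lambda>p. fst p \<circ> snd p) ` (support x \<times> support y)"
proof
  fix \<rho> assume "\<rho> \<in> support (x \<star> y)"
  then have "(x \<star> y) \<rho> \<noteq> 0" by (simp add: support_def)
  then have "{p \<in> support x \<times> support y. fst p \<circ> snd p = \<rho>} \<noteq> {}"
    unfolding skew_mult_eq by (rule contrapos_nn) (simp only: sum.empty)
  then obtain p where p: "p \<in> support x \<times> support y" "fst p \<circ> snd p = \<rho>" by blast
  show "\<rho> \<in> (\<lambda>p. fst p \<circ> snd p) ` (support x \<times> support y)"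
    by (rule image_eqI[where x = p]) (simp_all only: p)
qed

lemma skew_mult_closed:
  assumes "x \<in> carrier \<L>" "y \<in> carrier \<L>" shows "x \<star> y \<in> carrier \<L>"
proof -
  have "finite ((\<lambda>p. fst p \<circ> snd p) ` (support x \<times> support y))"
    using assms by (simp add: in_skew_ring_iff)
  moreover have "(\<lambda>p. fst p \<circ> snd p) ` (support x \<times> support y) \<subseteq> M"
    using assms M_comp unfolding in_skew_ring_iff by (auto simp del: o_apply dest!: subsetD)
  ultimately show ?thesis
    using support_skew_mult[of x y] unfolding in_skew_ring_iff by (meson finite_subset subset_trans)
qed

lemma act_mult:
  assumes x: "x \<in> carrier \<L>" and y: "y \<in> carrier \<L>"
  shows "act (x \<star> y) w = act x (act y w)"
proof -
  let ?P = "support x \<times> support y"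
  let ?S = "(\<lambda>p. fst p \<circ> snd p) ` ?P"
  have fin: "finite ?P" using x y by (simp add: in_skew_ring_iff)
  have aut: "ring_aut \<mu>" "ring_aut \<nu>" if "\<mu> \<in> support x" "\<nu> \<in> support y" for \<mu> \<nu>
    using that x y M_aut by (auto simp: in_skew_ring_iff)
  have "act (x \<star> y) w = (\<Sum>\<rho>\<in>?S. (x \<star> y) \<rho> * fract_ext \<rho> w)"
    by (rule act_superset) (use fin support_skew_mult in auto)
  also have "\<dots> = (\<Sum>\<rho>\<in>?S. \<Sum>p\<in>{p \<in> ?P. fst p \<circ> snd p = \<rho>}.
      x (fst p) * fract_ext (fst p) (y (snd p)) * fract_ext (fst p \<circ> snd p) w)"
    unfolding skew_mult_eq sum_distrib_right by (intro sum.cong) auto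
  \<comment> \<open>The fibres of composition partition the pairs, so the convolution turns into a
    plain double sum.\<close>
  also have "\<dots> = (\<Sum>p\<in>?P. x (fst p) * fract_ext (fst p) (y (snd p)) * fract_ext (fst p \<circ> snd p) w)"
    by (rule sum.group) (use fin in auto)
  also have "\<dots> = (\<Sum>p\<in>?P. x (fst p) * fract_ext (fst p) (y (snd p) * fract_ext (snd p) w))"
    by (rule sum.cong) (auto simp: fract_ext_mult fract_ext_comp aut mult.assoc)
  also have "\<dots> = (\<Sum>\<mu>\<in>support x. \<Sum>\<nu>\<in>support y. x \<mu> * fract_ext \<mu> (y \<nu> * fract_ext \<nu> w))"
    by (simp add: sum.cartesian_product case_prod_unfold)
  also have "\<dots> = act x (act y w)"
    unfolding act_def
    by (rule sum.cong) (use x M_aut in \<open>auto simp: in_skew_ring_iff fract_ext_sum sum_distrib_left\<close>)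
  finally show ?thesis .
qed

text \<open>Dedekind's lemma on the support of x. The test set X may be any multiplicative set
  separating M: all of L here, and \<Gamma> once G is available.\<close>

lemma act_independence:
  assumes x: "x \<in> carrier \<L>"
    and "1 \<in> X" and "\<And>x y. x \<in> X \<Longrightarrow> y \<in> X \<Longrightarrow> x * y \<in> X"
    and "\<And>\<mu> \<nu>. \<mu> \<in> M \<Longrightarrow> \<nu> \<in> M \<Longrightarrow> \<mu> \<noteq> \<nu> \<Longrightarrow> \<exists>w\<in>X. fract_ext \<mu> w \<noteq> fract_ext \<nu> w"
    and zero: "\<And>w. w \<in> X \<Longrightarrow> act x w = 0"
  shows "x = (\<lambda>_. 0)"
proof -
  have "\<forall>\<mu>\<in>support x. x \<mu> = 0"
  proof (rule fract_ext_independence[where X = X])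
    show "(\<Sum>h\<in>support x. x h * fract_ext h w) = 0" if "w \<in> X" for w
      using zero[OF that] by (simp add: act_def)
    show "\<exists>w\<in>X. fract_ext \<mu> w \<noteq> fract_ext \<nu> w" if "\<mu> \<in> support x" "\<nu> \<in> support x" "\<mu> \<noteq> \<nu>" for \<mu> \<nu>
      using assms(4)[of \<mu> \<nu>] that x by (auto simp: in_skew_ring_iff)
  qed (use assms M_aut in \<open>auto simp: in_skew_ring_iff\<close>)
  then show ?thesis by (auto simp: support_def fun_eq_iff)
qed

lemma act_eq_0:
  assumes "x \<in> carrier \<L>" and "\<And>w. act x w = 0"
  shows "x = (\<lambda>_. 0)"
proof (rule act_independence[where X = UNIV])
  show "\<exists>w\<in>UNIV. fract_ext \<mu> w \<noteq> fract_ext \<nu> w" if "\<mu> \<in> M" "\<nu> \<in> M" "\<mu> \<noteq> \<nu>" for \<mu> \<nu>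
    by (rule fract_ext_separates[OF M_aut M_aut]) (use that in auto)
qed (use assms in auto)

lemma skew_closed_if_support:
  "x \<in> carrier \<L> \<Longrightarrow> y \<in> carrier \<L> \<Longrightarrow> support z \<subseteq> support x \<union> support y \<Longrightarrow> z \<in> carrier \<L>"
  unfolding in_skew_ring_iff by (meson finite_UnI finite_subset le_sup_iff subset_trans)

lemma skew_diff_closed:
  "x \<in> carrier \<L> \<Longrightarrow> y \<in> carrier \<L> \<Longrightarrow> (\<lambda>\<mu>. x \<mu> - y \<mu>) \<in> carrier \<L>"
  by (erule skew_closed_if_support) (auto simp: support_def)

lemma skew_add_closed:
  "x \<in> carrier \<L> \<Longrightarrow> y \<in> carrier \<L> \<Longrightarrow> (\<lambda>\<mu>. x \<mu> + y \<mu>) \<in> carrier \<L>"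
  by (erule skew_closed_if_support) (auto simp: support_def)

lemma skew_scale_closed:
  "x \<in> carrier \<L> \<Longrightarrow> (\<lambda>\<mu>. a * x \<mu>) \<in> carrier \<L>"
  by (rule skew_closed_if_support[of x x]) (auto simp: support_def)

lemma skew_const_closed: "skew_const a \<in> carrier \<L>"
  by (simp add: in_skew_ring_iff support_skew_const M_id)

lemma skew_eqI:
  assumes "x \<in> carrier \<L>" "y \<in> carrier \<L>" and "\<And>w. act x w = act y w"
  shows "x = y"
proof -
  have "(\<lambda>\<mu>. x \<mu> - y \<mu>) = (\<lambda>_. 0)"
    by (rule act_eq_0[OF skew_diff_closed])
       (use assms in \<open>auto simp: act_diff in_skew_ring_iff\<close>)
  then show ?thesis by (auto simp: fun_eq_iff)
qed

lemma skew_zero: "\<zero>\<^bsub>\<L>\<^esub> = (\<lambda>_. 0)" and skew_one: "\<one>\<^bsub>\<L>\<^esub> = skew_const 1"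
  and skew_add: "x \<oplus>\<^bsub>\<L>\<^esub> y = (\<lambda>\<mu>. x \<mu> + y \<mu>)"
  by (simp_all add: skew_ring_def skew_const_def)

lemma act_zero: "act (\<lambda>_. 0) w = 0"
  by (simp add: act_def)

lemma act_plus:
  "x \<in> carrier \<L> \<Longrightarrow> y \<in> carrier \<L> \<Longrightarrow> act (x \<oplus>\<^bsub>\<L>\<^esub> y) w = act x w + act y w"
  by (simp add: skew_add act_add in_skew_ring_iff)

lemma skew_zero_closed: "(\<lambda>_. 0) \<in> carrier \<L>"
  by (simp add: in_skew_ring_iff support_def)

lemma skew_plus_closed: "x \<in> carrier \<L> \<Longrightarrow> y \<in> carrier \<L> \<Longrightarrow> x \<oplus>\<^bsub>\<L>\<^esub> y \<in> carrier \<L>"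
  by (simp add: skew_add skew_add_closed)

text \<open>The multiplicative axioms are pulled back from additive operators on L along the
  faithful action, so the convolution never has to be reassociated by hand.\<close>

lemma ring_skew: "ring \<L>"
proof (rule ringI)
  show "abelian_group \<L>"
  proof (rule abelian_groupI)
    fix x assume x: "x \<in> carrier \<L>"
    have "(\<lambda>\<mu>. (-1) * x \<mu>) \<oplus>\<^bsub>\<L>\<^esub> x = \<zero>\<^bsub>\<L>\<^esub>" by (simp add: skew_add skew_zero)
    then show "\<exists>y\<in>carrier \<L>. y \<oplus>\<^bsub>\<L>\<^esub> x = \<zero>\<^bsub>\<L>\<^esub>" using skew_scale_closed[OF x, of "-1"] by blast
  qed (auto simp: skew_add skew_zero skew_add_closed skew_zero_closed ac_simps)
  note cl = skew_mult_closed skew_const_closed skew_plus_closed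
  show "Group.monoid \<L>"
  proof (rule monoidI)
    fix x y z assume "x \<in> carrier \<L>" "y \<in> carrier \<L>" "z \<in> carrier \<L>"
    then show "x \<star> y \<star> z = x \<star> (y \<star> z)"
      by (intro skew_eqI) (simp_all add: cl act_mult)
  next
    fix x assume "x \<in> carrier \<L>"
    then show "\<one>\<^bsub>\<L>\<^esub> \<star> x = x" "x \<star> \<one>\<^bsub>\<L>\<^esub> = x"
      by (auto intro!: skew_eqI simp: cl skew_one act_mult act_const)
  qed (simp_all add: cl skew_one)
  fix x y z assume "x \<in> carrier \<L>" "y \<in> carrier \<L>" "z \<in> carrier \<L>"
  then show "(x \<oplus>\<^bsub>\<L>\<^esub> y) \<star> z = x \<star> z \<oplus>\<^bsub>\<L>\<^esub> y \<star> z"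
    and "z \<star> (x \<oplus>\<^bsub>\<L>\<^esub> y) = z \<star> x \<oplus>\<^bsub>\<L>\<^esub> z \<star> y"
    by (auto intro!: skew_eqI simp: cl act_mult act_plus act_add_arg)
qed

end

section \<open>The action of G, its invariants, and separation on \<Gamma>\<close>

locale galois_setting = skew_setting M for M :: "('a::idom \<Rightarrow> 'a) set" +
  fixes G :: "('a \<Rightarrow> 'a) set"
  assumes M_inv: "\<And>\<mu>. \<mu> \<in> M \<Longrightarrow> inv_into UNIV \<mu> \<in> M"
    and G_fin: "finite G"
    and G_aut: "\<And>g. g \<in> G \<Longrightarrow> ring_aut g"
    and G_id: "id \<in> G"
    and G_comp: "\<And>g h. g \<in> G \<Longrightarrow> h \<in> G \<Longrightarrow> g \<circ> h \<in> G"
    and G_inv: "\<And>g. g \<in> G \<Longrightarrow> inv_into UNIV g \<in> G"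
    and conj: "\<And>g \<mu>. g \<in> G \<Longrightarrow> \<mu> \<in> M \<Longrightarrow> g \<circ> \<mu> \<circ> inv_into UNIV g \<in> M"
    and M_Int_G: "\<And>\<mu>. \<mu> \<in> M \<Longrightarrow> \<mu> \<in> G \<Longrightarrow> \<mu> = id"
begin

abbreviation "\<K> \<equiv> invariant_skew_ring G M"

abbreviation K_mult (infixl "\<bullet>" 70) where
  "x \<bullet> y \<equiv> x \<otimes>\<^bsub>\<K>\<^esub> y"

lemma G_cancel: "g \<in> G \<Longrightarrow> g (inv_into UNIV g y) = y" "g \<in> G \<Longrightarrow> inv_into UNIV g (g y) = y"
  using ring_autD(1)[OF G_aut] by (auto simp: bij_is_surj surj_f_inv_f bij_is_inj)

lemma M_cancel: "\<mu> \<in> M \<Longrightarrow> \<mu> (inv_into UNIV \<mu> y) = y" "\<mu> \<in> M \<Longrightarrow> inv_into UNIV \<mu> (\<mu> y) = y"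
  using ring_autD(1)[OF M_aut] by (auto simp: bij_is_surj surj_f_inv_f bij_is_inj)

lemma conj_cancel:
  "g \<in> G \<Longrightarrow> inv_into UNIV g \<circ> (g \<circ> \<mu> \<circ> inv_into UNIV g) \<circ> g = \<mu>"
  by (simp add: fun_eq_iff G_cancel)

lemma conj_inj: "g \<in> G \<Longrightarrow> inj_on (\<lambda>\<mu>. g \<circ> \<mu> \<circ> inv_into UNIV g) S"
  by (rule inj_onI) (metis conj_cancel)

lemma support_skew_act:
  assumes g: "g \<in> G"
  shows "support (skew_act g x) = (\<lambda>\<mu>. g \<circ> \<mu> \<circ> inv_into UNIV g) ` support x"
proof -
  have "\<rho> = g \<circ> (inv_into UNIV g \<circ> \<rho> \<circ> g) \<circ> inv_into UNIV g" for \<rho>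
    by (simp add: fun_eq_iff G_cancel[OF g])
  then show ?thesis
    unfolding support_def skew_act_def fract_ext_eq_0_iff[OF G_aut[OF g]]
    by (auto simp: image_iff conj_cancel[OF g])
qed

lemma skew_act_closed:
  assumes "g \<in> G" and "x \<in> carrier \<L>" shows "skew_act g x \<in> carrier \<L>"
  using assms conj by (auto simp: in_skew_ring_iff support_skew_act)

lemma act_skew_act:
  assumes g: "g \<in> G" and x: "x \<in> carrier \<L>"
  shows "act (skew_act g x) w = fract_ext g (act x (fract_ext (inv_into UNIV g) w))"
proof -
  let ?c = "\<lambda>\<mu>. g \<circ> \<mu> \<circ> inv_into UNIV g"
  have aut: "ring_aut \<mu>" if "\<mu> \<in> support x" for \<mu>
    using that x M_aut by (auto simp: in_skew_ring_iff)
  note g_aut = G_aut[OF g] ring_aut_inv[OF G_aut[OF g]]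
  have "act (skew_act g x) w = (\<Sum>\<mu>\<in>support x. skew_act g x (?c \<mu>) * fract_ext (?c \<mu>) w)"
    unfolding act_def support_skew_act[OF g] by (simp add: sum.reindex[OF conj_inj[OF g]])
  also have "\<dots> = (\<Sum>\<mu>\<in>support x. fract_ext g (x \<mu> * fract_ext \<mu> (fract_ext (inv_into UNIV g) w)))"
    by (rule sum.cong)
       (simp_all add: skew_act_def conj_cancel[OF g] fract_ext_mult fract_ext_comp g_aut aut ring_aut_comp)
  also have "\<dots> = fract_ext g (act x (fract_ext (inv_into UNIV g) w))"
    by (simp add: act_def fract_ext_sum g_aut)
  finally show ?thesis .
qed

text \<open>On operators G acts by conjugation (\<open>act_skew_act\<close>), so being invariant
  means commuting with G. In this form closure under sums and products is immediate.\<close>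

lemma in_K_iff:
  "x \<in> carrier \<K> \<longleftrightarrow> x \<in> carrier \<L> \<and> (\<forall>g\<in>G. \<forall>w. act x (fract_ext g w) = fract_ext g (act x w))"
proof -
  have "skew_act g x = x \<longleftrightarrow> (\<forall>w. act x (fract_ext g w) = fract_ext g (act x w))"
    if g: "g \<in> G" and x: "x \<in> carrier \<L>" for g
  proof
    assume "skew_act g x = x"
    then have "act x (fract_ext g w) = act (skew_act g x) (fract_ext g w)" for w by simp
    then show "\<forall>w. act x (fract_ext g w) = fract_ext g (act x w)"
      by (simp add: act_skew_act[OF g x] fract_ext_inv(2) G_aut g)
  next
    assume *: "\<forall>w. act x (fract_ext g w) = fract_ext g (act x w)"
    show "skew_act g x = x"
      by (rule skew_eqI[OF skew_act_closed[OF g x] x])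
         (simp add: act_skew_act[OF g x] *[rule_format, symmetric] fract_ext_inv(1) G_aut g)
  qed
  then show ?thesis by (auto simp: invariant_skew_ring_def)
qed

lemma K_in_L: "x \<in> carrier \<K> \<Longrightarrow> x \<in> carrier \<L>"
  by (simp add: in_K_iff)

lemma K_simps: "\<zero>\<^bsub>\<K>\<^esub> = (\<lambda>_. 0)" "\<one>\<^bsub>\<K>\<^esub> = skew_const 1" "x \<oplus>\<^bsub>\<K>\<^esub> y = (\<lambda>\<mu>. x \<mu> + y \<mu>)"
  "x \<bullet> y = x \<star> y"
  by (simp_all add: invariant_skew_ring_def skew_ring_def skew_const_def)

text \<open>The field K = L^G as a subset of L. Elements of \<K> commute with G and therefore map it
  into itself.\<close>

definition fixed_G :: "'a fract set" where
  "fixed_G = {w. \<forall>g\<in>G. fract_ext g w = w}"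

lemma fixed_G_conv: "fixed_G = {Fract a b | a b. a \<in> invariants G \<and> b \<in> invariants G \<and> b \<noteq> 0}"
  unfolding fixed_G_def by (rule fract_fixed_conv[OF G_fin G_aut G_id G_comp])

lemma fixed_G_closed:
  "0 \<in> fixed_G" "1 \<in> fixed_G" "v \<in> fixed_G \<Longrightarrow> w \<in> fixed_G \<Longrightarrow> v + w \<in> fixed_G"
  "v \<in> fixed_G \<Longrightarrow> w \<in> fixed_G \<Longrightarrow> v * w \<in> fixed_G" "v \<in> fixed_G \<Longrightarrow> w \<in> fixed_G \<Longrightarrow> v / w \<in> fixed_G"
  by (auto simp: fixed_G_def fract_ext_0 fract_ext_1 fract_ext_add fract_ext_mult fract_ext_divide G_aut)

lemma invariants_closed:
  "0 \<in> invariants G" "1 \<in> invariants G" "a \<in> invariants G \<Longrightarrow> b \<in> invariants G \<Longrightarrow> a * b \<in> invariants G"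
  by (auto simp: invariants_def ring_autD G_aut)

lemma to_fract_in_fixed_G: "a \<in> invariants G \<Longrightarrow> to_fract a \<in> fixed_G"
  by (auto simp: fixed_G_def invariants_def fract_ext_to_fract G_aut)

lemma skew_const_in_K_iff: "skew_const a \<in> carrier \<K> \<longleftrightarrow> a \<in> fixed_G"
proof
  assume "skew_const a \<in> carrier \<K>"
  then have "\<forall>g\<in>G. a * fract_ext g 1 = fract_ext g (a * 1)"
    by (simp only: in_K_iff act_const) blast
  then show "a \<in> fixed_G" by (simp add: fixed_G_def fract_ext_1 G_aut)
qed (auto simp: in_K_iff skew_const_closed act_const fixed_G_def fract_ext_mult G_aut)

lemma act_fixed_G: "x \<in> carrier \<K> \<Longrightarrow> w \<in> fixed_G \<Longrightarrow> act x w \<in> fixed_G"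
  by (simp add: in_K_iff fixed_G_def) metis

lemma ring_K: "ring \<K>"
proof -
  interpret L: ring \<L> by (rule ring_skew)
  have minus: "\<ominus>\<^bsub>\<L>\<^esub> x = (\<lambda>\<mu>. (-1) * x \<mu>)" if "x \<in> carrier \<L>" for x
    by (rule L.minus_equality) (use that skew_scale_closed[of x "-1"] in \<open>simp_all add: skew_add skew_zero\<close>)
  have "subring (carrier \<K>) \<L>"
  proof (rule L.subringI)
    fix x assume x: "x \<in> carrier \<K>"
    then have "(\<lambda>\<mu>. (-1) * x \<mu>) \<in> carrier \<K>"
      unfolding in_K_iff using skew_scale_closed[of x "-1"]
      by (simp add: act_scale[of "-1", simplified] fract_ext_uminus G_aut)
    then show "\<ominus>\<^bsub>\<L>\<^esub> x \<in> carrier \<K>" using minus K_in_L[OF x] by simp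
  next
    fix x y assume x: "x \<in> carrier \<K>" and y: "y \<in> carrier \<K>"
    show "x \<star> y \<in> carrier \<K>"
      using x y by (simp add: in_K_iff skew_mult_closed act_mult)
    show "x \<oplus>\<^bsub>\<L>\<^esub> y \<in> carrier \<K>"
      using x y by (simp add: in_K_iff act_plus fract_ext_add G_aut)
  qed (use K_in_L fixed_G_closed(2) in \<open>auto simp: skew_one skew_const_in_K_iff\<close>)
  then have "ring (\<L>\<lparr>carrier := carrier \<K>\<rparr>)" by (rule L.subring_is_ring)
  then show ?thesis by (simp add: invariant_skew_ring_def)
qed

lemma M_separates_invariants:
  assumes \<mu>: "\<mu> \<in> M" and \<nu>: "\<nu> \<in> M" and ne: "\<mu> \<noteq> \<nu>"
  shows "\<exists>a\<in>invariants G. \<mu> a \<noteq> \<nu> a"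
proof (rule ccontr)
  assume *: "\<not> (\<exists>a\<in>invariants G. \<mu> a \<noteq> \<nu> a)"
  \<comment> \<open>An element of M that fixes \<Gamma> pointwise, which Artin's theorem places in
    G.\<close>
  let ?f = "inv_into UNIV \<mu> \<circ> \<nu>"
  have f: "?f \<in> M" using \<mu> \<nu> M_inv M_comp by blast
  have "?f \<in> G"
    by (rule finite_group_galois_closed[OF G_fin G_aut G_id G_comp M_aut[OF f]])
       (use * in \<open>auto simp: M_cancel(2)[OF \<mu>] dest!: sym[of "\<mu> _"]\<close>)
  then have "?f = id" using f by (intro M_Int_G)
  then have "\<mu> (?f x) = \<mu> x" for x by simp
  then have "\<mu> = \<nu>" by (simp add: fun_eq_iff M_cancel(1)[OF \<mu>])
  then show False using ne by simp
qed

abbreviation "\<Gamma> \<equiv> to_fract ` invariants G"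

lemma act_eq_0_on_Gamma:
  assumes "x \<in> carrier \<L>" and "\<And>c. c \<in> \<Gamma> \<Longrightarrow> act x c = 0"
  shows "x = (\<lambda>_. 0)"
proof (rule act_independence[where X = \<Gamma>])
  show "\<exists>w\<in>\<Gamma>. fract_ext \<mu> w \<noteq> fract_ext \<nu> w" if "\<mu> \<in> M" "\<nu> \<in> M" "\<mu> \<noteq> \<nu>" for \<mu> \<nu>
    using M_separates_invariants[OF that] that by (auto simp: fract_ext_to_fract M_aut)
  show "1 \<in> \<Gamma>" using invariants_closed(2) by (metis image_eqI to_fract_1)
  show "c * d \<in> \<Gamma>" if "c \<in> \<Gamma>" "d \<in> \<Gamma>" for c d
    using that invariants_closed(3) by (auto simp flip: to_fract_mult)
qed (use assms in auto)

lemma act_eq_0_on_line: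
  assumes x: "x \<in> carrier \<L>" and w: "w \<noteq> 0" and zero: "\<And>c. c \<in> \<Gamma> \<Longrightarrow> act x (c * w) = 0"
  shows "x = (\<lambda>_. 0)"
proof -
  \<comment> \<open>Multiplication by w on the right carries the line \<Gamma> w back to \<Gamma>,
    and it is undone by dividing the argument by w.\<close>
  have "x \<star> skew_const w = (\<lambda>_. 0)"
    by (rule act_eq_0_on_Gamma)
       (use x zero in \<open>auto simp: skew_mult_closed skew_const_closed act_mult act_const mult.commute\<close>)
  then have "act x (w * (u / w)) = 0" for u
    using act_mult[OF x skew_const_closed, of w "u / w"]
    by (simp add: act_zero act_const)
  then show ?thesis using w by (intro act_eq_0[OF x]) simp
qed

text \<open>This is what makes coordinates with respect to a basis of K sufficient to identify an
  element.\<close>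

lemma fixed_G_eqI:
  assumes x: "x \<in> carrier \<L>" and y: "y \<in> carrier \<L>"
    and eq: "\<And>w. w \<in> fixed_G \<Longrightarrow> act x w = act y w"
  shows "x = y"
proof -
  have "(\<lambda>\<mu>. x \<mu> - y \<mu>) = (\<lambda>_. 0)"
    by (rule act_eq_0_on_Gamma[OF skew_diff_closed[OF x y]])
       (use x y eq to_fract_in_fixed_G in \<open>auto simp: act_diff in_skew_ring_iff\<close>)
  then show ?thesis by (auto simp: fun_eq_iff)
qed

end

section \<open>Galois rings: primeness and polynomial identities\<close>

lemma word_eval_closed:
  assumes "Group.monoid R" and "range x \<subseteq> carrier R" shows "word_eval R x u \<in> carrier R"
  unfolding word_eval_def
  by (induction u) (use assms in \<open>auto intro: monoid.m_closed monoid.one_closed simp: image_subset_iff\<close>)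

text \<open>Serves two maps: the inclusion of U in \<K>, and the isomorphism of \<K> with a matrix
  ring.\<close>

lemma free_eval_hom:
  assumes "ring_hom_ring R S h" and x: "range x \<subseteq> carrier R" and \<eta>: "range \<eta> \<subseteq> carrier R"
  shows "h (free_eval R \<eta> x p) = free_eval S (h \<circ> \<eta>) (h \<circ> x) p"
proof -
  interpret ring_hom_ring R S h by fact
  have word: "word_eval R x u \<in> carrier R" for u
    by (rule word_eval_closed[OF R.monoid_axioms x])
  have h_word: "h (word_eval R x u) = word_eval S (h \<circ> x) u" for u
  proof (induction u)
    case (Cons i u)
    have "x i \<in> carrier R" using x by auto
    then have "h (x i \<otimes>\<^bsub>R\<^esub> word_eval R x u) = h (x i) \<otimes>\<^bsub>S\<^esub> h (word_eval R x u)"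
      using word by simp
    then show ?case unfolding Cons.IH by (simp add: word_eval_def)
  qed (simp add: word_eval_def)
  have eta: "\<eta> c \<in> carrier R" for c using \<eta> by auto
  have "h (free_eval R \<eta> x p)
      = (\<Oplus>\<^bsub>S\<^esub>w\<in>Poly_Mapping.keys p. (h \<circ> (\<lambda>w. \<eta> (Poly_Mapping.lookup p w) \<otimes>\<^bsub>R\<^esub> word_eval R x w)) w)"
    unfolding free_eval_def by (subst hom_finsum) (simp_all add: word eta comp_def)
  also have "\<dots> = free_eval S (h \<circ> \<eta>) (h \<circ> x) p"
    unfolding free_eval_def by (simp add: word eta h_word)
  finally show ?thesis .
qed

context galois_setting
begin

lemma skew_const_0: "skew_const 0 = (\<lambda>_. 0)"
  by (auto simp: skew_const_def)

lemma skew_const_eq_0_iff [simp]: "skew_const a = (\<lambda>_. 0) \<longleftrightarrow> a = 0"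
  by (simp flip: skew_const_0)

lemma K_zero_closed: "(\<lambda>_. 0) \<in> carrier \<K>"
  using ring.ring_simprules(2)[OF ring_K] by (simp add: K_simps)

lemma K_one_not_zero: "\<one>\<^bsub>\<K>\<^esub> \<noteq> \<zero>\<^bsub>\<K>\<^esub>"
  by (simp add: K_simps)

lemma skew_eq_0_iff: "x \<in> carrier \<L> \<Longrightarrow> x = (\<lambda>_. 0) \<longleftrightarrow> (\<forall>w. act x w = 0)"
  using act_eq_0[of x] act_zero by blast

lemma skew_const_mult:
  assumes "x \<in> carrier \<L>" shows "skew_const a \<star> x = (\<lambda>\<mu>. a * x \<mu>)"
  by (rule skew_eqI)
     (use assms in \<open>simp_all add: skew_mult_closed skew_const_closed skew_scale_closed act_mult
        act_const act_scale\<close>)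

lemma act_finsum:
  assumes "finite A" and "f \<in> A \<rightarrow> carrier \<K>"
  shows "act (finsum \<K> f A) w = (\<Sum>a\<in>A. act (f a) w)"
proof -
  interpret ring \<K> by (rule ring_K)
  show ?thesis using assms
  proof (induction A rule: finite_induct)
    case empty
    then show ?case by (simp add: K_simps act_zero)
  next
    case (insert a A)
    then have "f a \<in> carrier \<K>" "finsum \<K> f A \<in> carrier \<K>" by auto
    then have "act (f a \<oplus>\<^bsub>\<K>\<^esub> finsum \<K> f A) w = act (f a) w + act (finsum \<K> f A) w"
      using act_plus[OF K_in_L K_in_L] by (simp add: K_simps skew_add)
    with insert show ?case by simp
  qed
qed

lemma act_word_eval:
  assumes "range x \<subseteq> carrier \<K>"
  shows "act (word_eval \<K> x u) w = foldr (\<lambda>i. act (x i)) u w"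
proof (induction u)
  case Nil
  then show ?case by (simp add: word_eval_def K_simps act_const)
next
  case (Cons i u)
  interpret ring \<K> by (rule ring_K)
  have "x i \<in> carrier \<L>" using assms K_in_L by auto
  moreover have "word_eval \<K> x u \<in> carrier \<L>"
    using word_eval_closed[OF monoid_axioms assms] K_in_L by blast
  ultimately have "act (x i \<bullet> word_eval \<K> x u) w = act (x i) (act (word_eval \<K> x u) w)"
    by (simp add: K_simps act_mult)
  then show ?case using Cons by (simp add: word_eval_def)
qed

text \<open>Averaging over \<open>G\<close> after multiplication by a suitable scalar moves an element of \<open>L * M\<close> into
  the invariants without losing a given coefficient.\<close>

lemma symmetrize:
  assumes y: "y \<in> carrier \<L>" and \<mu>: "y \<mu> \<noteq> 0"
  obtains x where "x \<in> carrier \<K>" "x \<mu> \<noteq> 0" "\<And>w. w \<in> fixed_G \<Longrightarrow> act y w = 0 \<Longrightarrow> act x w = 0"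
proof -
  \<comment> \<open>The sum is the coefficient at \<mu> of the average of a y over G. It cannot
    vanish for all a: the elements of G are independent, and \<open>id\<close> comes with the
    coefficient \<open>y \<mu>\<close>, which is nonzero.\<close>
  have "\<exists>a. (\<Sum>g\<in>G. fract_ext g (y (inv_into UNIV g \<circ> \<mu> \<circ> g)) * fract_ext g a) \<noteq> 0"
  proof (rule ccontr)
    assume *: "\<not> ?thesis"
    have "\<forall>g\<in>G. fract_ext g (y (inv_into UNIV g \<circ> \<mu> \<circ> g)) = 0"
    proof (rule fract_ext_independence[OF G_fin G_aut, where X = UNIV])
      show "\<exists>x\<in>UNIV. fract_ext g x \<noteq> fract_ext h x" if "g \<in> G" "h \<in> G" "g \<noteq> h" for g h
        by (rule fract_ext_separates[OF G_aut G_aut]) (use that in auto)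
    qed (use * in auto)
    then have "fract_ext id (y (inv_into UNIV id \<circ> \<mu> \<circ> id)) = 0" using G_id by blast
    then show False using \<mu> by (simp add: fract_ext_id)
  qed
  then obtain a where a: "(\<Sum>g\<in>G. fract_ext g (y (inv_into UNIV g \<circ> \<mu> \<circ> g)) * fract_ext g a) \<noteq> 0" ..
  define z where "z = (\<lambda>\<nu>. a * y \<nu>)"
  have z: "z \<in> carrier \<L>" unfolding z_def by (rule skew_scale_closed[OF y])
  define x where "x = (\<lambda>\<rho>. \<Sum>g\<in>G. skew_act g z \<rho>)"
  have sum: "(\<lambda>\<rho>. \<Sum>g\<in>H. skew_act g z \<rho>) \<in> carrier \<L> \<and>
      act (\<lambda>\<rho>. \<Sum>g\<in>H. skew_act g z \<rho>) w = (\<Sum>g\<in>H. act (skew_act g z) w)"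
    if "finite H" "H \<subseteq> G" for H w
    using that
  proof (induction H rule: finite_induct)
    case empty
    then show ?case by (simp add: skew_zero_closed act_zero)
  next
    case (insert g H)
    then have g: "skew_act g z \<in> carrier \<L>" by (intro skew_act_closed z) auto
    with insert show ?case
      using skew_add_closed[OF g] act_add[of "skew_act g z"] by (simp add: in_skew_ring_iff)
  qed
  have x: "x \<in> carrier \<L>" using sum[OF G_fin order_refl] by (simp add: x_def)
  have x_apply: "act x w = (\<Sum>g\<in>G. fract_ext g (act z (fract_ext (inv_into UNIV g) w)))" for w
    using sum[OF G_fin order_refl, of w] by (simp add: x_def act_skew_act z)
  have "x \<in> carrier \<K>"
    unfolding in_K_iff
  proof (intro conjI x ballI allI)
    fix h w assume h: "h \<in> G"
    note inj = finite_group_translation(1)[OF G_fin G_aut G_comp h]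
      and surj = finite_group_translation(2)[OF G_fin G_aut G_comp h]
    have cancel: "fract_ext (inv_into UNIV (h \<circ> g)) (fract_ext h w) = fract_ext (inv_into UNIV g) w"
      if g: "g \<in> G" for g
    proof -
      have "fract_ext (inv_into UNIV (h \<circ> g)) (fract_ext h w) =
          fract_ext (inv_into UNIV (h \<circ> g)) (fract_ext (h \<circ> g) (fract_ext (inv_into UNIV g) w))"
        by (simp add: fract_ext_comp G_aut g h fract_ext_inv)
      also have "\<dots> = fract_ext (inv_into UNIV g) w"
        by (rule fract_ext_inv(2)) (intro G_aut G_comp g h)
      finally show ?thesis .
    qed
    have "act x (fract_ext h w) =
        (\<Sum>g\<in>(\<circ>) h ` G. fract_ext g (act z (fract_ext (inv_into UNIV g) (fract_ext h w))))"
      by (simp only: surj x_apply)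
    also have "\<dots> = (\<Sum>g\<in>G. fract_ext (h \<circ> g) (act z (fract_ext (inv_into UNIV (h \<circ> g)) (fract_ext h w))))"
      by (simp only: sum.reindex[OF inj] comp_def)
    also have "\<dots> = fract_ext h (act x w)"
      unfolding x_apply fract_ext_sum[OF G_aut[OF h]]
      by (rule sum.cong) (simp_all add: cancel fract_ext_comp G_aut h)
    finally show "act x (fract_ext h w) = fract_ext h (act x w)" .
  qed
  moreover have "x \<mu> \<noteq> 0"
  proof -
    have "x \<mu> = (\<Sum>g\<in>G. fract_ext g (y (inv_into UNIV g \<circ> \<mu> \<circ> g)) * fract_ext g a)"
      unfolding x_def skew_act_def z_def by (rule sum.cong) (simp_all add: fract_ext_mult G_aut mult.commute)
    then show ?thesis using a by simp
  qed
  \<comment> \<open>Averaging does not move the points of K, so those killed by y are killed by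
    x.\<close>
  moreover have "act x w = 0" if w: "w \<in> fixed_G" "act y w = 0" for w
  proof -
    have "fract_ext (inv_into UNIV g) w = w" if "g \<in> G" for g
      using w(1) G_inv[OF that] by (simp add: fixed_G_def)
    then show ?thesis
      unfolding x_apply using w(2) by (simp add: z_def act_scale fract_ext_0 G_aut)
  qed
  ultimately show thesis by (rule that)
qed

text \<open>Comparing coefficients at \<mu> in z c = c z shows that either z vanishes at \<mu> or
  \<mu> fixes c, and an element of M other than \<open>id\<close> moves some c in \<Gamma>.\<close>

lemma center_K_const:
  assumes "z \<in> carrier \<L>" and comm: "\<And>c. c \<in> \<Gamma> \<Longrightarrow> z \<star> skew_const c = skew_const c \<star> z"
  shows "z = skew_const (z id)"
proof
  fix \<mu>
  have "\<mu> = id" if "z \<mu> \<noteq> 0"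
  proof (rule ccontr)
    assume ne: "\<mu> \<noteq> id"
    have \<mu>: "\<mu> \<in> M" using that assms(1) by (auto simp: in_skew_ring_iff support_def)
    obtain a where a: "a \<in> invariants G" "\<mu> a \<noteq> a"
      using M_separates_invariants[OF \<mu> M_id ne] by auto
    let ?c = "to_fract a"
    have "(z \<star> skew_const ?c) \<mu> = z \<mu> * fract_ext \<mu> ?c"
    proof (cases "a = 0")
      case False
      have "{p \<in> support z \<times> {id}. fst p \<circ> snd p = \<mu>} = {(\<mu>, id)}"
        using that by (auto simp: support_def)
      then show ?thesis using False by (simp add: skew_mult_eq support_skew_const) (simp add: skew_const_def)
    qed (use a ring_autD(3)[OF M_aut[OF \<mu>]] in simp)
    moreover have "(skew_const ?c \<star> z) \<mu> = ?c * z \<mu>"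
      by (simp add: skew_const_mult assms(1))
    moreover have "fract_ext \<mu> ?c \<noteq> ?c" using a by (simp add: fract_ext_to_fract M_aut \<mu>)
    ultimately show False using comm[of ?c] a that by (metis imageI mult.commute mult_left_cancel)
  qed
  then show "z \<mu> = skew_const (z id) \<mu>" by (auto simp: skew_const_def)
qed

lemma center_K_subset: "center \<K> \<subseteq> range skew_const"
proof
  fix z assume z: "z \<in> center \<K>"
  have "z = skew_const (z id)"
  proof (rule center_K_const)
    show "z \<in> carrier \<L>" using z by (auto simp: center_def K_in_L)
    show "z \<star> skew_const c = skew_const c \<star> z" if "c \<in> \<Gamma>" for c
      using z that to_fract_in_fixed_G by (auto simp: center_def skew_const_in_K_iff K_simps)
  qed
  then show "z \<in> range skew_const" by (rule range_eqI)
qed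

lemma finite_M_if_finite_dimension:
  assumes "ring.finite_dimension \<K> (center \<K>) (carrier \<K>)"
  shows "finite M"
proof -
  interpret ring \<K> by (rule ring_K)
  have supp: "\<exists>S. finite S \<and> (\<forall>x\<in>E. support x \<subseteq> S)" if "dimension n (center \<K>) E" for n E
    using that
  proof (induction n "center \<K>" E rule: dimension.induct)
    case zero_dim
    show ?case by (rule exI[of _ "{}"]) (simp add: K_simps support_def)
  next
    case (Suc_dim v E n)
    from Suc_dim.hyps(4) obtain S where S: "finite S" "\<forall>x\<in>E. support x \<subseteq> S" by blast
    \<comment> \<open>Central scalars are constants multiplying from the left, so adjoining v
      enlarges the supports by at most that of v.\<close>
    have "support x \<subseteq> S \<union> support v" if "x \<in> line_extension (center \<K>) v E" for x
    proof -
      obtain k e where k: "k \<in> center \<K>" and e: "e \<in> E" and x: "x = k \<bullet> v \<oplus>\<^bsub>\<K>\<^esub> e"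
        using \<open>x \<in> _\<close> by (auto simp: line_extension_mem_iff)
      obtain a where "k = skew_const a" using center_K_subset k by blast
      then have "x = (\<lambda>\<mu>. a * v \<mu> + e \<mu>)"
        using x skew_const_mult[OF K_in_L[OF \<open>v \<in> carrier \<K>\<close>]] by (simp add: K_simps)
      then show ?thesis using S e by (force simp: support_def)
    qed
    moreover have "finite (support v)" using \<open>v \<in> carrier \<K>\<close> K_in_L by (auto simp: in_skew_ring_iff)
    ultimately show ?case using S by (intro exI[of _ "S \<union> support v"]) auto
  qed
  obtain S where S: "finite S" "\<forall>x\<in>carrier \<K>. support x \<subseteq> S"
    using assms supp unfolding finite_dimension_def by blast
  have "M \<subseteq> S"
  proof
    fix \<mu> assume \<mu>: "\<mu> \<in> M"
    \<comment> \<open>The group element \<mu> itself; symmetrizing moves it into \<K> and keeps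
      \<mu> in the support.\<close>
    define y :: "('a \<Rightarrow> 'a) \<Rightarrow> 'a fract" where "y = (\<lambda>\<nu>. if \<nu> = \<mu> then 1 else 0)"
    have "support y = {\<mu>}" by (auto simp: y_def support_def)
    then have "y \<in> carrier \<L>" using \<mu> by (simp add: in_skew_ring_iff)
    then obtain x where "x \<in> carrier \<K>" "x \<mu> \<noteq> 0"
      by (rule symmetrize[of y \<mu>]) (auto simp: y_def)
    then show "\<mu> \<in> S" using S by (auto simp: support_def)
  qed
  then show ?thesis using S finite_subset by blast
qed

end

text \<open>\<open>\<kappa>\<close> abstracts the structure map of k into \<Gamma>. Its additivity
  is what transports the signs of the standard polynomial to L.\<close>

locale galois_ring_setting = galois_setting M G
  for M G :: "('a::idom \<Rightarrow> 'a) set" +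
  fixes U :: "(('a \<Rightarrow> 'a) \<Rightarrow> 'a fract) set" and \<kappa> :: "'k::field \<Rightarrow> 'a fract"
  assumes U: "galois_ring G M U"
    and \<kappa>_Gamma: "\<And>c. \<kappa> c \<in> \<Gamma>"
    and \<kappa>_M: "\<And>\<mu> c. \<mu> \<in> M \<Longrightarrow> fract_ext \<mu> (\<kappa> c) = \<kappa> c"
    and \<kappa>_0: "\<kappa> 0 = 0" and \<kappa>_1: "\<kappa> 1 = 1"
    and \<kappa>_add: "\<And>c d. \<kappa> (c + d) = \<kappa> c + \<kappa> d"
begin

abbreviation "\<eta> \<equiv> \<lambda>c. skew_const (\<kappa> c)"
abbreviation "R \<equiv> \<K>\<lparr>carrier := U\<rparr>"

lemma subring_U: "subring U \<K>"
  using U by (simp add: galois_ring_def)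

lemma U_subset: "U \<subseteq> carrier \<K>"
  using subringE(1)[OF subring_U] .

lemma U_in_L: "x \<in> U \<Longrightarrow> x \<in> carrier \<L>"
  using U_subset K_in_L by blast

lemma ring_R: "ring R"
  using ring.subring_is_ring[OF ring_K subring_U] .

lemma Gamma_in_U: "c \<in> \<Gamma> \<Longrightarrow> skew_const c \<in> U"
  using U by (auto simp: galois_ring_def embedded_Gamma_def)

lemma U_mult: "x \<in> U \<Longrightarrow> y \<in> U \<Longrightarrow> x \<star> y \<in> U"
  using subringE(6)[OF subring_U] by (simp add: K_simps)

lemma U_add: "x \<in> U \<Longrightarrow> y \<in> U \<Longrightarrow> (\<lambda>\<mu>. x \<mu> + y \<mu>) \<in> U"
  using subringE(7)[OF subring_U, of x y] by (simp add: K_simps)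

lemma U_scale: "c \<in> \<Gamma> \<Longrightarrow> x \<in> U \<Longrightarrow> (\<lambda>\<mu>. c * x \<mu>) \<in> U"
  using U_mult[OF Gamma_in_U, of c x] by (simp add: skew_const_mult U_in_L)

text \<open>The usable form of KU = \<K>: a finite sum of products of a fraction over \<Gamma> with
  an element of U is brought to one denominator.\<close>

lemma common_denominator:
  assumes "x \<in> carrier \<K>"
  shows "\<exists>a\<in>invariants G. a \<noteq> 0 \<and> (\<lambda>\<mu>. to_fract a * x \<mu>) \<in> U"
proof -
  have "x \<in> ideal_prod \<K> (embedded_K G) U"
    using assms U by (simp add: galois_ring_def)
  then show ?thesis
  proof (induction rule: ideal_prod.induct)
    case (prod i j)
    then obtain a b where ab: "a \<in> invariants G" "b \<in> invariants G" "b \<noteq> 0" "i = skew_const (Fract a b)"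
      by (auto simp: embedded_K_def)
    have "(\<lambda>\<mu>. to_fract b * (i \<bullet> j) \<mu>) = (\<lambda>\<mu>. to_fract a * j \<mu>)"
      using ab prod by (simp add: K_simps skew_const_mult U_in_L Fract_conv_to_fract)
    then show ?case using ab prod U_scale[of "to_fract a" j] by auto
  next
    case (sum s1 s2)
    then obtain a b where a: "a \<in> invariants G" "a \<noteq> 0" "(\<lambda>\<mu>. to_fract a * s1 \<mu>) \<in> U"
      and b: "b \<in> invariants G" "b \<noteq> 0" "(\<lambda>\<mu>. to_fract b * s2 \<mu>) \<in> U" by blast
    have "(\<lambda>\<mu>. to_fract (a * b) * (s1 \<oplus>\<^bsub>\<K>\<^esub> s2) \<mu>)
        = (\<lambda>\<mu>. to_fract b * (to_fract a * s1 \<mu>) + to_fract a * (to_fract b * s2 \<mu>))"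
      by (simp add: K_simps algebra_simps)
    also have "\<dots> \<in> U"
      using U_add[OF U_scale[OF _ a(3)] U_scale[OF _ b(3)]] a b by simp
    finally show ?case using a b invariants_closed(3)[of a b] by (intro bexI[of _ "a * b"]) auto
  qed
qed

lemma prime_R: "prime_ring R"
  unfolding prime_ring_def
proof (intro conjI ballI impI ring_R)
  show "\<one>\<^bsub>R\<^esub> \<noteq> \<zero>\<^bsub>R\<^esub>" by (simp add: K_one_not_zero)
  fix a b assume a: "a \<in> carrier R" and b: "b \<in> carrier R"
    and zero: "\<forall>r\<in>carrier R. a \<otimes>\<^bsub>R\<^esub> r \<otimes>\<^bsub>R\<^esub> b = \<zero>\<^bsub>R\<^esub>"
  have aL: "a \<in> carrier \<L>" and bL: "b \<in> carrier \<L>" using a b by (simp_all add: U_in_L)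
  have "a = (\<lambda>_. 0)" if b0: "b \<noteq> (\<lambda>_. 0)"
  proof -
    obtain v where v: "act b v \<noteq> 0" using act_eq_0[OF bL] b0 by blast
    show ?thesis
    proof (rule act_eq_0_on_line[OF aL v])
      fix c assume c: "c \<in> \<Gamma>"
      have "a \<star> skew_const c \<star> b = (\<lambda>_. 0)"
        using zero Gamma_in_U[OF c] by (simp add: K_simps)
      then have "act (a \<star> skew_const c \<star> b) v = 0" by (simp add: act_zero)
      then show "act a (c * act b v) = 0"
        using aL bL by (simp add: act_mult skew_mult_closed skew_const_closed act_const)
    qed
  qed
  then show "a = \<zero>\<^bsub>R\<^esub> \<or> b = \<zero>\<^bsub>R\<^esub>" by (auto simp: K_simps)
qed

lemma \<eta>_in_U: "range \<eta> \<subseteq> U"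
  using Gamma_in_U \<kappa>_Gamma by auto

lemma \<eta>_in_K: "\<eta> c \<in> carrier \<K>"
  using \<eta>_in_U U_subset by blast

lemma zero_in_U: "(\<lambda>_. 0) \<in> U"
  using subringE(2)[OF subring_U] by (simp add: K_simps)

lemma act_free_eval:
  assumes "range x \<subseteq> carrier \<K>"
  shows "act (free_eval \<K> \<eta> x p) w = operator_eval \<kappa> (\<lambda>i. act (x i)) p w"
proof -
  interpret ring \<K> by (rule ring_K)
  have word: "word_eval \<K> x u \<in> carrier \<K>" for u
    by (rule word_eval_closed[OF monoid_axioms assms])
  have "act (\<eta> c \<bullet> word_eval \<K> x u) w = \<kappa> c * foldr (\<lambda>i. act (x i)) u w" for c u
    by (simp add: K_simps act_mult[OF K_in_L[OF \<eta>_in_K] K_in_L[OF word]] act_const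
        act_word_eval[OF assms])
  then show ?thesis
    unfolding free_eval_def operator_eval_def
    by (subst act_finsum) (auto intro!: m_closed \<eta>_in_K word)
qed

lemma free_eval_R:
  assumes "range x \<subseteq> U" shows "free_eval R \<eta> x p = free_eval \<K> \<eta> x p"
proof -
  have "ring_hom_ring R \<K> id"
    by (rule ring_hom_ringI[OF ring_R ring_K]) (use U_subset in auto)
  from free_eval_hom[OF this, of x \<eta> p] show ?thesis using assms \<eta>_in_U by (simp add: comp_def)
qed

lemma free_eval_in_K:
  assumes "range x \<subseteq> carrier \<K>" shows "free_eval \<K> \<eta> x p \<in> carrier \<K>"
proof -
  interpret ring \<K> by (rule ring_K)
  show ?thesis unfolding free_eval_def
    by (rule finsum_closed) (auto intro!: m_closed \<eta>_in_K word_eval_closed[OF monoid_axioms assms])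
qed

lemma free_eval_eq_0_iff:
  assumes "range x \<subseteq> carrier \<K>"
  shows "free_eval \<K> \<eta> x p = \<zero>\<^bsub>\<K>\<^esub> \<longleftrightarrow> (\<forall>w. operator_eval \<kappa> (\<lambda>i. act (x i)) p w = 0)"
  using K_in_L[OF free_eval_in_K[OF assms]]
  by (simp add: K_simps skew_eq_0_iff act_free_eval[OF assms])

text \<open>By faithfulness an identity becomes a statement about operators on L, and its scalars
  need no further ring computations.\<close>

lemma identities_K_iff:
  "p \<in> polynomial_identities \<K> \<eta> \<longleftrightarrow>
     (\<forall>x. range x \<subseteq> carrier \<K> \<longrightarrow> (\<forall>w. operator_eval \<kappa> (\<lambda>i. act (x i)) p w = 0))"
  using free_eval_eq_0_iff by (auto simp: polynomial_identities_def)

lemma identities_R_iff: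
  "p \<in> polynomial_identities R \<eta> \<longleftrightarrow>
     (\<forall>x. range x \<subseteq> U \<longrightarrow> (\<forall>w. operator_eval \<kappa> (\<lambda>i. act (x i)) p w = 0))"
proof -
  have "free_eval R \<eta> x p = \<zero>\<^bsub>R\<^esub> \<longleftrightarrow> (\<forall>w. operator_eval \<kappa> (\<lambda>i. act (x i)) p w = 0)"
    if "range x \<subseteq> U" for x
    using free_eval_eq_0_iff[OF subset_trans[OF that U_subset]] by (simp add: free_eval_R[OF that])
  then show ?thesis by (auto simp: polynomial_identities_def)
qed

section \<open>Absence of identities for infinite M\<close>

lemma word_operator_in_L:
  assumes "\<And>i. i \<in> set ps \<Longrightarrow> Y i \<in> carrier \<L>"
  shows "\<exists>X\<in>carrier \<L>. \<forall>w. act X w = foldr (\<lambda>i. act (Y i)) ps w"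
  using assms
proof (induction ps)
  case Nil
  then show ?case by (intro bexI[of _ "skew_const 1"]) (auto simp: act_const skew_const_closed)
next
  case (Cons i ps)
  then obtain X where X: "X \<in> carrier \<L>" "\<forall>w. act X w = foldr (\<lambda>i. act (Y i)) ps w" by auto
  have "Y i \<in> carrier \<L>" using Cons.prems by simp
  then show ?case using X
    by (intro bexI[of _ "Y i \<star> X"]) (auto simp: act_mult skew_mult_closed)
qed

text \<open>Makes a multilinear expression the action of a single element, to which
  \<open>act_eq_0_on_line\<close> can be applied.\<close>

lemma sum_operator_in_L:
  assumes "finite P" and "\<And>ps i. ps \<in> P \<Longrightarrow> i \<in> set ps \<Longrightarrow> Y i \<in> carrier \<L>"
  shows "\<exists>X\<in>carrier \<L>. \<forall>w. act X w = (\<Sum>ps\<in>P. c ps * foldr (\<lambda>i. act (Y i)) ps w)"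
  using assms
proof (induction P rule: finite_induct)
  case empty
  then show ?case by (intro bexI[of _ "\<lambda>_. 0"]) (auto simp: act_zero skew_zero_closed)
next
  case (insert ps P)
  then obtain X where X: "X \<in> carrier \<L>"
    "\<forall>w. act X w = (\<Sum>ps\<in>P. c ps * foldr (\<lambda>i. act (Y i)) ps w)" by auto
  obtain Z where Z: "Z \<in> carrier \<L>" "\<forall>w. act Z w = foldr (\<lambda>i. act (Y i)) ps w"
    using word_operator_in_L[of ps Y] insert.prems by auto
  have cZ: "(\<lambda>\<mu>. c ps * Z \<mu>) \<in> carrier \<L>" by (rule skew_scale_closed[OF Z(1)])
  show ?case
    using insert.hyps X(2) Z(2) act_plus[OF cZ X(1)] skew_plus_closed[OF cZ X(1)]
    by (intro bexI[of _ "(\<lambda>\<mu>. c ps * Z \<mu>) \<oplus>\<^bsub>\<L>\<^esub> X"]) (simp_all add: act_scale)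
qed

text \<open>The letters of a multilinear identity are peeled off from the right: all letters but the last
  one are taken from the annihilator of a vector \<open>v\<close> which the last letter does not kill. What
  remains vanishes on a line over \<open>\<Gamma>\<close>, hence is an identity of degree one less on
  the annihilator of \<open>v\<close>.\<close>

lemma no_multilinear_identity:
  assumes kill: "\<And>V. finite V \<Longrightarrow> V \<subseteq> fixed_G \<Longrightarrow> \<exists>x\<in>U. (\<forall>v\<in>V. act x v = 0) \<and> x \<noteq> (\<lambda>_. 0)"
    and "finite V" "V \<subseteq> fixed_G" and "c [0..<d] \<noteq> 0"
    and "\<And>Y w. (\<And>i. i < d \<Longrightarrow> Y i \<in> U) \<Longrightarrow> (\<And>i v. i < d \<Longrightarrow> v \<in> V \<Longrightarrow> act (Y i) v = 0) \<Longrightarrow>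
       (\<Sum>ps\<in>permutations_of_set {..<d}. c ps * foldr (\<lambda>i. act (Y i)) ps w) = 0"
  shows False
  using assms(2-)
proof (induction d arbitrary: c V)
  case 0
  have "c [] * 1 = 0" using "0.prems"(4)[of "\<lambda>_. (\<lambda>_. 0)" 1] by simp
  then show False using "0.prems"(3) by simp
next
  case (Suc d)
  obtain z where z: "z \<in> U" "\<forall>v\<in>V. act z v = 0" "z \<noteq> (\<lambda>_. 0)"
    using kill[OF Suc.prems(1,2)] by blast
  \<comment> \<open>The vector has to come from K: it joins V, and annihilators are only supplied
    for finite subsets of K.\<close>
  have "\<exists>v\<in>fixed_G. act z v \<noteq> 0"
    using fixed_G_eqI[OF U_in_L[OF z(1)] skew_zero_closed] z(3) by (auto simp: act_zero)
  then obtain v where v: "v \<in> fixed_G" "act z v \<noteq> 0" by blast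
  show False
  proof (rule Suc.IH[of "insert v V" "\<lambda>qs. c (qs @ [d])"])
    show "finite (insert v V)" "insert v V \<subseteq> fixed_G" "c ([0..<d] @ [d]) \<noteq> 0"
      using Suc.prems v by auto
    fix Y w
    assume Y: "\<And>i. i < d \<Longrightarrow> Y i \<in> U" and YV: "\<And>i u. i < d \<Longrightarrow> u \<in> insert v V \<Longrightarrow> act (Y i) u = 0"
    have "\<exists>X\<in>carrier \<L>. \<forall>w. act X w =
        (\<Sum>qs\<in>permutations_of_set {..<d}. c (qs @ [d]) * foldr (\<lambda>i. act (Y i)) qs w)"
    proof (rule sum_operator_in_L)
      fix qs i assume "qs \<in> permutations_of_set {..<d}" "i \<in> set qs"
      then show "Y i \<in> carrier \<L>" by (intro U_in_L Y) (auto simp: permutations_of_set_def)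
    qed simp
    then obtain X where X: "X \<in> carrier \<L>" "\<And>w. act X w =
        (\<Sum>qs\<in>permutations_of_set {..<d}. c (qs @ [d]) * foldr (\<lambda>i. act (Y i)) qs w)"
      by blast
    have "X = (\<lambda>_. 0)"
    proof (rule act_eq_0_on_line[OF X(1) v(2)])
      fix \<gamma> assume \<gamma>: "\<gamma> \<in> \<Gamma>"
      \<comment> \<open>The last letter is z scaled by \<gamma>; letting \<gamma> vary over \<Gamma>
        is what fills the line through \<open>act z v\<close>.\<close>
      define Z where "Z i = (if i < d then Y i else (\<lambda>\<mu>. \<gamma> * z \<mu>))" for i
      let ?f = "\<lambda>ps. c ps * foldr (\<lambda>i. act (Z i)) ps v"
      let ?P = "permutations_of_set {..<Suc d}" and ?Q = "permutations_of_set {..<d}"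
      have Z_U: "Z i \<in> U" for i using Y U_scale[OF \<gamma> z(1)] by (simp add: Z_def)
      have fold_0: "foldr (\<lambda>i. act (Z i)) qs 0 = 0" for qs
        by (induction qs) (simp_all add: act_0_arg U_in_L Z_U)
      have 1: "(\<Sum>ps\<in>?P. ?f ps) = 0"
      proof (rule Suc.prems(4)[of Z v])
        fix i u assume "u \<in> V"
        then show "act (Z i) u = 0" using YV[of i u] z(2) by (simp add: Z_def act_scale)
      qed (rule Z_U)
      \<comment> \<open>The rightmost letter acts first. If it is not d, it is one of the operators
        chosen to annihilate v, and the whole word gives 0.\<close>
      have 2: "(\<Sum>ps\<in>?P. ?f ps) = (\<Sum>ps\<in>(\<lambda>qs. qs @ [d]) ` ?Q. ?f ps)"
      proof (rule sum.mono_neutral_right)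
        show "(\<lambda>qs. qs @ [d]) ` ?Q \<subseteq> ?P"
        proof (rule image_subsetI)
          fix qs assume "qs \<in> ?Q"
          then show "qs @ [d] \<in> ?P" by (simp add: permutations_of_set_def lessThan_Suc)
        qed
        show "\<forall>ps\<in>?P - (\<lambda>qs. qs @ [d]) ` ?Q. ?f ps = 0"
        proof
          fix ps assume ps: "ps \<in> ?P - (\<lambda>qs. qs @ [d]) ` ?Q"
          then have "ps \<in> ?P" by (rule DiffD1)
          then have ps_perm: "set ps = {..<Suc d}" "distinct ps" by (simp_all add: permutations_of_set_def)
          have "d \<in> set ps" unfolding ps_perm(1) by simp
          then have "ps \<noteq> []" by (cases ps) simp_all
          then obtain qs l where qs: "ps = qs @ [l]" by (cases ps rule: rev_cases) simp_all
          then have dist: "distinct qs" "l \<notin> set qs" "insert l (set qs) = {..<Suc d}"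
            using ps_perm by auto
          have "l \<noteq> d"
          proof
            assume l: "l = d"
            have "set qs = {..<d}"
              using dist(2,3) insert_ident[of d "set qs" "{..<d}"] unfolding l lessThan_Suc by simp
            then have "qs \<in> ?Q" using dist(1) by (simp add: permutations_of_set_def)
            then show False using ps qs l by blast
          qed
          moreover have "l \<in> {..<Suc d}" using dist(3) by blast
          ultimately have "l < d" by simp
          then have "act (Z l) v = 0" using YV[of l v] by (simp add: Z_def)
          then show "?f ps = 0" by (simp add: qs fold_0)
        qed
      qed simp
      have 3: "(\<Sum>ps\<in>(\<lambda>qs. qs @ [d]) ` ?Q. ?f ps) = (\<Sum>qs\<in>?Q. ?f (qs @ [d]))"
        by (subst sum.reindex) (auto simp: inj_on_def)
      have 4: "?f (qs @ [d]) = c (qs @ [d]) * foldr (\<lambda>i. act (Y i)) qs (\<gamma> * act z v)"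
        if "qs \<in> ?Q" for qs
      proof -
        have "foldr (\<lambda>i. act (Z i)) qs u = foldr (\<lambda>i. act (Y i)) qs u" for u
          by (rule foldr_cong) (use that in \<open>auto simp: permutations_of_set_def Z_def\<close>)
        then show ?thesis by (simp add: Z_def act_scale)
      qed
      have "act X (\<gamma> * act z v) = (\<Sum>qs\<in>?Q. ?f (qs @ [d]))"
        unfolding X(2) by (rule sum.cong[OF refl 4[symmetric]])
      then show "act X (\<gamma> * act z v) = 0" using 1 2 3 by (simp only:)
    qed
    then show "(\<Sum>ps\<in>permutations_of_set {..<d}. c (ps @ [d]) * foldr (\<lambda>i. act (Y i)) ps w) = 0"
      using X(2)[of w] by (simp add: act_zero)
  qed
qed

lemma killing_element:
  assumes inf: "infinite M" and V: "finite V" "V \<subseteq> fixed_G"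
  shows "\<exists>x\<in>U. (\<forall>v\<in>V. act x v = 0) \<and> x \<noteq> (\<lambda>_. 0)"
proof -
  \<comment> \<open>One unknown coefficient more than there are equations
    \<open>act y v = 0\<close>.\<close>
  obtain S where S: "finite S" "card S = Suc (card V)" "S \<subseteq> M"
    using infinite_arbitrarily_large[OF inf] by blast
  obtain c where c: "\<exists>\<mu>\<in>S. c \<mu> \<noteq> 0" "\<forall>v\<in>V. (\<Sum>\<mu>\<in>S. c \<mu> * fract_ext \<mu> v) = 0"
    using homogeneous_system_solution[OF V(1) S(1), of UNIV fract_ext] S(2) by auto
  define y where "y = (\<lambda>\<mu>. if \<mu> \<in> S then c \<mu> else 0)"
  have supp: "support y \<subseteq> S" by (auto simp: y_def support_def split: if_splits)
  have y: "y \<in> carrier \<L>" using supp S finite_subset by (auto simp: in_skew_ring_iff)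
  have y_V: "act y v = 0" if "v \<in> V" for v
  proof -
    have "act y v = (\<Sum>\<mu>\<in>S. c \<mu> * fract_ext \<mu> v)"
      unfolding act_superset[OF S(1) supp] by (rule sum.cong) (auto simp: y_def)
    then show ?thesis using c(2) that by simp
  qed
  obtain \<mu> where "\<mu> \<in> S" "c \<mu> \<noteq> 0" using c(1) by blast
  then have "y \<mu> \<noteq> 0" by (simp add: y_def)
  then obtain x where x: "x \<in> carrier \<K>" "x \<mu> \<noteq> 0"
    "\<And>w. w \<in> fixed_G \<Longrightarrow> act y w = 0 \<Longrightarrow> act x w = 0"
    using symmetrize[OF y] by blast
  obtain a where a: "a \<in> invariants G" "a \<noteq> 0" "(\<lambda>\<mu>. to_fract a * x \<mu>) \<in> U"
    using common_denominator[OF x(1)] by blast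
  have "(\<lambda>\<mu>. to_fract a * x \<mu>) \<noteq> (\<lambda>_. 0)" using x(2) a(2) by (auto simp: fun_eq_iff)
  moreover have "\<forall>v\<in>V. act (\<lambda>\<mu>. to_fract a * x \<mu>) v = 0"
    using x(3) y_V V(2) by (auto simp: act_scale)
  ultimately show ?thesis using a(3) by blast
qed

lemma finite_M_if_PI:
  assumes "PI_algebra R \<eta>" shows "finite M"
proof (rule ccontr)
  assume inf: "infinite M"
  obtain p w where p: "p \<in> polynomial_identities R \<eta>" and w: "Poly_Mapping.lookup p w = 1"
    and len: "\<And>v. v \<in> Poly_Mapping.keys p \<Longrightarrow> length v \<le> length w"
    using assms unfolding PI_algebra_def has_monic_leading_word_def by blast
  have "(\<Sum>ps\<in>permutations_of_set {..<length w}.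
      \<kappa> (Poly_Mapping.lookup p (map ((!) w) ps)) * foldr (\<lambda>i. act (Y i)) ps u) = 0"
    if Y: "\<And>i. i < length w \<Longrightarrow> Y i \<in> U" for Y u
  proof (rule multilinear_identity[where S = "act ` U"])
    show "Z (a + b) = Z a + Z b" if "Z \<in> act ` U" for Z a b
      using that by (auto simp: act_add_arg U_in_L)
    show "(\<lambda>_. 0) \<in> act ` U"
      using zero_in_U by (rule rev_image_eqI) (simp add: act_zero fun_eq_iff)
    show "(\<lambda>v. A v + B v) \<in> act ` U" if AB: "A \<in> act ` U" "B \<in> act ` U" for A B
    proof -
      obtain x y where xy: "x \<in> U" "y \<in> U" "A = act x" "B = act y" using AB by blast
      have "(\<lambda>v. A v + B v) = act (\<lambda>\<mu>. x \<mu> + y \<mu>)"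
        using U_in_L[OF xy(1)] U_in_L[OF xy(2)] by (simp add: xy fun_eq_iff act_add in_skew_ring_iff)
      then show ?thesis using U_add[OF xy(1,2)] by blast
    qed
    show "operator_eval \<kappa> X p v = 0" if X: "range X \<subseteq> act ` U" for X v
    proof -
      have "\<forall>i. \<exists>x\<in>U. X i = act x" using X by blast
      then obtain x where x: "\<forall>i. x i \<in> U \<and> X i = act (x i)" by metis
      then have "X = (\<lambda>i. act (x i))" "range x \<subseteq> U" by auto
      then show ?thesis using p unfolding identities_R_iff by simp
    qed
  qed (use len Y \<kappa>_0 in auto)
  \<comment> \<open>The list \<open>[0..<length w]\<close> reads off the leading word, whose
    coefficient is 1.\<close>
  then show False
    by (intro no_multilinear_identity[OF killing_element[OF inf], of "{}" 
          "\<lambda>ps. \<kappa> (Poly_Mapping.lookup p (map ((!) w) ps))" "length w"])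
       (simp_all add: map_nth w \<kappa>_1)
qed

end

section \<open>Matrix units for a finite group\<close>

context galois_setting
begin

text \<open>The fixed field F of G and M together. For finite M its constants turn out to be exactly
  the center of \<K>.\<close>

definition fixed_GM :: "'a fract set" where
  "fixed_GM = {w \<in> fixed_G. \<forall>\<mu>\<in>M. fract_ext \<mu> w = w}"

lemma fixed_GM_closed:
  "0 \<in> fixed_GM" "1 \<in> fixed_GM" "v \<in> fixed_GM \<Longrightarrow> w \<in> fixed_GM \<Longrightarrow> v + w \<in> fixed_GM"
  "v \<in> fixed_GM \<Longrightarrow> w \<in> fixed_GM \<Longrightarrow> v - w \<in> fixed_GM"
  "v \<in> fixed_GM \<Longrightarrow> w \<in> fixed_GM \<Longrightarrow> v * w \<in> fixed_GM" "v \<in> fixed_GM \<Longrightarrow> w \<in> fixed_GM \<Longrightarrow> v / w \<in> fixed_GM"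
  by (simp_all add: fixed_GM_def fixed_G_def fract_ext_0 fract_ext_1 fract_ext_add fract_ext_diff
      fract_ext_mult fract_ext_divide G_aut M_aut)

lemma fixed_GM_in_G: "w \<in> fixed_GM \<Longrightarrow> w \<in> fixed_G"
  by (simp add: fixed_GM_def)

lemma act_fixed_GM_linear:
  assumes "x \<in> carrier \<L>" and "a \<in> fixed_GM"
  shows "act x (a * w) = a * act x w"
  unfolding act_def sum_distrib_left
proof (rule sum.cong[OF refl])
  fix \<mu> assume "\<mu> \<in> support x"
  then have "\<mu> \<in> M" using assms by (auto simp: in_skew_ring_iff)
  then have "fract_ext \<mu> (a * w) = a * fract_ext \<mu> w"
    using assms(2) by (simp add: fract_ext_mult M_aut fixed_GM_def)
  then show "x \<mu> * fract_ext \<mu> (a * w) = a * (x \<mu> * fract_ext \<mu> w)" by simp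
qed

text \<open>The points form a basis of K over F, and the T i are its coordinate functionals. They
  are the dual system of M with test set K, reindexed by numbers for the sake of matrices. Their
  values lie in F because dual functionals are M-invariant and \<K> preserves K.\<close>

lemma K_dual_basis:
  assumes fin: "finite M"
  shows "\<exists>v T. (\<forall>i<card M. v i \<in> fixed_G) \<and> (\<forall>i<card M. T i \<in> carrier \<K>) \<and>
    (\<forall>i<card M. \<forall>j<card M. act (T i) (v j) = (if i = j then 1 else 0)) \<and>
    (\<forall>i<card M. \<forall>w\<in>fixed_G. act (T i) w \<in> fixed_GM) \<and>
    (\<forall>w\<in>fixed_G. w = (\<Sum>i<card M. act (T i) w * v i))"
proof -
  have sep: "\<exists>x\<in>fixed_G. fract_ext \<mu> x \<noteq> fract_ext \<nu> x" if "\<mu> \<in> M" "\<nu> \<in> M" "\<mu> \<noteq> \<nu>" for \<mu> \<nu>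
    using M_separates_invariants[OF that] to_fract_in_fixed_G that
    by (metis fract_ext_to_fract M_aut to_fract_eq_iff)
  have "\<exists>v b. v ` M \<subseteq> fixed_G \<and>
    (\<forall>i\<in>M. \<forall>j\<in>M. (\<Sum>k\<in>M. b i k * fract_ext k (v j)) = (if i = j then 1 else 0)) \<and>
    (\<forall>c. \<forall>x\<in>fixed_G. (\<Sum>k\<in>M. c k * fract_ext k x)
        = (\<Sum>i\<in>M. (\<Sum>k\<in>M. c k * fract_ext k (v i)) * (\<Sum>k\<in>M. b i k * fract_ext k x))) \<and>
    (\<forall>h\<in>M. \<forall>i\<in>M. \<forall>x\<in>fixed_G.
        fract_ext h (\<Sum>k\<in>M. b i k * fract_ext k x) = (\<Sum>k\<in>M. b i k * fract_ext k x))"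
    by (rule finite_group_dual_system[OF fin M_aut M_id M_comp fixed_G_closed(2) fixed_G_closed(4) sep])
  then obtain v b where v: "v ` M \<subseteq> fixed_G"
    and vb: "\<forall>i\<in>M. \<forall>j\<in>M. (\<Sum>k\<in>M. b i k * fract_ext k (v j)) = (if i = j then 1 else 0)"
      "\<forall>c. \<forall>x\<in>fixed_G. (\<Sum>k\<in>M. c k * fract_ext k x)
        = (\<Sum>i\<in>M. (\<Sum>k\<in>M. c k * fract_ext k (v i)) * (\<Sum>k\<in>M. b i k * fract_ext k x))"
      "\<forall>h\<in>M. \<forall>i\<in>M. \<forall>x\<in>fixed_G.
        fract_ext h (\<Sum>k\<in>M. b i k * fract_ext k x) = (\<Sum>k\<in>M. b i k * fract_ext k x)"
    by (elim exE conjE)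
  define T where "T i = (\<lambda>k. if k \<in> M then b i k else 0)" for i
  have supp: "support (T i) \<subseteq> M" for i by (auto simp: T_def support_def split: if_splits)
  have TL: "T i \<in> carrier \<L>" for i
    using supp[of i] fin finite_subset by (auto simp: in_skew_ring_iff)
  have T_apply: "act (T i) w = (\<Sum>k\<in>M. b i k * fract_ext k w)" for i w
    unfolding act_superset[OF fin supp] by (rule sum.cong) (simp_all add: T_def)
  have dual: "act (T i) (v j) = (if i = j then 1 else 0)" if "i \<in> M" "j \<in> M" for i j
    using vb(1) that by (simp add: T_apply)
  have span: "act x w = (\<Sum>i\<in>M. act x (v i) * act (T i) w)"
    if x: "x \<in> carrier \<L>" and w: "w \<in> fixed_G" for x w
  proof -
    have "act x u = (\<Sum>k\<in>M. x k * fract_ext k u)" for u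
      by (rule act_superset[OF fin]) (use x in \<open>simp add: in_skew_ring_iff\<close>)
    then show ?thesis using vb(2)[rule_format, OF w, of x] by (simp only: T_apply)
  qed
  \<comment> \<open>Conjugation by g leaves the values at the points \<open>v j\<close> alone, since
    these points and the values 0 and 1 are fixed by G; by \<open>span\<close> the two elements then
    agree on all of K.\<close>
  have TK: "T i \<in> carrier \<K>" if i: "i \<in> M" for i
  proof -
    have "skew_act g (T i) = T i" if g: "g \<in> G" for g
    proof (rule fixed_G_eqI[OF skew_act_closed[OF g TL] TL])
      fix w assume w: "w \<in> fixed_G"
      have v_fix: "fract_ext (inv_into UNIV g) (v j) = v j" if "j \<in> M" for j
        using v that G_inv[OF g] by (auto simp: fixed_G_def)
      have "act (skew_act g (T i)) w
          = (\<Sum>j\<in>M. act (skew_act g (T i)) (v j) * act (T j) w)"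
        by (rule span[OF skew_act_closed[OF g TL] w])
      also have "\<dots> = (\<Sum>j\<in>M. if i = j then act (T j) w else 0)"
        by (rule sum.cong)
           (simp_all add: act_skew_act[OF g TL] v_fix dual i fract_ext_0 fract_ext_1 G_aut g)
      also have "\<dots> = act (T i) w" using fin i by simp
      finally show "act (skew_act g (T i)) w = act (T i) w" .
    qed
    then show ?thesis using TL by (simp add: invariant_skew_ring_def)
  qed
  have T_GM: "act (T i) w \<in> fixed_GM" if "i \<in> M" "w \<in> fixed_G" for i w
    using act_fixed_G[OF TK] vb(3) that by (simp add: fixed_GM_def T_apply)
  have expand: "w = (\<Sum>i\<in>M. act (T i) w * v i)" if "w \<in> fixed_G" for w
    using span[OF skew_const_closed[of 1] that] by (simp add: act_const mult.commute)
  obtain h where h: "bij_betw h {..<card M} M"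
    using ex_bij_betw_nat_finite[OF fin] by (auto simp: atLeast0LessThan)
  have hM: "h i \<in> M" if "i < card M" for i using h that by (auto simp: bij_betw_def)
  have h_eq: "h i = h j \<longleftrightarrow> i = j" if "i < card M" "j < card M" for i j
    using bij_betw_imp_inj_on[OF h] that by (auto simp: inj_on_def)
  show ?thesis
  proof (intro exI[of _ "v \<circ> h"] exI[of _ "T \<circ> h"] conjI allI impI ballI)
    fix w assume "w \<in> fixed_G"
    then have "w = (\<Sum>i\<in>M. act (T i) w * v i)" by (rule expand)
    also have "\<dots> = (\<Sum>i<card M. act (T (h i)) w * v (h i))"
      by (rule sum.reindex_bij_betw[OF h, symmetric])
    finally show "w = (\<Sum>i<card M. act ((T \<circ> h) i) w * (v \<circ> h) i)" by simp
  qed (use v in \<open>auto simp: hM TK dual h_eq T_GM\<close>)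
qed

end

section \<open>Matrix entries, center, simplicity and dimension of \<K>\<close>

locale matrix_units_setting = galois_ring_setting M G U \<kappa>
  for M G :: "('a::idom \<Rightarrow> 'a) set" and U and \<kappa> :: "'k::field \<Rightarrow> 'a fract" +
  fixes n :: nat and v :: "nat \<Rightarrow> 'a fract" and T :: "nat \<Rightarrow> ('a \<Rightarrow> 'a) \<Rightarrow> 'a fract"
  assumes M_fin: "finite M"
    and v_fixed: "\<And>i. i < n \<Longrightarrow> v i \<in> fixed_G"
    and T_K: "\<And>i. i < n \<Longrightarrow> T i \<in> carrier \<K>"
    and T_v: "\<And>i j. i < n \<Longrightarrow> j < n \<Longrightarrow> act (T i) (v j) = (if i = j then 1 else 0)"
    and T_GM: "\<And>i w. i < n \<Longrightarrow> w \<in> fixed_G \<Longrightarrow> act (T i) w \<in> fixed_GM"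
    and expand: "\<And>w. w \<in> fixed_G \<Longrightarrow> w = (\<Sum>i<n. act (T i) w * v i)"
begin

lemma n_pos: "0 < n"
  using expand[OF fixed_G_closed(2)] by (cases n) auto

text \<open>The map sending the basis vector \<open>v j\<close> to \<open>v i\<close> and the other
  basis vectors to 0.\<close>

definition unit_mat :: "nat \<Rightarrow> nat \<Rightarrow> ('a \<Rightarrow> 'a) \<Rightarrow> 'a fract" where
  "unit_mat i j = skew_const (v i) \<bullet> T j"

text \<open>The entry (i, j) of x as an F-linear map of K in the basis v.\<close>

definition coef :: "(('a \<Rightarrow> 'a) \<Rightarrow> 'a fract) \<Rightarrow> nat \<Rightarrow> nat \<Rightarrow> 'a fract" where
  "coef x i j = act (T i) (act x (v j))"

lemma unit_mat_K: "i < n \<Longrightarrow> j < n \<Longrightarrow> unit_mat i j \<in> carrier \<K>"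
  unfolding unit_mat_def
  by (intro monoid.m_closed[OF ring.is_monoid[OF ring_K]] T_K) (simp_all add: skew_const_in_K_iff v_fixed)

lemma act_unit_mat: "i < n \<Longrightarrow> j < n \<Longrightarrow> act (unit_mat i j) w = v i * act (T j) w"
  by (simp add: unit_mat_def K_simps act_mult skew_const_closed K_in_L T_K act_const)

lemma coef_GM: "x \<in> carrier \<K> \<Longrightarrow> i < n \<Longrightarrow> j < n \<Longrightarrow> coef x i j \<in> fixed_GM"
  unfolding coef_def by (intro T_GM act_fixed_G v_fixed)

lemma act_v: "x \<in> carrier \<K> \<Longrightarrow> j < n \<Longrightarrow> act x (v j) = (\<Sum>i<n. coef x i j * v i)"
  unfolding coef_def by (rule expand[OF act_fixed_G[OF _ v_fixed]])

lemma act_expand: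
  assumes x: "x \<in> carrier \<K>" and w: "w \<in> fixed_G"
  shows "act x w = (\<Sum>j<n. act (T j) w * act x (v j))"
proof -
  have "act x w = act x (\<Sum>j<n. act (T j) w * v j)"
    by (rule arg_cong[OF expand[OF w]])
  also have "\<dots> = (\<Sum>j<n. act x (act (T j) w * v j))"
    by (rule act_sum_arg[OF K_in_L[OF x]])
  also have "\<dots> = (\<Sum>j<n. act (T j) w * act x (v j))"
    by (rule sum.cong[OF refl]) (simp add: act_fixed_GM_linear[OF K_in_L[OF x] T_GM[OF _ w]])
  finally show ?thesis .
qed

lemma coef_eqI:
  assumes x: "x \<in> carrier \<K>" and y: "y \<in> carrier \<K>"
    and eq: "\<And>i j. i < n \<Longrightarrow> j < n \<Longrightarrow> coef x i j = coef y i j"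
  shows "x = y"
proof (rule fixed_G_eqI[OF K_in_L[OF x] K_in_L[OF y]])
  fix w assume w: "w \<in> fixed_G"
  have "act x (v j) = act y (v j)" if "j < n" for j
    unfolding act_v[OF x that] act_v[OF y that]
    by (rule sum.cong) (simp_all add: eq that)
  then show "act x w = act y w"
    unfolding act_expand[OF x w] act_expand[OF y w] by (intro sum.cong) simp_all
qed

lemma linear_combination:
  assumes "finite P" and "\<And>p. p \<in> P \<Longrightarrow> c p \<in> fixed_GM" and "\<And>p. p \<in> P \<Longrightarrow> y p \<in> carrier \<K>"
  shows "(\<lambda>\<mu>. \<Sum>p\<in>P. c p * y p \<mu>) \<in> carrier \<K> \<and>
    (\<forall>w. act (\<lambda>\<mu>. \<Sum>p\<in>P. c p * y p \<mu>) w = (\<Sum>p\<in>P. c p * act (y p) w))"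
  using assms
proof (induction P rule: finite_induct)
  case empty
  show ?case by (simp add: K_zero_closed act_zero)
next
  case (insert p P)
  interpret ring \<K> by (rule ring_K)
  have p: "(\<lambda>\<mu>. c p * y p \<mu>) \<in> carrier \<K>"
  proof -
    have "skew_const (c p) \<bullet> y p \<in> carrier \<K>"
      using insert.prems by (intro m_closed) (simp_all add: skew_const_in_K_iff fixed_GM_in_G)
    then show ?thesis using insert.prems by (simp add: K_simps skew_const_mult K_in_L)
  qed
  have P: "(\<lambda>\<mu>. \<Sum>p\<in>P. c p * y p \<mu>) \<in> carrier \<K>" using insert by simp
  show ?case
    using insert a_closed[OF p P] act_add[of "\<lambda>\<mu>. c p * y p \<mu>" "\<lambda>\<mu>. \<Sum>p\<in>P. c p * y p \<mu>"]
      K_in_L[OF p] K_in_L[OF P]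
    by (simp add: K_simps in_skew_ring_iff act_scale)
qed

lemma coef_linear_combination:
  assumes "finite P" and "\<And>p. p \<in> P \<Longrightarrow> c p \<in> fixed_GM" and "\<And>p. p \<in> P \<Longrightarrow> y p \<in> carrier \<K>"
    and "i < n" "j < n"
  shows "coef (\<lambda>\<mu>. \<Sum>p\<in>P. c p * y p \<mu>) i j = (\<Sum>p\<in>P. c p * coef (y p) i j)"
proof -
  have "coef (\<lambda>\<mu>. \<Sum>p\<in>P. c p * y p \<mu>) i j = act (T i) (\<Sum>p\<in>P. c p * act (y p) (v j))"
    using linear_combination[OF assms(1-3)] by (simp add: coef_def)
  also have "\<dots> = (\<Sum>p\<in>P. act (T i) (c p * act (y p) (v j)))"
    by (rule act_sum_arg[OF K_in_L[OF T_K[OF assms(4)]]])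
  also have "\<dots> = (\<Sum>p\<in>P. c p * coef (y p) i j)"
    unfolding coef_def
    by (rule sum.cong) (simp_all add: act_fixed_GM_linear K_in_L T_K assms)
  finally show ?thesis .
qed

lemma coef_unit_mat:
  assumes "i < n" "j < n" "k < n" "l < n"
  shows "coef (unit_mat i j) k l = (if k = i \<and> j = l then 1 else 0)"
proof -
  have "coef (unit_mat i j) k l = act (T k) ((if j = l then 1 else 0) * v i)"
    using assms by (simp add: coef_def act_unit_mat T_v mult.commute)
  also have "\<dots> = (if k = i \<and> j = l then 1 else 0)"
    using assms by (simp add: T_v act_0_arg K_in_L T_K)
  finally show ?thesis .
qed

lemma coef_zero: "i < n \<Longrightarrow> coef (\<lambda>_. 0) i j = 0"
  by (simp add: coef_def act_zero act_0_arg K_in_L T_K)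

lemma coef_add:
  "x \<in> carrier \<K> \<Longrightarrow> y \<in> carrier \<K> \<Longrightarrow> i < n \<Longrightarrow> coef (\<lambda>\<mu>. x \<mu> + y \<mu>) i j = coef x i j + coef y i j"
  using act_add[of x y "v j"] by (simp add: coef_def K_in_L[unfolded in_skew_ring_iff] act_add_arg K_in_L T_K)

lemma coef_scale:
  "a \<in> fixed_GM \<Longrightarrow> i < n \<Longrightarrow> coef (\<lambda>\<mu>. a * x \<mu>) i j = a * coef x i j"
  by (simp add: coef_def act_scale act_fixed_GM_linear K_in_L T_K)

lemma coef_mult:
  assumes x: "x \<in> carrier \<K>" and y: "y \<in> carrier \<K>" and i: "i < n" and j: "j < n"
  shows "coef (x \<bullet> y) i j = (\<Sum>k<n. coef x i k * coef y k j)"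
proof -
  have T: "T i \<in> carrier \<L>" by (intro K_in_L T_K i)
  have "coef (x \<bullet> y) i j = act (T i) (act x (act y (v j)))"
    by (simp add: coef_def K_simps act_mult K_in_L x y)
  also have "\<dots> = act (T i) (\<Sum>k<n. coef y k j * act x (v k))"
    unfolding act_expand[OF x act_fixed_G[OF y v_fixed[OF j]]]
    by (simp only: coef_def)
  also have "\<dots> = (\<Sum>k<n. act (T i) (coef y k j * act x (v k)))"
    by (rule act_sum_arg[OF T])
  also have "\<dots> = (\<Sum>k<n. coef y k j * coef x i k)"
    unfolding coef_def[of x]
    by (rule sum.cong) (simp_all add: act_fixed_GM_linear[OF T coef_GM[OF y _ j]])
  finally show ?thesis by (simp add: mult.commute)
qed

lemma coef_const:
  assumes "a \<in> fixed_GM" "i < n" "j < n" shows "coef (skew_const a) i j = (if i = j then a else 0)"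
  using assms by (simp add: coef_def act_const act_fixed_GM_linear K_in_L T_K T_v)

lemma center_K: "center \<K> = skew_const ` fixed_GM"
proof (intro equalityI subsetI)
  fix z assume z: "z \<in> center \<K>"
  then obtain a where a: "z = skew_const a" using center_K_subset by blast
  have aG: "a \<in> fixed_G" using z by (simp add: a center_def skew_const_in_K_iff)
  have e: "unit_mat 0 0 \<in> carrier \<K>" using n_pos by (intro unit_mat_K)
  \<comment> \<open>One matrix unit is enough: evaluated at the first basis vector it exhibits a as
    a value of \<open>T 0\<close>, and these lie in F.\<close>
  have "skew_const a \<star> unit_mat 0 0 = unit_mat 0 0 \<star> skew_const a"
    using z e by (simp add: a center_def K_simps)
  then have "act (skew_const a \<star> unit_mat 0 0) (v 0) = act (unit_mat 0 0 \<star> skew_const a) (v 0)"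
    by simp
  then have "a * v 0 = v 0 * act (T 0) (a * v 0)"
    by (simp add: act_mult skew_const_closed K_in_L[OF e] act_const act_unit_mat n_pos T_v)
  moreover have "v 0 \<noteq> 0"
    using T_v[OF n_pos n_pos] by (auto simp: act_0_arg K_in_L T_K n_pos)
  ultimately have "a = act (T 0) (a * v 0)" by (metis mult.commute mult_left_cancel)
  also have "\<dots> \<in> fixed_GM" by (intro T_GM n_pos fixed_G_closed(4) aG v_fixed)
  finally show "z \<in> skew_const ` fixed_GM" using a by blast
next
  fix z assume "z \<in> skew_const ` fixed_GM"
  then obtain a where a: "a \<in> fixed_GM" "z = skew_const a" by blast
  have "skew_const a \<star> x = x \<star> skew_const a" if "x \<in> carrier \<K>" for x
    by (rule skew_eqI)
       (simp_all add: K_in_L[OF that] skew_mult_closed skew_const_closed act_mult act_const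
         act_fixed_GM_linear a)
  then show "z \<in> center \<K>"
    using a by (simp add: center_def K_simps skew_const_in_K_iff fixed_GM_in_G)
qed

lemma skew_const_times: "skew_const a \<bullet> skew_const b = skew_const (a * b)"
  by (simp add: K_simps skew_const_mult skew_const_closed) (auto simp: skew_const_def fun_eq_iff)

lemma skew_const_plus: "skew_const a \<oplus>\<^bsub>\<K>\<^esub> skew_const b = skew_const (a + b)"
  by (auto simp: K_simps skew_const_def fun_eq_iff)

lemma skew_const_inv:
  assumes "a \<in> fixed_G" "a \<noteq> 0"
  shows "skew_const a \<in> Units \<K>" "inv\<^bsub>\<K>\<^esub> skew_const a = skew_const (1 / a)"
proof -
  interpret ring \<K> by (rule ring_K)
  have a: "skew_const a \<in> carrier \<K>" "skew_const (1 / a) \<in> carrier \<K>"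
    using assms fixed_G_closed by (simp_all add: skew_const_in_K_iff)
  have e: "skew_const a \<bullet> skew_const (1 / a) = \<one>\<^bsub>\<K>\<^esub>" "skew_const (1 / a) \<bullet> skew_const a = \<one>\<^bsub>\<K>\<^esub>"
    unfolding skew_const_times using assms by (simp_all add: K_simps)
  show "skew_const a \<in> Units \<K>" unfolding Units_def using a e by blast
  show "inv\<^bsub>\<K>\<^esub> skew_const a = skew_const (1 / a)" by (rule inv_unique'[OF a e, symmetric])
qed

text \<open>A nonzero entry c at (i, j) of some x in I can be moved by matrix units to any diagonal
  place and divided by c. So I contains all diagonal matrix units, and these sum to 1.\<close>

lemma simple_K: "simple_ring \<K>"
  unfolding simple_ring_def
proof (intro conjI allI impI ring_K)
  show "\<one>\<^bsub>\<K>\<^esub> \<noteq> \<zero>\<^bsub>\<K>\<^esub>" by (rule K_one_not_zero)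
  fix I assume "ideal I \<K>"
  then interpret ideal I \<K> .
  have "I = carrier \<K>" if ne: "I \<noteq> {\<zero>\<^bsub>\<K>\<^esub>}"
  proof -
    obtain x where x: "x \<in> I" "x \<noteq> (\<lambda>_. 0)"
      using ne additive_subgroup.zero_closed[OF is_additive_subgroup] by (auto simp: K_simps)
    have xK: "x \<in> carrier \<K>" using x Icarr by blast
    obtain i j where ij: "i < n" "j < n" "coef x i j \<noteq> 0"
      using coef_eqI[OF xK K_zero_closed] x(2) coef_zero by metis
    define c where "c = coef x i j"
    have c: "c \<in> fixed_GM" "c \<noteq> 0" unfolding c_def by (rule coef_GM[OF xK ij(1,2)]) (rule ij(3))
    have diag: "unit_mat k k \<in> I" if k: "k < n" for k
    proof -
      define y where "y = unit_mat k i \<bullet> x \<bullet> unit_mat j k"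
      have yI: "y \<in> I" unfolding y_def by (intro I_l_closed I_r_closed unit_mat_K x ij k)
      then have zI: "skew_const (1 / c) \<bullet> y \<in> I"
        using fixed_GM_closed(6)[OF fixed_GM_closed(2) c(1)]
        by (intro I_l_closed) (simp_all add: skew_const_in_K_iff fixed_GM_in_G)
      have eK: "unit_mat k i \<in> carrier \<L>" "unit_mat j k \<in> carrier \<L>" "unit_mat k k \<in> carrier \<L>"
        by (intro K_in_L unit_mat_K ij k)+
      note xL = K_in_L[OF xK]
      have "skew_const (1 / c) \<bullet> y = unit_mat k k"
      proof (rule fixed_G_eqI[OF K_in_L[OF Icarr[OF zI]] eK(3)])
        fix w assume w: "w \<in> fixed_G"
        have "act y w = v k * act (T i) (act x (act (T k) w * v j))"
          unfolding y_def using ij k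
          by (simp add: K_simps act_mult eK xL skew_mult_closed act_unit_mat mult.commute)
        also have "\<dots> = v k * (act (T k) w * c)"
          using ij by (simp add: act_fixed_GM_linear[OF _ T_GM[OF k w]] xL K_in_L T_K c_def coef_def)
        finally show "act (skew_const (1 / c) \<bullet> y) w = act (unit_mat k k) w"
          using c k by (simp add: K_simps act_mult skew_const_closed K_in_L[OF Icarr[OF yI]]
              act_const act_unit_mat)
      qed
      then show ?thesis using zI by simp
    qed
    have sum: "(\<lambda>\<mu>. \<Sum>k<m. unit_mat k k \<mu>) \<in> I" if "m \<le> n" for m
      using that
    proof (induction m)
      case 0
      then show ?case using additive_subgroup.zero_closed[OF is_additive_subgroup] by (simp add: K_simps)
    next
      case (Suc m)
      then have "(\<lambda>\<mu>. \<Sum>k<m. unit_mat k k \<mu>) \<oplus>\<^bsub>\<K>\<^esub> unit_mat m m \<in> I"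
        by (intro additive_subgroup.a_closed[OF is_additive_subgroup] diag) simp_all
      then show ?case by (simp add: K_simps)
    qed
    have "(\<lambda>\<mu>. \<Sum>k<n. 1 * unit_mat k k \<mu>) = \<one>\<^bsub>\<K>\<^esub>"
    proof (rule coef_eqI)
      show "(\<lambda>\<mu>. \<Sum>k<n. 1 * unit_mat k k \<mu>) \<in> carrier \<K>" using Icarr[OF sum[of n]] by simp
      fix i j assume ij: "i < n" "j < n"
      have "coef (\<lambda>\<mu>. \<Sum>k<n. 1 * unit_mat k k \<mu>) i j = (\<Sum>k<n. 1 * coef (unit_mat k k) i j)"
        by (rule coef_linear_combination) (use ij in \<open>simp_all add: fixed_GM_closed unit_mat_K\<close>)
      also have "\<dots> = (\<Sum>k<n. if k = i then (if i = j then 1 else 0) else 0)"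
        by (rule sum.cong) (use ij in \<open>auto simp: coef_unit_mat\<close>)
      finally show "coef (\<lambda>\<mu>. \<Sum>k<n. 1 * unit_mat k k \<mu>) i j = coef \<one>\<^bsub>\<K>\<^esub> i j"
        using ij by (simp add: K_simps coef_const fixed_GM_closed)
    qed simp
    then have "\<one>\<^bsub>\<K>\<^esub> \<in> I" using sum[of n] by simp
    then show ?thesis by (rule one_imp_carrier)
  qed
  then show "I = {\<zero>\<^bsub>\<K>\<^esub>} \<or> I = carrier \<K>" by blast
qed

text \<open>\<open>dimension\<close> grows by line extensions, so the index pairs are added one by
  one: E A holds the elements whose matrix is supported on A, and adjoining a matrix unit frees one
  more entry.\<close>

lemma dimension_K: "ring.dimension \<K> (n * n) (center \<K>) (carrier \<K>)"
proof -
  interpret ring \<K> by (rule ring_K)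
  let ?N = "{..<n} \<times> {..<n}"
  define E where "E A = {x \<in> carrier \<K>. \<forall>i<n. \<forall>j<n. (i, j) \<notin> A \<longrightarrow> coef x i j = 0}" for A
  have "dimension (card A) (center \<K>) (E A)" if "finite A" "A \<subseteq> ?N" for A
    using that
  proof (induction A rule: finite_induct)
    case empty
    have "x = (\<lambda>_. 0)" if "x \<in> E {}" for x
      by (rule coef_eqI[OF _ K_zero_closed]) (use that in \<open>simp_all add: E_def coef_zero\<close>)
    moreover have "(\<lambda>_. 0) \<in> E {}" by (simp add: E_def K_zero_closed coef_zero)
    ultimately have "E {} = {\<zero>\<^bsub>\<K>\<^esub>}" unfolding K_simps by blast
    then show ?case by simp
  next
    case (insert p A)
    obtain i j where p: "p = (i, j)" "i < n" "j < n" using insert.prems by auto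
    let ?e = "unit_mat i j"
    have e: "?e \<in> carrier \<K>" using p by (intro unit_mat_K)
    have "coef ?e i j = 1" using coef_unit_mat[of i j i j] p by simp
    moreover have "coef ?e i j = 0" if "?e \<in> E A"
      using that insert.hyps(2) p by (simp add: E_def)
    ultimately have e_notin: "?e \<notin> E A" by auto
    moreover have "line_extension (center \<K>) ?e (E A) = E (insert p A)"
    proof (intro equalityI subsetI)
      fix x assume "x \<in> line_extension (center \<K>) ?e (E A)"
      then obtain k y where k: "k \<in> center \<K>" and y: "y \<in> E A" and x: "x = k \<bullet> ?e \<oplus>\<^bsub>\<K>\<^esub> y"
        by (auto simp: line_extension_mem_iff)
      obtain a where a: "a \<in> fixed_GM" "k = skew_const a" using k center_K by auto
      have yK: "y \<in> carrier \<K>" using y by (simp add: E_def)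
      have kK: "k \<in> carrier \<K>" using k by (simp add: center_def)
      have ae: "k \<bullet> ?e = (\<lambda>\<mu>. a * ?e \<mu>)" using a e by (simp add: K_simps skew_const_mult K_in_L)
      have aeK: "(\<lambda>\<mu>. a * ?e \<mu>) \<in> carrier \<K>" using m_closed[OF kK e] by (simp add: ae)
      have "coef x r s = a * coef ?e r s + coef y r s" if "r < n" for r s
        unfolding x ae using coef_add[OF aeK yK that] coef_scale[OF a(1) that] by (simp add: K_simps)
      moreover have "x \<in> carrier \<K>" unfolding x by (intro a_closed m_closed kK e yK)
      ultimately show "x \<in> E (insert p A)"
        using y p by (auto simp: E_def coef_unit_mat)
    next
      fix x assume x: "x \<in> E (insert p A)"
      then have xK: "x \<in> carrier \<K>" by (simp add: E_def)
      define a where "a = coef x i j"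
      have a: "a \<in> fixed_GM" unfolding a_def by (intro coef_GM xK p)
      have ma: "- a \<in> fixed_GM" using fixed_GM_closed(4)[OF fixed_GM_closed(1) a] by simp
      define y where "y = (\<lambda>\<mu>. x \<mu> + (- a) * ?e \<mu>)"
      have aeK: "(\<lambda>\<mu>. (- a) * ?e \<mu>) \<in> carrier \<K>"
        using m_closed[OF _ e, of "skew_const (- a)"] ma e
        by (simp add: K_simps skew_const_mult K_in_L skew_const_in_K_iff fixed_GM_in_G)
      have yK: "y \<in> carrier \<K>" using a_closed[OF xK aeK] by (simp add: y_def K_simps)
      have "coef y r s = coef x r s - a * coef ?e r s" if "r < n" for r s
        unfolding y_def using coef_add[OF xK aeK that] coef_scale[OF ma that, of ?e] by simp
      then have "y \<in> E A" using x yK p by (auto simp: E_def coef_unit_mat a_def)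
      moreover have "x = skew_const a \<bullet> ?e \<oplus>\<^bsub>\<K>\<^esub> y"
        using e by (simp add: y_def K_simps skew_const_mult K_in_L)
      ultimately show "x \<in> line_extension (center \<K>) ?e (E A)"
        unfolding line_extension_mem_iff using a center_K by blast
    qed
    ultimately show ?case
      using Suc_dim[OF e _ insert.IH] insert by simp
  qed
  from this[of ?N] have "dimension (n * n) (center \<K>) (E ?N)" by (simp add: card_cartesian_product)
  moreover have "E ?N = carrier \<K>" by (auto simp: E_def)
  ultimately show ?thesis by simp
qed

lemma central_simple_K: "central_simple_algebra \<K>"
  unfolding central_simple_algebra_def ring.finite_dimension_def[OF ring_K]
  using simple_K dimension_K by blast

end

section \<open>Center, central localization and identities\<close>

context matrix_units_setting
begin

text \<open>The ring \<Gamma>^M. Its elements lie in U and are central in \<K>, which makes them the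
  central denominators; F is its field of fractions.\<close>

definition Z0 :: "'a set" where
  "Z0 = {a \<in> invariants G. \<forall>\<mu>\<in>M. \<mu> a = a}"

lemma to_fract_GM_iff: "to_fract a \<in> fixed_GM \<longleftrightarrow> a \<in> Z0"
  by (auto simp: fixed_GM_def fixed_G_def Z0_def invariants_def fract_ext_to_fract G_aut M_aut)

lemma Z0_closed: "1 \<in> Z0" "a \<in> Z0 \<Longrightarrow> b \<in> Z0 \<Longrightarrow> a * b \<in> Z0"
  using fixed_GM_closed(2,5) by (auto simp flip: to_fract_GM_iff)

lemma Z0_const_in_U: "a \<in> Z0 \<Longrightarrow> skew_const (to_fract a) \<in> U"
  by (intro Gamma_in_U imageI) (simp add: Z0_def)

text \<open>The multiple is the norm of d over M. Each g in G fixes d and permutes M by conjugation,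
  so it permutes the factors; the cofactor e is then G-invariant by cancelling d.\<close>

lemma Z0_multiple:
  assumes d: "d \<in> invariants G" "d \<noteq> 0"
  shows "\<exists>e\<in>invariants G. d * e \<in> Z0 \<and> d * e \<noteq> 0"
proof -
  define N where "N = (\<Prod>\<mu>\<in>M. \<mu> d)"
  define e where "e = (\<Prod>\<mu>\<in>M - {id}. \<mu> d)"
  have N: "N = d * e" unfolding N_def e_def using M_fin M_id by (subst prod.remove[of M id]) auto
  have N0: "N \<noteq> 0" unfolding N_def by (rule norm_nonzero[OF M_fin M_aut d(2)])
  have N_M: "\<mu> N = N" if "\<mu> \<in> M" for \<mu>
    unfolding N_def by (rule norm_invariant[OF M_fin M_aut M_comp that])
  have N_G: "g N = N" if g: "g \<in> G" for g
  proof -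
    let ?c = "\<lambda>\<mu>. g \<circ> \<mu> \<circ> inv_into UNIV g"
    have surj: "?c ` M = M"
      by (rule endo_inj_surj[OF M_fin _ conj_inj[OF g]]) (use conj[OF g] in blast)
    have "inv_into UNIV g d = d" using d(1) G_inv[OF g] by (simp add: invariants_def)
    then have "g N = (\<Prod>\<mu>\<in>M. ?c \<mu> d)" unfolding N_def ring_aut_prod[OF G_aut[OF g]] by simp
    also have "\<dots> = (\<Prod>\<mu>\<in>?c ` M. \<mu> d)" by (simp add: prod.reindex[OF conj_inj[OF g]])
    finally show ?thesis by (simp only: surj N_def)
  qed
  have "N \<in> Z0" using N_M N_G by (simp add: Z0_def invariants_def)
  moreover have "g e = e" if g: "g \<in> G" for g
  proof -
    have "g d * g e = d * e" using N_G[OF g] by (simp add: N ring_autD(5)[OF G_aut[OF g]])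
    moreover have "g d = d" using d(1) g by (simp add: invariants_def)
    ultimately show ?thesis using d(2) by simp
  qed
  ultimately show ?thesis using N N0 by (intro bexI[of _ e]) (auto simp: invariants_def)
qed

lemma fixed_GM_fraction:
  assumes a: "a \<in> fixed_GM"
  shows "\<exists>p\<in>Z0. \<exists>q\<in>Z0. q \<noteq> 0 \<and> a = to_fract p / to_fract q"
proof -
  obtain c d where cd: "a = Fract c d" "c \<in> invariants G" "d \<in> invariants G" "d \<noteq> 0"
    using fixed_GM_in_G[OF a] unfolding fixed_G_conv by blast
  obtain e where e: "d * e \<in> Z0" "d * e \<noteq> 0" using Z0_multiple[OF cd(3,4)] by blast
  have eq: "to_fract (c * e) = a * to_fract (d * e)"
    using cd e by (simp add: Fract_conv_to_fract)
  have "c * e \<in> Z0"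
    unfolding to_fract_GM_iff[symmetric] eq by (intro fixed_GM_closed(5) a) (simp add: to_fract_GM_iff e del: to_fract_mult)
  moreover have "a = to_fract (c * e) / to_fract (d * e)" unfolding eq using e by simp
  ultimately show ?thesis using e by blast
qed

lemma central_denominator:
  assumes "x \<in> carrier \<K>"
  shows "\<exists>z\<in>Z0. z \<noteq> 0 \<and> (\<lambda>\<mu>. to_fract z * x \<mu>) \<in> U"
proof -
  obtain a where a: "a \<in> invariants G" "a \<noteq> 0" "(\<lambda>\<mu>. to_fract a * x \<mu>) \<in> U"
    using common_denominator[OF assms] by blast
  obtain e where e: "e \<in> invariants G" "a * e \<in> Z0" "a * e \<noteq> 0" using Z0_multiple[OF a(1,2)] by blast
  have "(\<lambda>\<mu>. to_fract e * (to_fract a * x \<mu>)) \<in> U" by (rule U_scale) (use e a in auto)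
  then show ?thesis using e by (intro bexI[of _ "a * e"]) (simp_all add: ac_simps)
qed

text \<open>Commutation with U extends to all x in \<K>: some central multiple c x lies in U, and c
  can be cancelled afterwards.\<close>

lemma center_R: "center R = U \<inter> center \<K>"
proof (intro equalityI subsetI)
  fix z assume "z \<in> U \<inter> center \<K>"
  then show "z \<in> center R" using U_subset by (auto simp: center_def)
next
  fix z assume z: "z \<in> center R"
  then have zU: "z \<in> U" and comm: "\<And>u. u \<in> U \<Longrightarrow> z \<star> u = u \<star> z"
    by (auto simp: center_def K_simps)
  have "z \<star> x = x \<star> z" if x: "x \<in> carrier \<K>" for x
  proof -
    obtain c where c: "c \<in> Z0" "c \<noteq> 0" "(\<lambda>\<mu>. to_fract c * x \<mu>) \<in> U"
      using central_denominator[OF x] by blast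
    have cGM: "to_fract c \<in> fixed_GM" using c by (simp add: to_fract_GM_iff)
    note zL = U_in_L[OF zU] and xL = K_in_L[OF x]
    show ?thesis
    proof (rule skew_eqI[OF skew_mult_closed[OF zL xL] skew_mult_closed[OF xL zL]])
      fix w
      have "act (z \<star> (\<lambda>\<mu>. to_fract c * x \<mu>)) w = act ((\<lambda>\<mu>. to_fract c * x \<mu>) \<star> z) w"
        by (simp only: comm[OF c(3)])
      then have "to_fract c * act z (act x w) = to_fract c * act x (act z w)"
        by (simp add: act_mult zL skew_scale_closed[OF xL] act_scale
            act_fixed_GM_linear[OF zL cGM])
      then show "act (z \<star> x) w = act (x \<star> z) w"
        using c(2) by (simp add: act_mult zL xL)
    qed
  qed
  then show "z \<in> U \<inter> center \<K>" using zU U_subset by (auto simp: center_def K_simps)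
qed

lemma Z0_const_in_center: "a \<in> Z0 \<Longrightarrow> skew_const (to_fract a) \<in> center R"
  by (simp add: center_R center_K Z0_const_in_U to_fract_GM_iff)

abbreviation "central_denoms \<equiv> center R - {\<zero>\<^bsub>R\<^esub>}"

lemma center_R_nonzero:
  assumes "s \<in> central_denoms"
  shows "\<exists>a\<in>fixed_GM. a \<noteq> 0 \<and> s = skew_const a"
  using assms by (auto simp: center_R center_K K_simps)

lemma center_R_units: "central_denoms \<subseteq> Units \<K>"
proof
  fix z assume "z \<in> central_denoms"
  from center_R_nonzero[OF this] obtain a where "a \<in> fixed_GM" "z = skew_const a" "a \<noteq> 0" by blast
  then show "z \<in> Units \<K>" using skew_const_inv(1) fixed_GM_in_G by blast
qed

lemma fractions_center_R: "fractions_in \<K> (center R) = center \<K>"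
proof (intro equalityI subsetI)
  fix z assume "z \<in> fractions_in \<K> (center R)"
  then obtain a b where ab: "a \<in> center R" "b \<in> center R - {\<zero>\<^bsub>\<K>\<^esub>}" "z = a \<bullet> inv\<^bsub>\<K>\<^esub> b"
    by (auto simp: fractions_in_def)
  obtain c where "c \<in> fixed_GM" "a = skew_const c" using ab(1) by (auto simp: center_R center_K)
  moreover obtain d where "d \<in> fixed_GM" "b = skew_const d" "d \<noteq> 0"
    using center_R_nonzero[of b] ab(2) by auto
  ultimately show "z \<in> center \<K>"
    using ab(3) fixed_GM_closed(6)[of c d]
    by (simp add: skew_const_inv fixed_GM_in_G skew_const_times center_K)
next
  fix z assume "z \<in> center \<K>"
  then obtain a where a: "a \<in> fixed_GM" "z = skew_const a" by (auto simp: center_K)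
  obtain p q where pq: "p \<in> Z0" "q \<in> Z0" "q \<noteq> 0" "a = to_fract p / to_fract q"
    using fixed_GM_fraction[OF a(1)] by blast
  have "to_fract q \<in> fixed_G" using pq by (simp add: to_fract_GM_iff fixed_GM_in_G)
  then have "z = skew_const (to_fract p) \<bullet> inv\<^bsub>\<K>\<^esub> skew_const (to_fract q)"
    using pq a by (simp add: skew_const_inv skew_const_times)
  moreover have "skew_const (to_fract q) \<noteq> \<zero>\<^bsub>\<K>\<^esub>" using pq by (simp add: K_simps)
  ultimately show "z \<in> fractions_in \<K> (center R)"
    unfolding fractions_in_def using Z0_const_in_center pq by blast
qed

section \<open>The standard identity on U\<close>

lemma PI_R: "PI_algebra R \<eta>"
proof -
  \<comment> \<open>One more than the dimension of \<K> over its center, so that any N elements are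
    linearly dependent over F.\<close>
  define N where "N = n * n + 1"
  let ?P = "{\<sigma>. \<sigma> permutes {..<N}}"
  let ?w = "\<lambda>\<sigma>. map \<sigma> [0..<N]"
  define p :: "'k free_algebra" where "p = (\<Sum>\<sigma>\<in>?P. Poly_Mapping.single (?w \<sigma>) (of_int (sign \<sigma>)))"
  have finP: "finite ?P" by (rule finite_permutations) simp
  \<comment> \<open>Different permutations give different words, so no coefficients merge and the
    word of \<open>id\<close> keeps the coefficient 1.\<close>
  have inj: "inj_on ?w ?P"
  proof (rule inj_onI)
    fix \<sigma> \<tau> assume "\<sigma> \<in> ?P" "\<tau> \<in> ?P" and eq: "?w \<sigma> = ?w \<tau>"
    have "\<sigma> i = \<tau> i" for i
    proof (cases "i < N")
      case True
      then show ?thesis using arg_cong[OF eq, of "\<lambda>l. l ! i"] by simp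
    next
      case False
      then show ?thesis using \<open>\<sigma> \<in> ?P\<close> \<open>\<tau> \<in> ?P\<close> by (simp add: permutes_not_in)
    qed
    then show "\<sigma> = \<tau>" by blast
  qed
  have lookup: "Poly_Mapping.lookup p (?w \<sigma>) = of_int (sign \<sigma>)" if "\<sigma> \<in> ?P" for \<sigma>
  proof -
    have "Poly_Mapping.lookup p (?w \<sigma>) = (\<Sum>\<tau>\<in>?P. if \<tau> = \<sigma> then of_int (sign \<tau>) else 0)"
      unfolding p_def lookup_sum
    proof (rule sum.cong[OF refl])
      fix \<tau> assume "\<tau> \<in> ?P"
      then have "?w \<tau> = ?w \<sigma> \<longleftrightarrow> \<tau> = \<sigma>" using that by (rule inj_on_eq_iff[OF inj])
      then show "Poly_Mapping.lookup (Poly_Mapping.single (?w \<tau>) (of_int (sign \<tau>))) (?w \<sigma>)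
          = (if \<tau> = \<sigma> then of_int (sign \<tau>) else 0)"
        by (simp add: lookup_single when_def del: map_eq_conv)
    qed
    then show ?thesis using finP that by simp
  qed
  have keys: "Poly_Mapping.keys p \<subseteq> ?w ` ?P"
    unfolding p_def by (rule order_trans[OF keys_sum]) auto
  have "operator_eval \<kappa> (\<lambda>i. act (x i)) p w = 0" if x: "range x \<subseteq> U" for x w
  proof -
    have xK: "x k \<in> carrier \<K>" for k using x U_subset by blast
    \<comment> \<open>The dependence is found by making all n * n matrix entries vanish. Its
      coefficients lie in F, so they commute with the operators as \<open>standard_sum_eq_0\<close>
      requires.\<close>
    have "\<exists>c. range c \<subseteq> fixed_GM \<and> (\<exists>k\<in>{..<N}. c k \<noteq> 0) \<and>
        (\<forall>ij\<in>{..<n} \<times> {..<n}. (\<Sum>k\<in>{..<N}. c k * coef (x k) (fst ij) (snd ij)) = 0)"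
    proof (rule homogeneous_system_solution)
      show "card ({..<n} \<times> {..<n}) < card {..<N}" by (simp add: N_def)
    qed (auto intro: fixed_GM_closed coef_GM xK)
    then obtain c where c: "range c \<subseteq> fixed_GM" "\<exists>k\<in>{..<N}. c k \<noteq> 0"
      "\<forall>ij\<in>{..<n} \<times> {..<n}. (\<Sum>k\<in>{..<N}. c k * coef (x k) (fst ij) (snd ij)) = 0"
      by (elim exE conjE)
    then obtain j where j: "j < N" "c j \<noteq> 0" by blast
    have cGM: "c k \<in> fixed_GM" for k using c(1) by blast
    note lc = linear_combination[of "{..<N}" c x, OF finite_lessThan cGM xK]
    have "(\<lambda>\<mu>. \<Sum>k\<in>{..<N}. c k * x k \<mu>) = (\<lambda>_. 0)"
    proof (rule coef_eqI[OF _ K_zero_closed])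
      fix i j assume "i < n" "j < n"
      then show "coef (\<lambda>\<mu>. \<Sum>k<N. c k * x k \<mu>) i j = coef (\<lambda>_. 0) i j"
        using coef_linear_combination[of "{..<N}" c x i j] c(3) cGM xK by (simp add: coef_zero)
    qed (use lc in blast)
    then have dep: "(\<Sum>k<N. c k * act (x k) u) = 0" for u
      using lc by (metis act_zero)
    have zero: "(\<Sum>\<sigma>\<in>?P. of_int (sign \<sigma>) * foldr (\<lambda>i. act (x i)) (?w \<sigma>) w) = 0"
      by (rule standard_sum_eq_0[OF dep j])
         (simp_all add: act_add_arg act_fixed_GM_linear K_in_L[OF xK] cGM)
    \<comment> \<open>Only the values 1 and -1 occur, and additivity of \<open>\<kappa>\<close>
      settles the second one.\<close>
    have \<kappa>_sign: "\<kappa> (of_int (sign \<sigma>)) = of_int (sign \<sigma>)" for \<sigma> :: "nat \<Rightarrow> nat"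
    proof -
      have "\<kappa> (-1) + \<kappa> 1 = 0" by (simp add: \<kappa>_0 flip: \<kappa>_add)
      then have "\<kappa> (-1) = -1" by (simp add: \<kappa>_1 eq_neg_iff_add_eq_0)
      then show ?thesis by (simp add: sign_def \<kappa>_1)
    qed
    have "operator_eval \<kappa> (\<lambda>i. act (x i)) p w =
        (\<Sum>u\<in>?w ` ?P. \<kappa> (Poly_Mapping.lookup p u) * foldr (\<lambda>i. act (x i)) u w)"
      unfolding operator_eval_def
      by (rule sum.mono_neutral_left) (use keys finP in \<open>auto simp: \<kappa>_0 in_keys_iff\<close>)
    also have "\<dots> = (\<Sum>\<sigma>\<in>?P. \<kappa> (Poly_Mapping.lookup p (?w \<sigma>)) * foldr (\<lambda>i. act (x i)) (?w \<sigma>) w)"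
      by (rule sum.reindex_cong[OF inj refl refl])
    also have "\<dots> = (\<Sum>\<sigma>\<in>?P. of_int (sign \<sigma>) * foldr (\<lambda>i. act (x i)) (?w \<sigma>) w)"
      by (rule sum.cong[OF refl]) (simp only: lookup \<kappa>_sign)
    finally show ?thesis using zero by simp
  qed
  then have "p \<in> polynomial_identities R \<eta>" unfolding identities_R_iff by blast
  moreover have "has_monic_leading_word p"
    unfolding has_monic_leading_word_def
  proof (intro bexI[of _ "?w id"] conjI ballI)
    have id: "id \<in> ?P" by (simp add: permutes_id)
    show 1: "Poly_Mapping.lookup p (?w id) = 1" using lookup[OF id] by (simp add: sign_id)
    show "?w id \<in> Poly_Mapping.keys p" unfolding in_keys_iff 1 by simp
    show "length u \<le> length (?w id)" if "u \<in> Poly_Mapping.keys p" for u using that keys by auto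
  qed
  ultimately show ?thesis unfolding PI_algebra_def by blast
qed

section \<open>Transfer of identities from U to \<K>\<close>

lemma foldr_central_scale:
  assumes t: "t \<in> fixed_GM" and x: "\<And>i. i \<in> set u \<Longrightarrow> x i \<in> carrier \<L>"
  shows "foldr (\<lambda>i. act (\<lambda>\<mu>. t * x i \<mu>)) u w = t ^ length u * foldr (\<lambda>i. act (x i)) u w"
  using x
proof (induction u)
  case (Cons i u)
  have "t ^ m \<in> fixed_GM" for m
    by (induction m) (auto intro: fixed_GM_closed t)
  with Cons show ?case
    by (simp add: act_scale act_fixed_GM_linear mult.assoc)
qed simp

text \<open>Restricted to a finite set of indices, because denominators multiply; the variables
  occurring in a polynomial form such a set.\<close>

lemma central_common_denominator:
  assumes "finite V" and x: "range x \<subseteq> carrier \<K>"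
  shows "\<exists>z\<in>Z0. z \<noteq> 0 \<and> (\<forall>i\<in>V. (\<lambda>\<mu>. to_fract z * x i \<mu>) \<in> U)"
  using assms(1)
proof (induction V rule: finite_induct)
  case empty
  show ?case using Z0_closed(1) by (intro bexI[of _ 1]) auto
next
  case (insert i V)
  then obtain z where z: "z \<in> Z0" "z \<noteq> 0" "\<forall>i\<in>V. (\<lambda>\<mu>. to_fract z * x i \<mu>) \<in> U" by blast
  have "x i \<in> carrier \<K>" using x by blast
  then obtain y where y: "y \<in> Z0" "y \<noteq> 0" "(\<lambda>\<mu>. to_fract y * x i \<mu>) \<in> U"
    using central_denominator by blast
  have \<Gamma>: "to_fract z \<in> \<Gamma>" "to_fract y \<in> \<Gamma>" using z y by (simp_all add: Z0_def)
  have "(\<lambda>\<mu>. to_fract (y * z) * x k \<mu>) \<in> U" if "k \<in> insert i V" for k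
  proof (cases "k = i")
    case True
    then show ?thesis using U_scale[OF \<Gamma>(1) y(3)] by (simp add: ac_simps)
  next
    case False
    then have "(\<lambda>\<mu>. to_fract z * x k \<mu>) \<in> U" using that z(3) by blast
    from U_scale[OF \<Gamma>(2) this] show ?thesis by (simp add: ac_simps)
  qed
  then show ?case using y z Z0_closed(2)[OF y(1) z(1)] by (intro bexI[of _ "y * z"]) auto
qed

text \<open>Over an infinite \<open>Z0\<close> the value of an identity of \<open>U\<close> at \<open>t y\<close> is a polynomial in the
  central variable \<open>t\<close> with infinitely many zeros, so \<open>t\<close> may be specialised to the inverse
  of a common denominator. A finite \<open>Z0\<close> is a field, and then \<open>U\<close> is everything.\<close>

lemma identities_R_eq_K: "polynomial_identities R \<eta> = polynomial_identities \<K> \<eta>"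
proof (intro equalityI subsetI)
  fix p assume "p \<in> polynomial_identities \<K> \<eta>"
  then show "p \<in> polynomial_identities R \<eta>"
    using U_subset unfolding identities_K_iff identities_R_iff by blast
next
  fix p assume p: "p \<in> polynomial_identities R \<eta>"
  show "p \<in> polynomial_identities \<K> \<eta>"
  proof (cases "finite Z0")
    case True
    have "carrier \<K> \<subseteq> U"
    proof
      fix x assume "x \<in> carrier \<K>"
      then obtain z where z: "z \<in> Z0" "z \<noteq> 0" "(\<lambda>\<mu>. to_fract z * x \<mu>) \<in> U"
        using central_denominator by blast
      \<comment> \<open>In a finite domain multiplication by a nonzero element is onto, which
        inverts z.\<close>
      have "inj_on ((*) z) Z0" using z(2) by (simp add: inj_on_def)
      then have "(*) z ` Z0 = Z0"
        using endo_inj_surj[OF True] Z0_closed(2)[OF z(1)] by (metis image_subsetI)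
      then obtain y where y: "y \<in> Z0" "1 = z * y" using Z0_closed(1) by blast
      have "(\<lambda>\<mu>. to_fract y * (to_fract z * x \<mu>)) \<in> U"
        by (rule U_scale[OF _ z(3)]) (use y in \<open>simp add: Z0_def\<close>)
      moreover have "to_fract y * to_fract z = 1" using y(2) by (metis mult.commute to_fract_1 to_fract_mult)
      ultimately show "x \<in> U" by (simp add: mult.assoc[symmetric])
    qed
    then show ?thesis using p unfolding identities_K_iff identities_R_iff by (meson subset_trans)
  next
    case False
    show ?thesis unfolding identities_K_iff
    proof (intro allI impI)
      fix x :: "nat \<Rightarrow> ('a \<Rightarrow> 'a) \<Rightarrow> 'a fract" and w
      assume x: "range x \<subseteq> carrier \<K>"
      define V where "V = (\<Union>u\<in>Poly_Mapping.keys p. set u)"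
      have "finite V" by (simp add: V_def)
      then obtain z where z: "z \<in> Z0" "z \<noteq> 0" "\<forall>i\<in>V. (\<lambda>\<mu>. to_fract z * x i \<mu>) \<in> U"
        using central_common_denominator x by blast
      define y where "y i = (\<lambda>\<mu>. to_fract z * x i \<mu>)" for i
      have yL: "y i \<in> carrier \<L>" for i
        unfolding y_def using x by (intro skew_scale_closed K_in_L) blast
      \<comment> \<open>The value of p at t y, as a polynomial in t: each letter of a word
        contributes one factor t. With the vector w fixed its coefficients lie in the field
        L.\<close>
      define q where "q = (\<Sum>u\<in>Poly_Mapping.keys p.
        Polynomial.monom (\<kappa> (Poly_Mapping.lookup p u) * foldr (\<lambda>i. act (y i)) u w) (length u))"
      have q: "poly q t = operator_eval \<kappa> (\<lambda>i. act (\<lambda>\<mu>. t * y i \<mu>)) p w" if "t \<in> fixed_GM" for t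
        unfolding q_def operator_eval_def poly_sum Polynomial.poly_monom
        by (rule sum.cong[OF refl]) (simp add: foldr_central_scale[OF that yL])
      have zero: "poly q (to_fract t) = 0" if t: "t \<in> Z0" for t
      proof -
        \<comment> \<open>A variable absent from p may have a value that z does not bring into U, so
          it is set to 0; this does not affect the value of p.\<close>
        define y' where "y' i = (if i \<in> V then (\<lambda>\<mu>. to_fract t * y i \<mu>) else (\<lambda>_. 0))" for i
        have "(\<lambda>\<mu>. to_fract t * y i \<mu>) \<in> U" if "i \<in> V" for i
          using U_scale[of "to_fract t" "y i"] t z(3) that by (simp add: y_def Z0_def)
        then have y'U: "range y' \<subseteq> U" using zero_in_U by (auto simp: y'_def)
        have "foldr (\<lambda>i. act (\<lambda>\<mu>. to_fract t * y i \<mu>)) u w = foldr (\<lambda>i. act (y' i)) u w"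
          if "u \<in> Poly_Mapping.keys p" for u
          by (rule foldr_cong) (use that in \<open>auto simp: y'_def V_def\<close>)
        then have "poly q (to_fract t) = operator_eval \<kappa> (\<lambda>i. act (y' i)) p w"
          unfolding q[OF iffD2[OF to_fract_GM_iff t]] operator_eval_def by simp
        also have "\<dots> = 0" using p y'U unfolding identities_R_iff by blast
        finally show ?thesis .
      qed
      have "q = 0"
      proof (rule ccontr)
        assume "q \<noteq> 0"
        then have "finite {t. poly q t = 0}" by (rule poly_roots_finite)
        then have "finite (to_fract ` Z0)" by (rule rev_finite_subset) (use zero in auto)
        then show False using False by (simp add: finite_image_iff inj_on_def)
      qed
      moreover have "1 / to_fract z \<in> fixed_GM"
        using fixed_GM_closed(6)[OF fixed_GM_closed(2)] z(1) by (simp add: to_fract_GM_iff)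
      moreover have "(\<lambda>\<mu>. 1 / to_fract z * y i \<mu>) = x i" for i using z(2) by (simp add: y_def)
      ultimately show "operator_eval \<kappa> (\<lambda>i. act (x i)) p w = 0" using q by fastforce
    qed
  qed
qed

section \<open>\<K> as a matrix ring over its center\<close>

abbreviation "F \<equiv> \<K>\<lparr>carrier := center \<K>\<rparr>"

lemma subfield_center: "subfield (center \<K>) \<K>"
proof -
  interpret ring \<K> by (rule ring_K)
  have "subring (center \<K>) \<K>"
  proof (rule subringI)
    fix h assume h: "h \<in> center \<K>"
    then obtain a where a: "a \<in> fixed_GM" "h = skew_const a" by (auto simp: center_K)
    have ma: "- a \<in> fixed_GM" using fixed_GM_closed(4)[OF fixed_GM_closed(1) a(1)] by simp
    have "\<ominus>\<^bsub>\<K>\<^esub> h = skew_const (- a)"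
      by (rule minus_equality) (use a ma in \<open>simp_all add: skew_const_plus skew_const_in_K_iff fixed_GM_in_G, simp add: K_simps skew_const_0\<close>)
    then show "\<ominus>\<^bsub>\<K>\<^esub> h \<in> center \<K>" using ma by (simp add: center_K)
  next
    fix h k assume "h \<in> center \<K>" "k \<in> center \<K>"
    then show "h \<bullet> k \<in> center \<K>" "h \<oplus>\<^bsub>\<K>\<^esub> k \<in> center \<K>"
      by (auto simp: center_K skew_const_times skew_const_plus fixed_GM_closed)
  next
    show "\<one>\<^bsub>\<K>\<^esub> \<in> center \<K>" unfolding center_K K_simps using fixed_GM_closed(2) by blast
    show "center \<K> \<subseteq> carrier \<K>" unfolding center_def by blast
  qed
  then have "subcring (center \<K>) \<K>"
    by (rule subcringI) (unfold center_def, blast)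
  moreover have "Units F = center \<K> - {\<zero>\<^bsub>\<K>\<^esub>}"
  proof (intro equalityI subsetI)
    fix z assume z: "z \<in> Units F"
    then obtain y where y: "z \<in> center \<K>" "y \<in> center \<K>" "z \<bullet> y = \<one>\<^bsub>\<K>\<^esub>" by (auto simp: Units_def)
    moreover have "z \<noteq> \<zero>\<^bsub>\<K>\<^esub>"
    proof
      assume "z = \<zero>\<^bsub>\<K>\<^esub>"
      then have "\<one>\<^bsub>\<K>\<^esub> = \<zero>\<^bsub>\<K>\<^esub>" using y by (simp add: center_def)
      then show False by (simp add: K_simps)
    qed
    ultimately show "z \<in> center \<K> - {\<zero>\<^bsub>\<K>\<^esub>}" by blast
  next
    fix z assume "z \<in> center \<K> - {\<zero>\<^bsub>\<K>\<^esub>}"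
    then obtain a where a: "a \<in> fixed_GM" "z = skew_const a" "a \<noteq> 0"
      by (auto simp: center_K K_simps skew_const_0)
    have "1 / a \<in> fixed_GM" by (intro fixed_GM_closed a)
    moreover have "skew_const a \<bullet> skew_const (1 / a) = \<one>\<^bsub>\<K>\<^esub>" "skew_const (1 / a) \<bullet> skew_const a = \<one>\<^bsub>\<K>\<^esub>"
      unfolding skew_const_times using a by (simp_all add: K_simps)
    ultimately show "z \<in> Units F" using a unfolding Units_def by (auto simp: center_K)
  qed
  ultimately show ?thesis by (rule subfieldI)
qed

lemma ring_F: "ring F"
  using ring.subring_is_ring[OF ring_K subfieldE(1)[OF subfield_center]] .

definition to_matrix :: "(('a \<Rightarrow> 'a) \<Rightarrow> 'a fract) \<Rightarrow> nat \<times> nat \<Rightarrow> ('a \<Rightarrow> 'a) \<Rightarrow> 'a fract" where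
  "to_matrix x = (\<lambda>(i, j)\<in>{..<n} \<times> {..<n}. skew_const (coef x i j))"

lemma finsum_F:
  assumes "finite P" and "\<And>p. p \<in> P \<Longrightarrow> c p \<in> fixed_GM"
  shows "(\<Oplus>\<^bsub>F\<^esub>p\<in>P. skew_const (c p)) = skew_const (\<Sum>p\<in>P. c p)"
  using assms
proof (induction P rule: finite_induct)
  case empty
  interpret F: ring F by (rule ring_F)
  show ?case by (simp add: K_simps skew_const_0)
next
  case (insert p P)
  interpret F: ring F by (rule ring_F)
  have "(\<Oplus>\<^bsub>F\<^esub>p\<in>insert p P. skew_const (c p)) = skew_const (c p) \<oplus>\<^bsub>F\<^esub> (\<Oplus>\<^bsub>F\<^esub>p\<in>P. skew_const (c p))"
    using insert by (intro F.finsum_insert) (auto simp: center_K)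
  then show ?case using insert by (simp add: skew_const_plus)
qed

lemma to_matrix_hom: "to_matrix \<in> ring_hom \<K> (matrix_ring n F)"
proof (rule ring_hom_memI)
  interpret ring \<K> by (rule ring_K)
  let ?N = "{..<n} \<times> {..<n}"
  fix x assume x: "x \<in> carrier \<K>"
  show "to_matrix x \<in> carrier (matrix_ring n F)"
    using coef_GM[OF x] by (auto simp: matrix_ring_def to_matrix_def center_K)
  fix y assume y: "y \<in> carrier \<K>"
  show "to_matrix (x \<bullet> y) = to_matrix x \<otimes>\<^bsub>matrix_ring n F\<^esub> to_matrix y"
  proof
    fix ij :: "nat \<times> nat"
    show "to_matrix (x \<bullet> y) ij = (to_matrix x \<otimes>\<^bsub>matrix_ring n F\<^esub> to_matrix y) ij"
    proof (cases "ij \<in> ?N")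
      case True
      then obtain i j where ij: "ij = (i, j)" "i < n" "j < n" by auto
      have "(to_matrix x \<otimes>\<^bsub>matrix_ring n F\<^esub> to_matrix y) ij
          = (\<Oplus>\<^bsub>F\<^esub>k\<in>{..<n}. to_matrix x (i, k) \<otimes>\<^bsub>F\<^esub> to_matrix y (k, j))"
        using ij by (simp add: matrix_ring_def)
      also have "\<dots> = (\<Oplus>\<^bsub>F\<^esub>k\<in>{..<n}. skew_const (coef x i k * coef y k j))"
      proof -
        interpret F: ring F by (rule ring_F)
        show ?thesis
          by (rule F.finsum_cong') 
             (use ij coef_GM[OF x] coef_GM[OF y] in \<open>auto simp: to_matrix_def skew_const_times center_K fixed_GM_closed\<close>)
      qed
      also have "\<dots> = skew_const (\<Sum>k<n. coef x i k * coef y k j)"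
        by (rule finsum_F) (use ij coef_GM[OF x] coef_GM[OF y] in \<open>auto simp: fixed_GM_closed\<close>)
      also have "\<dots> = to_matrix (x \<bullet> y) ij"
        using ij by (simp add: to_matrix_def coef_mult x y)
      finally show ?thesis ..
    qed (auto simp: to_matrix_def matrix_ring_def)
  qed
  show "to_matrix (x \<oplus>\<^bsub>\<K>\<^esub> y) = to_matrix x \<oplus>\<^bsub>matrix_ring n F\<^esub> to_matrix y"
  proof
    fix ij :: "nat \<times> nat"
    show "to_matrix (x \<oplus>\<^bsub>\<K>\<^esub> y) ij = (to_matrix x \<oplus>\<^bsub>matrix_ring n F\<^esub> to_matrix y) ij"
    proof (cases "ij \<in> ?N")
      case True
      then obtain i j where ij: "ij = (i, j)" "i < n" "j < n" by auto
      have "coef (x \<oplus>\<^bsub>\<K>\<^esub> y) i j = coef x i j + coef y i j"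
        using coef_add[OF x y ij(2)] by (simp add: K_simps)
      then show ?thesis using ij by (simp add: to_matrix_def matrix_ring_def skew_const_plus)
    qed (auto simp: to_matrix_def matrix_ring_def)
  qed
next
  show "to_matrix \<one>\<^bsub>\<K>\<^esub> = \<one>\<^bsub>matrix_ring n F\<^esub>"
    by (auto simp: to_matrix_def matrix_ring_def K_simps coef_const fixed_GM_closed skew_const_0 fun_eq_iff)
qed

lemma to_matrix_inj: "inj_on to_matrix (carrier \<K>)"
proof (rule inj_onI)
  fix x y assume xy: "x \<in> carrier \<K>" "y \<in> carrier \<K>" and eq: "to_matrix x = to_matrix y"
  show "x = y"
  proof (rule coef_eqI[OF xy])
    fix i j assume "i < n" "j < n"
    then show "coef x i j = coef y i j"
      using fun_cong[OF eq, of "(i, j)"] by (simp add: to_matrix_def)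
  qed
qed

lemma to_matrix_surj: "to_matrix ` carrier \<K> = carrier (matrix_ring n F)"
proof (intro equalityI subsetI)
  fix B assume "B \<in> to_matrix ` carrier \<K>"
  then show "B \<in> carrier (matrix_ring n F)" using ring_hom_memE(1)[OF to_matrix_hom] by blast
next
  let ?N = "{..<n} \<times> {..<n}"
  fix B assume B: "B \<in> carrier (matrix_ring n F)"
  then have B_ext: "B \<in> ?N \<rightarrow>\<^sub>E center \<K>" by (simp add: matrix_ring_def)
  have "\<forall>p\<in>?N. \<exists>a\<in>fixed_GM. B p = skew_const a"
    using B_ext unfolding center_K by (auto simp: PiE_def Pi_def image_iff)
  then obtain c where c: "\<forall>p\<in>?N. c p \<in> fixed_GM \<and> B p = skew_const (c p)" by metis
  define x where "x = (\<lambda>\<mu>. \<Sum>p\<in>?N. c p * unit_mat (fst p) (snd p) \<mu>)"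
  have x: "x \<in> carrier \<K>"
    unfolding x_def using c by (intro linear_combination[THEN conjunct1]) (auto simp: unit_mat_K)
  have coef: "coef x i j = c (i, j)" if ij: "i < n" "j < n" for i j
  proof -
    have "coef x i j = (\<Sum>p\<in>?N. c p * coef (unit_mat (fst p) (snd p)) i j)"
      unfolding x_def using c ij by (intro coef_linear_combination) (auto simp: unit_mat_K)
    also have "\<dots> = (\<Sum>p\<in>?N. if p = (i, j) then c (i, j) else 0)"
      by (rule sum.cong) (use ij in \<open>auto simp: coef_unit_mat split: if_splits\<close>)
    also have "\<dots> = c (i, j)" using ij by simp
    finally show ?thesis .
  qed
  have "to_matrix x = B"
  proof
    fix p :: "nat \<times> nat"
    show "to_matrix x p = B p"
      using c coef PiE_arb[OF B_ext, of p] by (cases p) (auto simp: to_matrix_def)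
  qed
  then show "B \<in> to_matrix ` carrier \<K>" using x by blast
qed

text \<open>The ring axioms are transported from \<K> along the bijective homomorphism
  \<open>to_matrix\<close>. The transported structure has its carrier and zero overwritten, with the
  values they already have.\<close>

lemma ring_matrix: "ring (matrix_ring n F)"
proof -
  have "to_matrix \<zero>\<^bsub>\<K>\<^esub> = \<zero>\<^bsub>matrix_ring n F\<^esub>"
    by (auto simp: to_matrix_def matrix_ring_def K_simps coef_zero skew_const_0 fun_eq_iff)
  then have "(matrix_ring n F)\<lparr>carrier := to_matrix ` carrier \<K>, zero := to_matrix \<zero>\<^bsub>\<K>\<^esub>\<rparr> = matrix_ring n F"
    unfolding to_matrix_surj by simp
  then show ?thesis using ring.ring_hom_imp_img_ring[OF ring_K to_matrix_hom] by simp
qed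

lemma identities_matrix:
  "polynomial_identities \<K> \<eta> = polynomial_identities (matrix_ring n F) (\<lambda>c. scalar_matrix n F (\<eta> c))"
proof -
  let ?M = "matrix_ring n F" and ?s = "\<lambda>c. scalar_matrix n F (\<eta> c)"
  have hom: "ring_hom_ring \<K> ?M to_matrix"
    by (rule ring_hom_ringI2[OF ring_K ring_matrix to_matrix_hom])
  interpret ring_hom_ring \<K> ?M to_matrix by (rule hom)
  have \<kappa>_GM: "\<kappa> c \<in> fixed_GM" for c
    using \<kappa>_Gamma[of c] \<kappa>_M to_fract_in_fixed_G by (auto simp: fixed_GM_def)
  have "to_matrix (\<eta> c) = ?s c" for c
    by (auto simp: to_matrix_def scalar_matrix_def coef_const \<kappa>_GM K_simps skew_const_0 fun_eq_iff)
  then have s: "to_matrix \<circ> \<eta> = ?s" by (simp add: fun_eq_iff)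
  have \<eta>K: "range \<eta> \<subseteq> carrier \<K>" using \<eta>_in_U U_subset by blast
  have iff: "free_eval \<K> \<eta> x p = \<zero>\<^bsub>\<K>\<^esub> \<longleftrightarrow> free_eval ?M ?s (to_matrix \<circ> x) p = \<zero>\<^bsub>?M\<^esub>"
    if x: "range x \<subseteq> carrier \<K>" for x p
  proof -
    have "free_eval \<K> \<eta> x p = \<zero>\<^bsub>\<K>\<^esub> \<longleftrightarrow> to_matrix (free_eval \<K> \<eta> x p) = to_matrix \<zero>\<^bsub>\<K>\<^esub>"
      by (rule inj_on_eq_iff[OF to_matrix_inj free_eval_in_K[OF x] R.zero_closed, symmetric])
    then show ?thesis unfolding free_eval_hom[OF hom x \<eta>K] s by simp
  qed
  have ex: "\<exists>x. range x \<subseteq> carrier \<K> \<and> y = to_matrix \<circ> x" if "range y \<subseteq> carrier ?M" for y :: "nat \<Rightarrow> _"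
  proof -
    have "\<forall>i. \<exists>x\<in>carrier \<K>. y i = to_matrix x" using that unfolding to_matrix_surj[symmetric] by blast
    then obtain x where "\<forall>i. x i \<in> carrier \<K> \<and> y i = to_matrix (x i)" by metis
    then show ?thesis by (intro exI[of _ x]) auto
  qed
  have in_M: "range (to_matrix \<circ> x) \<subseteq> carrier ?M" if "range x \<subseteq> carrier \<K>" for x :: "nat \<Rightarrow> _"
    using that unfolding to_matrix_surj[symmetric] by auto
  show ?thesis
  proof (intro equalityI subsetI)
    fix p assume p: "p \<in> polynomial_identities \<K> \<eta>"
    show "p \<in> polynomial_identities ?M ?s" unfolding polynomial_identities_def
    proof (intro CollectI allI impI)
      fix y :: "nat \<Rightarrow> _" assume "range y \<subseteq> carrier ?M"
      then obtain x where x: "range x \<subseteq> carrier \<K>" "y = to_matrix \<circ> x" using ex by blast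
      have "free_eval \<K> \<eta> x p = \<zero>\<^bsub>\<K>\<^esub>" using p x(1) unfolding polynomial_identities_def by blast
      then show "free_eval ?M ?s y p = \<zero>\<^bsub>?M\<^esub>" unfolding x(2) by (rule iffD1[OF iff[OF x(1)]])
    qed
  next
    fix p assume p: "p \<in> polynomial_identities ?M ?s"
    show "p \<in> polynomial_identities \<K> \<eta>" unfolding polynomial_identities_def
    proof (intro CollectI allI impI)
      fix x :: "nat \<Rightarrow> _" assume x: "range x \<subseteq> carrier \<K>"
      have "free_eval ?M ?s (to_matrix \<circ> x) p = \<zero>\<^bsub>?M\<^esub>"
        using p in_M[OF x] unfolding polynomial_identities_def by blast
      then show "free_eval \<K> \<eta> x p = \<zero>\<^bsub>\<K>\<^esub>" by (rule iffD2[OF iff[OF x]])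
    qed
  qed
qed

section \<open>The central localization of U and its PI degree\<close>

abbreviation "CL \<equiv> central_localization R"

text \<open>The fraction attached to x without a choice of representative: all pairs whose quotient
  in \<K> is x.\<close>

definition to_fraction :: "(('a \<Rightarrow> 'a) \<Rightarrow> 'a fract) \<Rightarrow> ((('a \<Rightarrow> 'a) \<Rightarrow> 'a fract) \<times> (('a \<Rightarrow> 'a) \<Rightarrow> 'a fract)) set" where
  "to_fraction x = {(r, s). r \<in> U \<and> s \<in> central_denoms \<and> r = x \<bullet> s}"

lemma one_in_center_R: "\<one>\<^bsub>\<K>\<^esub> \<in> central_denoms"
  using Z0_const_in_center[OF Z0_closed(1)] by (simp add: K_simps)

lemma times_center_cancel:
  assumes "x \<in> carrier \<K>" "y \<in> carrier \<K>" "s \<in> central_denoms" "x \<bullet> s = y \<bullet> s"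
  shows "x = y"
proof -
  interpret ring \<K> by (rule ring_K)
  have s: "s \<in> Units \<K>" using center_R_units assms(3) by blast
  have cancel: "z \<bullet> s \<bullet> inv\<^bsub>\<K>\<^esub> s = z" if "z \<in> carrier \<K>" for z
    using that s Units_closed[OF s] by (simp add: m_assoc)
  show ?thesis using cancel[OF assms(1)] cancel[OF assms(2)] unfolding assms(4) by simp
qed

lemma center_R_mult:
  assumes s: "s \<in> central_denoms" and t: "t \<in> central_denoms"
  shows "s \<bullet> t \<in> central_denoms"
proof -
  obtain a b where ab: "a \<in> fixed_GM" "a \<noteq> 0" "s = skew_const a" "b \<in> fixed_GM" "b \<noteq> 0" "t = skew_const b"
    using center_R_nonzero[OF s] center_R_nonzero[OF t] by blast
  have eq: "s \<bullet> t = skew_const (a * b)" by (simp only: ab skew_const_times)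
  have "s \<in> U" "t \<in> U" using s t unfolding center_R by blast+
  then have "s \<bullet> t \<in> U" by (simp add: U_mult K_simps)
  moreover have "skew_const (a * b) \<in> center \<K>" using ab by (simp add: center_K fixed_GM_closed)
  ultimately have "skew_const (a * b) \<in> center R" unfolding center_R eq by blast
  then show ?thesis unfolding eq using ab by (simp add: K_simps)
qed

text \<open>With r = x s the relation r s' = r' s reads x s' s = r' s, and s, being a central unit
  of \<K>, cancels.\<close>

lemma frac_rel_class:
  assumes x: "x \<in> carrier \<K>" and r: "r \<in> U" and s: "s \<in> central_denoms" and rs: "r = x \<bullet> s"
  shows "frac_rel R `` {(r, s)} = to_fraction x"
proof -
  interpret ring \<K> by (rule ring_K)
  have sc: "s \<in> carrier \<K>" using s U_subset by (auto simp: center_R)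
  have "r \<bullet> s' = r' \<bullet> s \<longleftrightarrow> r' = x \<bullet> s'" if r': "r' \<in> U" and s': "s' \<in> central_denoms" for r' s'
  proof -
    have s'c: "s' \<in> carrier \<K>" using s' U_subset by (auto simp: center_R)
    have r'c: "r' \<in> carrier \<K>" using r' U_subset by blast
    have comm: "s \<bullet> s' = s' \<bullet> s" using s s'c unfolding center_R center_def[of \<K>] by blast
    have "r \<bullet> s' = (x \<bullet> s') \<bullet> s"
      unfolding rs using x sc s'c comm by (simp add: m_assoc)
    then show ?thesis
      using times_center_cancel[OF m_closed[OF x s'c] r'c s] by auto
  qed
  then show ?thesis using r s by (auto simp: frac_rel_def to_fraction_def)
qed

text \<open>Here central denominators enter: every element of \<K> is a fraction of U over its own
  center.\<close>

lemma to_fraction_nonempty: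
  assumes "x \<in> carrier \<K>"
  shows "\<exists>r s. r \<in> U \<and> s \<in> central_denoms \<and> r = x \<bullet> s"
proof -
  obtain z where z: "z \<in> Z0" "z \<noteq> 0" "(\<lambda>\<mu>. to_fract z * x \<mu>) \<in> U"
    using central_denominator[OF assms] by blast
  let ?s = "skew_const (to_fract z)"
  have "?s \<in> center \<K>" using Z0_const_in_center[OF z(1)] unfolding center_R by blast
  then have "?s \<bullet> x = x \<bullet> ?s" using assms unfolding center_def by blast
  from this[symmetric] have "x \<bullet> ?s = (\<lambda>\<mu>. to_fract z * x \<mu>)"
    using assms by (simp add: K_simps skew_const_mult K_in_L)
  moreover have "?s \<in> central_denoms"
    using Z0_const_in_center[OF z(1)] z(2) by (simp add: K_simps)
  ultimately show ?thesis using z(3) by metis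
qed

lemma to_fraction_inj: "inj_on to_fraction (carrier \<K>)"
proof (rule inj_onI)
  fix x y assume xy: "x \<in> carrier \<K>" "y \<in> carrier \<K>" "to_fraction x = to_fraction y"
  obtain r s where rs: "r \<in> U" "s \<in> central_denoms" "r = x \<bullet> s"
    using to_fraction_nonempty[OF xy(1)] by blast
  then have "(r, s) \<in> to_fraction y" unfolding xy(3)[symmetric] by (simp add: to_fraction_def)
  then have "r = y \<bullet> s" by (simp add: to_fraction_def)
  then show "x = y" using times_center_cancel[OF xy(1,2) rs(2)] rs(3) by simp
qed

lemma to_fraction_surj: "to_fraction ` carrier \<K> = carrier CL"
proof (intro equalityI subsetI)
  fix X assume "X \<in> to_fraction ` carrier \<K>"
  then obtain x where x: "x \<in> carrier \<K>" "X = to_fraction x" by blast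
  obtain r s where rs: "r \<in> U" "s \<in> central_denoms" "r = x \<bullet> s"
    using to_fraction_nonempty[OF x(1)] by blast
  have "X = frac_rel R `` {(r, s)}" using frac_rel_class[OF x(1) rs] x(2) by simp
  then show "X \<in> carrier CL" using rs by (auto simp: central_localization_def intro!: quotientI)
next
  interpret ring \<K> by (rule ring_K)
  fix X assume "X \<in> carrier CL"
  then obtain r s where rs: "r \<in> U" "s \<in> central_denoms" "X = frac_rel R `` {(r, s)}"
    by (auto simp: central_localization_def elim!: quotientE)
  have s: "s \<in> Units \<K>" using center_R_units rs(2) by blast
  have rc: "r \<in> carrier \<K>" using rs U_subset by blast
  have x: "r \<bullet> inv\<^bsub>\<K>\<^esub> s \<in> carrier \<K>" using s rc by simp
  have eq: "r = (r \<bullet> inv\<^bsub>\<K>\<^esub> s) \<bullet> s"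
    using s rc Units_closed[OF s] by (simp add: m_assoc)
  have "X = to_fraction (r \<bullet> inv\<^bsub>\<K>\<^esub> s)"
    unfolding rs(3) by (rule frac_rel_class[OF x rs(1,2) eq])
  then show "X \<in> to_fraction ` carrier \<K>" using x by (rule image_eqI)
qed

lemma to_fraction_hom: "to_fraction \<in> ring_hom \<K> CL"
proof (rule ring_hom_memI)
  interpret ring \<K> by (rule ring_K)
  fix x assume x: "x \<in> carrier \<K>"
  show "to_fraction x \<in> carrier CL" using x to_fraction_surj by blast
  fix y assume y: "y \<in> carrier \<K>"
  obtain r0 s0 r1 s1 where ne: "(r0, s0) \<in> to_fraction x" "(r1, s1) \<in> to_fraction y"
    using to_fraction_nonempty[OF x] to_fraction_nonempty[OF y] unfolding to_fraction_def by blast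
  \<comment> \<open>The operations of the localization are unions over all representatives. If every
    choice gives the same class C, the union is C, provided that representatives exist.\<close>
  have cancel: "(\<Union>(r, s)\<in>to_fraction x. \<Union>(r', s')\<in>to_fraction y. f r s r' s') = C"
    if "\<And>r s r' s'. (r, s) \<in> to_fraction x \<Longrightarrow> (r', s') \<in> to_fraction y \<Longrightarrow> f r s r' s' = C"
    for f and C :: "((('a \<Rightarrow> 'a) \<Rightarrow> 'a fract) \<times> (('a \<Rightarrow> 'a) \<Rightarrow> 'a fract)) set"
  proof (intro equalityI subsetI)
    fix c assume "c \<in> C"
    then have "c \<in> f r0 s0 r1 s1" using that[OF ne] by simp
    then show "c \<in> (\<Union>(r, s)\<in>to_fraction x. \<Union>(r', s')\<in>to_fraction y. f r s r' s')" using ne by blast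
  next
    fix c assume "c \<in> (\<Union>(r, s)\<in>to_fraction x. \<Union>(r', s')\<in>to_fraction y. f r s r' s')"
    then obtain r s r' s' where "(r, s) \<in> to_fraction x" "(r', s') \<in> to_fraction y" "c \<in> f r s r' s'" by blast
    then show "c \<in> C" using that by blast
  qed
  have D: "r \<in> carrier \<K>" "s \<in> carrier \<K>" "\<And>u. u \<in> carrier \<K> \<Longrightarrow> s \<bullet> u = u \<bullet> s"
    "r \<in> U" "s \<in> U" "s \<in> central_denoms" "r = z \<bullet> s"
    if "(r, s) \<in> to_fraction z" for r s z
  proof -
    have r: "r \<in> U" "s \<in> central_denoms" "r = z \<bullet> s" using that unfolding to_fraction_def by blast+
    then have s: "s \<in> U" "s \<in> center \<K>" unfolding center_R by blast+
    show "r \<in> carrier \<K>" "s \<in> carrier \<K>" using r s U_subset by blast+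
    show "s \<bullet> u = u \<bullet> s" if "u \<in> carrier \<K>" for u
      using s(2) that unfolding center_def by blast
    show "r \<in> U" "s \<in> U" "s \<in> central_denoms" "r = z \<bullet> s" by fact+
  qed
  show "to_fraction (x \<bullet> y) = to_fraction x \<otimes>\<^bsub>CL\<^esub> to_fraction y"
  proof -
    have "frac_rel R `` {(r \<bullet> r', s \<bullet> s')} = to_fraction (x \<bullet> y)"
      if rs: "(r, s) \<in> to_fraction x" and rs': "(r', s') \<in> to_fraction y" for r s r' s'
    proof (rule frac_rel_class[OF m_closed[OF x y]])
      show "r \<bullet> r' \<in> U" using D[OF rs] D[OF rs'] U_mult by (simp add: K_simps)
      show "s \<bullet> s' \<in> central_denoms" by (rule center_R_mult[OF D(6)[OF rs] D(6)[OF rs']])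
      have sy: "s \<bullet> (y \<bullet> s') = (y \<bullet> s') \<bullet> s"
        by (rule D(3)[OF rs m_closed[OF y D(2)[OF rs']]])
      have ss': "s' \<bullet> s = s \<bullet> s'" by (rule D(3)[OF rs' D(2)[OF rs]])
      have "r \<bullet> r' = x \<bullet> (s \<bullet> (y \<bullet> s'))"
        unfolding D(7)[OF rs] D(7)[OF rs'] using x y D(2)[OF rs] D(2)[OF rs'] by (simp add: m_assoc)
      also have "\<dots> = (x \<bullet> y) \<bullet> (s \<bullet> s')"
        unfolding sy using x y D(2)[OF rs] D(2)[OF rs'] ss' by (simp add: m_assoc)
      finally show "r \<bullet> r' = (x \<bullet> y) \<bullet> (s \<bullet> s')" .
    qed
    then show ?thesis by (simp add: central_localization_def cancel)
  qed
  show "to_fraction (x \<oplus>\<^bsub>\<K>\<^esub> y) = to_fraction x \<oplus>\<^bsub>CL\<^esub> to_fraction y"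
  proof -
    have "frac_rel R `` {(r \<bullet> s' \<oplus>\<^bsub>\<K>\<^esub> r' \<bullet> s, s \<bullet> s')} = to_fraction (x \<oplus>\<^bsub>\<K>\<^esub> y)"
      if rs: "(r, s) \<in> to_fraction x" and rs': "(r', s') \<in> to_fraction y" for r s r' s'
    proof (rule frac_rel_class[OF a_closed[OF x y]])
      show "r \<bullet> s' \<oplus>\<^bsub>\<K>\<^esub> r' \<bullet> s \<in> U"
        using D(4,5)[OF rs] D(4,5)[OF rs'] subringE(6,7)[OF subring_U] by blast
      show "s \<bullet> s' \<in> central_denoms" by (rule center_R_mult[OF D(6)[OF rs] D(6)[OF rs']])
      have ss': "s' \<bullet> s = s \<bullet> s'" by (rule D(3)[OF rs' D(2)[OF rs]])
      show "r \<bullet> s' \<oplus>\<^bsub>\<K>\<^esub> r' \<bullet> s = (x \<oplus>\<^bsub>\<K>\<^esub> y) \<bullet> (s \<bullet> s')"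
        unfolding D(7)[OF rs] D(7)[OF rs'] using x y D(2)[OF rs] D(2)[OF rs'] ss'
        by (simp add: m_assoc l_distr)
    qed
    then show ?thesis by (simp add: central_localization_def cancel)
  qed
next
  interpret ring \<K> by (rule ring_K)
  have "\<one>\<^bsub>\<K>\<^esub> \<in> U" by (rule subringE(3)[OF subring_U])
  then show "to_fraction \<one>\<^bsub>\<K>\<^esub> = \<one>\<^bsub>CL\<^esub>"
    using frac_rel_class[OF one_closed _ one_in_center_R] by (simp add: central_localization_def)
qed

lemma to_fraction_zero: "to_fraction \<zero>\<^bsub>\<K>\<^esub> = \<zero>\<^bsub>CL\<^esub>"
proof -
  interpret ring \<K> by (rule ring_K)
  have "\<zero>\<^bsub>\<K>\<^esub> \<in> U" by (rule subringE(2)[OF subring_U])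
  then show ?thesis
    using frac_rel_class[OF zero_closed _ one_in_center_R] by (simp add: central_localization_def)
qed

text \<open>Identifies the scalar field used in \<open>PI_deg\<close> with the image of the center
  of \<K>.\<close>

lemma to_fraction_center:
  "to_fraction ` center \<K> = {frac_rel R `` {(z, s)} | z s. z \<in> center R \<and> s \<in> central_denoms}"
proof (intro equalityI subsetI)
  fix X assume "X \<in> to_fraction ` center \<K>"
  then obtain a where a: "a \<in> fixed_GM" "X = to_fraction (skew_const a)" by (auto simp: center_K)
  obtain p q where pq: "p \<in> Z0" "q \<in> Z0" "q \<noteq> 0" "a = to_fract p / to_fract q"
    using fixed_GM_fraction[OF a(1)] by blast
  have s: "skew_const (to_fract q) \<in> central_denoms"
    using Z0_const_in_center[OF pq(2)] pq(3) by (simp add: K_simps)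
  have "skew_const a \<in> carrier \<K>" using a by (simp add: skew_const_in_K_iff fixed_GM_in_G)
  then have "frac_rel R `` {(skew_const (to_fract p), skew_const (to_fract q))} = X"
    unfolding a(2) using pq by (intro frac_rel_class s Z0_const_in_U) (simp_all add: skew_const_times)
  then show "X \<in> {frac_rel R `` {(z, s)} | z s. z \<in> center R \<and> s \<in> central_denoms}"
    using s Z0_const_in_center[OF pq(1)] by blast
next
  fix X assume "X \<in> {frac_rel R `` {(z, s)} | z s. z \<in> center R \<and> s \<in> central_denoms}"
  then obtain z s where zs: "X = frac_rel R `` {(z, s)}" "z \<in> center R" "s \<in> central_denoms" by blast
  obtain a where a: "a \<in> fixed_GM" "a \<noteq> 0" "s = skew_const a" using center_R_nonzero[OF zs(3)] by blast
  obtain b where b: "b \<in> fixed_GM" "z = skew_const b" using zs(2) by (auto simp: center_R center_K)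
  have ba: "b / a \<in> fixed_GM" by (intro fixed_GM_closed a b)
  have "X = to_fraction (skew_const (b / a))"
    unfolding zs(1)
    by (rule frac_rel_class[OF _ _ zs(3)])
       (use zs ba a b in \<open>simp_all add: skew_const_in_K_iff fixed_GM_in_G center_R skew_const_times\<close>)
  then show "X \<in> to_fraction ` center \<K>" using ba by (simp add: center_K)
qed

text \<open>Localizing U at its center gives back \<K>, so the dimension to be taken is that of \<K>
  over its center, namely n * n.\<close>

lemma PI_deg_R: "PI_deg R = real n"
proof -
  have "CL\<lparr>carrier := to_fraction ` carrier \<K>, zero := to_fraction \<zero>\<^bsub>\<K>\<^esub>\<rparr> = CL"
    unfolding to_fraction_surj to_fraction_zero by simp
  then have ring_CL: "ring CL" using ring.ring_hom_imp_img_ring[OF ring_K to_fraction_hom] by simp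
  interpret hom: ring_hom_ring \<K> CL to_fraction
    by (rule ring_hom_ringI2[OF ring_K ring_CL to_fraction_hom])
  have ne: "\<one>\<^bsub>CL\<^esub> \<noteq> \<zero>\<^bsub>CL\<^esub>"
  proof
    assume "\<one>\<^bsub>CL\<^esub> = \<zero>\<^bsub>CL\<^esub>"
    then have "to_fraction \<one>\<^bsub>\<K>\<^esub> = to_fraction \<zero>\<^bsub>\<K>\<^esub>" by simp
    then have "\<one>\<^bsub>\<K>\<^esub> = \<zero>\<^bsub>\<K>\<^esub>" using inj_onD[OF to_fraction_inj] by blast
    then show False by (simp add: K_simps)
  qed
  have sub: "subfield (to_fraction ` center \<K>) CL" by (rule hom.img_is_subfield(2)[OF subfield_center ne])
  have dim: "hom.S.dimension (n * n) (to_fraction ` center \<K>) (to_fraction ` carrier \<K>)"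
    by (rule hom.inj_hom_dimension[OF subfield_center ne to_fraction_inj dimension_K])
  have "hom.S.dim (to_fraction ` center \<K>) (carrier CL) = n * n"
    unfolding hom.S.dim_def
  proof (rule the_equality)
    show "hom.S.dimension (n * n) (to_fraction ` center \<K>) (carrier CL)" using dim unfolding to_fraction_surj .
    \<comment> \<open>\<open>dim\<close> is a definite description, so the dimension also has to be
      shown unique.\<close>
    then show "m = n * n" if "hom.S.dimension m (to_fraction ` center \<K>) (carrier CL)" for m
      using hom.S.dimension_is_inj[OF sub that] by blast
  qed
  then show ?thesis unfolding PI_deg_def to_fraction_center by (simp add: real_sqrt_mult)
qed

end

section \<open>Reduction of all assertions to finiteness of M\<close>

theorem theorem4p11:
  fixes scale :: "'k::field \<Rightarrow> 'a::idom \<Rightarrow> 'a"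
    and G M :: "('a \<Rightarrow> 'a) set"
    and U :: "(('a \<Rightarrow> 'a) \<Rightarrow> 'a fract) set"
  defines "A \<equiv> aut_group scale"
    and "\<K> \<equiv> invariant_skew_ring G M"
    and "\<eta> \<equiv> skew_scalar scale"
  defines "R \<equiv> \<K>\<lparr>carrier := U\<rparr>"
  defines "F \<equiv> fractions_in \<K> (center R)"
  assumes algebra: "commutative_algebra scale"
    and int_closed: "integrally_closed_domain TYPE('a)"
    and G: "subgroup G A" "finite G"
    and M: "subgroup M A" "\<exists>S. finite S \<and> S \<subseteq> M \<and> generate A S = M"
    and separating: "(M <#>\<^bsub>A\<^esub> set_inv\<^bsub>A\<^esub> M) \<inter> G = {\<one>\<^bsub>A\<^esub>}"
    and conjugation: "\<And>g \<mu>. g \<in> G \<Longrightarrow> \<mu> \<in> M \<Longrightarrow> g \<otimes>\<^bsub>A\<^esub> \<mu> \<otimes>\<^bsub>A\<^esub> inv\<^bsub>A\<^esub> g \<in> M"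
    and noetherian: "noetherian_over (invariants G)"
    and galois: "galois_ring G M U"
  shows "(prime_ring R \<and> PI_algebra R \<eta> \<longleftrightarrow> central_simple_algebra \<K>) \<and>
    (central_simple_algebra \<K> \<longrightarrow>
       center R - {\<zero>\<^bsub>R\<^esub>} \<subseteq> Units \<K> \<and> F = center \<K> \<and>
       finite M \<and>
       (\<exists>n. real n = PI_deg R \<and>
          polynomial_identities R \<eta> =
            polynomial_identities (matrix_ring n (\<K>\<lparr>carrier := F\<rparr>))
              (\<lambda>c. scalar_matrix n (\<K>\<lparr>carrier := F\<rparr>) (\<eta> c)) \<and>
          polynomial_identities \<K> \<eta> =
            polynomial_identities (matrix_ring n (\<K>\<lparr>carrier := F\<rparr>))
              (\<lambda>c. scalar_matrix n (\<K>\<lparr>carrier := F\<rparr>) (\<eta> c))))"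
proof -
  define \<kappa> where "\<kappa> c = to_fract (scale c 1)" for c
  have in_A: "f \<in> carrier A" if "f \<in> G \<or> f \<in> M" for f
    using that subgroup.subset[OF G(1)] subgroup.subset[OF M(1)] by blast
  have aut: "ring_aut f" if "f \<in> G \<or> f \<in> M" for f
    using in_A[OF that] by (simp add: A_def aut_group_def ring_aut_def)
  have inv_eq: "inv\<^bsub>A\<^esub> f = inv_into UNIV f" if "f \<in> G \<or> f \<in> M" for f
    using aut_group_inv[OF algebra] in_A[OF that] by (simp add: A_def)
  have A_simps: "f \<otimes>\<^bsub>A\<^esub> g = f \<circ> g" "\<one>\<^bsub>A\<^esub> = id" for f g
    by (simp_all add: A_def aut_group_def)
  interpret vector_space scale using algebra by (simp add: commutative_algebra_def)
  interpret galois_ring_setting M G U \<kappa>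
  proof unfold_locales
    show "ring_aut \<mu>" if "\<mu> \<in> M" for \<mu> using aut that by blast
    show "id \<in> M" using subgroup.one_closed[OF M(1)] by (simp add: A_simps)
    show "\<mu> \<circ> \<nu> \<in> M" if "\<mu> \<in> M" "\<nu> \<in> M" for \<mu> \<nu>
      using subgroup.m_closed[OF M(1) that] by (simp add: A_simps)
    show M_inv: "inv_into UNIV \<mu> \<in> M" if "\<mu> \<in> M" for \<mu>
      using subgroup.m_inv_closed[OF M(1) that] inv_eq that by simp
    show "finite G" by (rule G(2))
    show "ring_aut g" if "g \<in> G" for g using aut that by blast
    show "id \<in> G" using subgroup.one_closed[OF G(1)] by (simp add: A_simps)
    show "g \<circ> h \<in> G" if "g \<in> G" "h \<in> G" for g h
      using subgroup.m_closed[OF G(1) that] by (simp add: A_simps)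
    show "inv_into UNIV g \<in> G" if "g \<in> G" for g
      using subgroup.m_inv_closed[OF G(1) that] inv_eq that by simp
    show "g \<circ> \<mu> \<circ> inv_into UNIV g \<in> M" if "g \<in> G" "\<mu> \<in> M" for g \<mu>
      using conjugation[OF that] inv_eq that by (simp add: A_simps)
    show "\<mu> = id" if "\<mu> \<in> M" "\<mu> \<in> G" for \<mu>
    proof -
      \<comment> \<open>As M contains the identity, M M^-1 contains M, and the separation hypothesis
        applies to \<mu> itself.\<close>
      have idM: "id \<in> M" using subgroup.one_closed[OF M(1)] by (simp add: A_simps)
      have "inv\<^bsub>A\<^esub> id = id" using inv_eq[of id] idM by (simp add: inv_id)
      then have "id \<in> set_inv\<^bsub>A\<^esub> M" using idM unfolding SET_INV_def by force
      then have "\<mu> \<otimes>\<^bsub>A\<^esub> id \<in> M <#>\<^bsub>A\<^esub> set_inv\<^bsub>A\<^esub> M" using that unfolding set_mult_def by blast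
      then have "\<mu> \<in> (M <#>\<^bsub>A\<^esub> set_inv\<^bsub>A\<^esub> M) \<inter> G" using that by (simp add: A_simps)
      then show ?thesis unfolding separating by (simp add: A_simps)
    qed
    show "galois_ring G M U" by (rule galois)
    have scale_fix: "f (scale c 1) = scale c 1" if "f \<in> G \<or> f \<in> M" for f c
      using in_A[OF that] by (simp add: A_def aut_group_def)
    show "\<kappa> c \<in> to_fract ` invariants G" for c
      by (simp add: \<kappa>_def invariants_def scale_fix)
    show "fract_ext \<mu> (\<kappa> c) = \<kappa> c" if "\<mu> \<in> M" for \<mu> c
      using that by (simp add: \<kappa>_def fract_ext_to_fract aut scale_fix)
    show "\<kappa> 0 = 0" "\<kappa> 1 = 1" "\<kappa> (c + d) = \<kappa> c + \<kappa> d" for c d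
      by (simp_all add: \<kappa>_def scale_left_distrib)
  qed
  have eta: "\<eta> = (\<lambda>c. skew_const (\<kappa> c))"
    by (simp add: \<eta>_def skew_scalar_def \<kappa>_def fun_eq_iff)
  \<comment> \<open>For finite M everything holds, with n = \<open>card M\<close>. What then remains
    is that either side of the equivalence forces M to be finite.\<close>
  have main: "PI_algebra R \<eta> \<and> central_simple_algebra \<K> \<and>
      center R - {\<zero>\<^bsub>R\<^esub>} \<subseteq> Units \<K> \<and> F = center \<K> \<and>
      (\<exists>n. real n = PI_deg R \<and>
          polynomial_identities R \<eta> =
            polynomial_identities (matrix_ring n (\<K>\<lparr>carrier := F\<rparr>))
              (\<lambda>c. scalar_matrix n (\<K>\<lparr>carrier := F\<rparr>) (\<eta> c)) \<and>
          polynomial_identities \<K> \<eta> =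
            polynomial_identities (matrix_ring n (\<K>\<lparr>carrier := F\<rparr>))
              (\<lambda>c. scalar_matrix n (\<K>\<lparr>carrier := F\<rparr>) (\<eta> c)))"
    if fin: "finite M"
  proof -
    obtain v T where vT: "\<forall>i<card M. v i \<in> fixed_G" "\<forall>i<card M. T i \<in> carrier (invariant_skew_ring G M)"
      "\<forall>i<card M. \<forall>j<card M. act (T i) (v j) = (if i = j then 1 else 0)"
      "\<forall>i<card M. \<forall>w\<in>fixed_G. act (T i) w \<in> fixed_GM"
      "\<forall>w\<in>fixed_G. w = (\<Sum>i<card M. act (T i) w * v i)"
      using K_dual_basis[OF fin] by (elim exE conjE)
    interpret matrix_units_setting M G U \<kappa> "card M" v T
      by unfold_locales (use fin vT in auto)
    have FK: "F = center \<K>" unfolding F_def R_def \<K>_def by (rule fractions_center_R)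
    have *: "polynomial_identities \<K> \<eta> =
            polynomial_identities (matrix_ring (card M) (\<K>\<lparr>carrier := F\<rparr>))
              (\<lambda>c. scalar_matrix (card M) (\<K>\<lparr>carrier := F\<rparr>) (\<eta> c))"
      unfolding FK eta unfolding \<K>_def by (rule identities_matrix)
    have "polynomial_identities R \<eta> = polynomial_identities \<K> \<eta>"
      unfolding eta R_def \<K>_def by (rule identities_R_eq_K)
    then have "\<exists>n. real n = PI_deg R \<and>
          polynomial_identities R \<eta> =
            polynomial_identities (matrix_ring n (\<K>\<lparr>carrier := F\<rparr>))
              (\<lambda>c. scalar_matrix n (\<K>\<lparr>carrier := F\<rparr>) (\<eta> c)) \<and>
          polynomial_identities \<K> \<eta> =
            polynomial_identities (matrix_ring n (\<K>\<lparr>carrier := F\<rparr>))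
              (\<lambda>c. scalar_matrix n (\<K>\<lparr>carrier := F\<rparr>) (\<eta> c))"
      using * PI_deg_R unfolding R_def \<K>_def by (intro exI[of _ "card M"]) simp
    then show ?thesis
      using PI_R central_simple_K center_R_units FK unfolding eta R_def \<K>_def by blast
  qed
  have "finite M" if "PI_algebra R \<eta>"
    using that finite_M_if_PI unfolding eta R_def \<K>_def by blast
  moreover have "finite M" if "central_simple_algebra \<K>"
    using that finite_M_if_finite_dimension unfolding central_simple_algebra_def \<K>_def by blast
  moreover have "prime_ring R" unfolding R_def \<K>_def by (rule prime_R)
  ultimately show ?thesis using main by blast
qed

end
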